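(* For the graded quotient space $\mathcal Q_{4,\mathbb C}=\mathcal W_4/\mathcal A_{4,\mathbb C}^+\mathcal W_4$ we have $$\dim_{\mathbb C}\mathcal Q_{4,\mathbb C}^{(0)}=1,\quad \dim_{\mathbb C}\mathcal Q_{4,\mathbb C}^{(1)}=8,\quad \dim_{\mathbb C}\mathcal Q_{4,\mathbb C}^{(2)}=18,\quad \dim_{\mathbb C}\mathcal Q_{4,\mathbb C}^{(3)}=12,$$ while $\mathcal Q_{4,\mathbb C}^{(k)}=0$ for $k\ge4$. In particular, $\dim_{\mathbb C}\mathcal Q_{4,\mathbb C}=1+8+18+12=39$. One minimal homogeneous generating system of $\mathcal W_4$ over $\mathcal A_{4,\mathbb C}$ can be chosen as follows: (1) one element of $C$-degree $0$: $D_{123}D_{124}D_{134}D_{234}$; (2) eight elements of $C$-degree $1$: $F_{21},F_{31},F_{12},F_{32},F_{13},F_{23},F_{14},F_{24}$; (3) eighteen elements of $C$-degree $2$: $G_{i\mid r}$ for $i\ne r$ in $\{1,2,3,4\}$ (twelve elements), and $H_{ab}$ for $1\le a<b\le4$ (six elements); (4) twelve elements of $C$-degree $3$: $K_{ab;c}$ for $1\le a<b\le 4$ and $c\in\{1,2,3,4\}\setminus\{a,b\}$.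
   Context: $\mathcal M_4=\{(A_i,\ell_i)_{i=1}^4\in(\mathbb C^3\oplus(\mathbb C^3)^* )^4\mid \ell_iA_i=0,\ i=1,\dots,4\}$ ($A_i$ columns, $\ell_i$ rows), with coordinate ring $\mathbb C[\mathcal M_4]$. $SL(3,\mathbb C)$ acts by $A_i\mapsto GA_i$, $\ell_i\mapsto\ell_iG^{-1}$, and $\mathbb T_4=(\mathbb C^\times)^4$ acts by $A_i\mapsto t_iA_i$, $\ell_i\mapsto t_i^{-1}\ell_i$. Define $$\mathcal W_4=\{H\in\mathbb C[\mathcal M_4]^{SL(3,\mathbb C)}\mid H(\mathbf t\cdot z)=(t_1t_2t_3t_4)^{-3}H(z)\ \ \forall\,\mathbf t\in\mathbb T_4\}.$$ ($\mathcal W_4$ is the complexification of the space of polynomial relative first-order differential projective invariants of weight $-1$ of four points.) $\mathcal A_{4,\mathbb C}$ is the complex algebra of polynomial absolute invariants, identified with $\mathbb C[\mathcal M_4]^{SL(3,\mathbb C)\times\mathbb T_4}$; it acts on $\mathcal W_4$ by multiplication. Both are graded by $C$-degree, which is the total degree in the coordinates of $A_1,\dots,A_4$ (for monomials in $D_{ijk}=\det(\ell_i,\ell_j,\ell_k)$ and $C_{ij}=\ell_iA_j$, this is the number of factors $C_{ij}$). $\mathcal A_{4,\mathbb C}^+=\bigoplus_{k>0}(\mathcal A_{4,\mathbb C})_k$, and $\mathcal Q_{4,\mathbb C}=\bigoplus_k\mathcal Q_{4,\mathbb C}^{(k)}$ carries the induced grading. Put $d_1=D_{234}$, $d_2=-D_{134}$,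 $d_3=D_{124}$, $d_4=-D_{123}$. - For $i\ne j$ with $\{p,q\}=\{1,2,3,4\}\setminus\{i,j\}$: $F_{ij}=d_i^2d_pd_qC_{ij}$. - For $i\ne r$ with $\{p,q\}=\{1,2,3,4\}\setminus\{i,r\}$: $G_{i\mid r}=d_i^3d_rC_{ip}C_{iq}$. - For $1\le a<b\le4$ with $\{p,q\}=\{1,2,3,4\}\setminus\{a,b\}$, $p<q$: $H_{ab}=d_a^2d_b^2C_{ap}C_{bq}$, $K_{ab;p}=d_a^2d_b^2C_{ap}C_{bp}C_{pq}$, $K_{ab;q}=d_a^2d_b^2C_{aq}C_{bq}C_{qp}$. *)

theory Defs
  imports "HOL-Analysis.Analysis" "HOL-Library.Function_Algebras"
begin

section \<open>The variety, its coordinate ring and the group actions\<close>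

text \<open>
  A configuration is a pair of families: the columns \<open>A\<^sub>i\<close> in the first component, the rows
  \<open>\<ell>\<^sub>i\<close> in the second.  The index type \<^typ>\<open>4\<close> has the four elements \<open>1, 2, 3, 4\<close>, where
  \<open>4 = 0\<close>; its order is therefore not the one of the numbers \<open>1 < 2 < 3 < 4\<close> and is never used.
\<close>

type_synonym config = "((complex ^ 3) ^ 4) \<times> ((complex ^ 3) ^ 4)"

abbreviation colA :: "config \<Rightarrow> 4 \<Rightarrow> complex ^ 3"
  where "colA z i \<equiv> fst z $ i"

abbreviation rowL :: "config \<Rightarrow> 4 \<Rightarrow> complex ^ 3"
  where "rowL z i \<equiv> snd z $ i"

definition M4 :: "config set"
  where "M4 = {z. \<forall>i. scalar_product (rowL z i) (colA z i) = 0}"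

definition SL3 :: "(complex ^ 3 ^ 3) set"
  where "SL3 = {G. det G = 1}"

definition T4 :: "(complex ^ 4) set"
  where "T4 = {t. \<forall>i. t $ i \<noteq> 0}"

definition sl_act :: "complex ^ 3 ^ 3 \<Rightarrow> config \<Rightarrow> config"
  where "sl_act G z = ((\<chi> i. G *v colA z i), (\<chi> i. rowL z i v* matrix_inv G))"

definition torus_act :: "complex ^ 4 \<Rightarrow> config \<Rightarrow> config"
  where "torus_act t z = ((\<chi> i. t $ i *s colA z i), (\<chi> i. inverse (t $ i) *s rowL z i))"

text \<open>
  Ring operations on functions are the pointwise ones of \<^theory>\<open>HOL-Library.Function_Algebras\<close>.
\<close>

definition cscale :: "complex \<Rightarrow> ('a \<Rightarrow> complex) \<Rightarrow> 'a \<Rightarrow> complex"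
  where "cscale c f = (\<lambda>z. c * f z)"

global_interpretation cfun: vector_space "cscale :: complex \<Rightarrow> ('a \<Rightarrow> complex) \<Rightarrow> 'a \<Rightarrow> complex"
  by unfold_locales (auto simp: cscale_def fun_eq_iff algebra_simps)

text \<open>
  A function on \<^const>\<open>M4\<close> is represented by its extension by zero, so that equality in the
  coordinate ring is equality of HOL functions.
\<close>

definition on_M4 :: "(config \<Rightarrow> complex) \<Rightarrow> config \<Rightarrow> complex"
  where "on_M4 f = (\<lambda>z. if z \<in> M4 then f z else 0)"

definition monom_fun :: "(4 \<Rightarrow> 3 \<Rightarrow> nat) \<Rightarrow> (4 \<Rightarrow> 3 \<Rightarrow> nat) \<Rightarrow> config \<Rightarrow> complex"
  where "monom_fun \<alpha> \<beta> z =
    (\<Prod>i\<in>UNIV. \<Prod>a\<in>UNIV. (colA z i $ a) ^ \<alpha> i a) * (\<Prod>i\<in>UNIV. \<Prod>a\<in>UNIV. (rowL z i $ a) ^ \<beta> i a)"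

definition coord_ring :: "(config \<Rightarrow> complex) set"
  where "coord_ring = cfun.span {on_M4 (monom_fun \<alpha> \<beta>) | \<alpha> \<beta>. True}"

text \<open>The part of \<open>C\<close>-degree \<open>k\<close>: total degree \<open>k\<close> in the coordinates of the columns only.\<close>

definition coord_ring_deg :: "nat \<Rightarrow> (config \<Rightarrow> complex) set"
  where "coord_ring_deg k =
    cfun.span {on_M4 (monom_fun \<alpha> \<beta>) | \<alpha> \<beta>. (\<Sum>i\<in>UNIV. \<Sum>a\<in>UNIV. \<alpha> i a) = k}"

definition SL_invariants :: "(config \<Rightarrow> complex) set"
  where "SL_invariants = {H \<in> coord_ring. \<forall>G\<in>SL3. \<forall>z\<in>M4. H (sl_act G z) = H z}"


section \<open>Absolute and relative invariants\<close>

definition A4 :: "(config \<Rightarrow> complex) set"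
  where "A4 = {H \<in> SL_invariants. \<forall>t\<in>T4. \<forall>z\<in>M4. H (torus_act t z) = H z}"

definition W4 :: "(config \<Rightarrow> complex) set"
  where "W4 = {H \<in> SL_invariants.
    \<forall>t\<in>T4. \<forall>z\<in>M4. H (torus_act t z) = (\<Prod>i\<in>UNIV. t $ i) powi (-3) * H z}"

definition A4_deg :: "nat \<Rightarrow> (config \<Rightarrow> complex) set"
  where "A4_deg k = A4 \<inter> coord_ring_deg k"

definition W4_deg :: "nat \<Rightarrow> (config \<Rightarrow> complex) set"
  where "W4_deg k = W4 \<inter> coord_ring_deg k"

definition A4_plus :: "(config \<Rightarrow> complex) set"
  where "A4_plus = cfun.span (\<Union>k\<in>{0<..}. A4_deg k)"

definition A4_plus_W4 :: "(config \<Rightarrow> complex) set"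
  where "A4_plus_W4 = cfun.span {a * w | a w. a \<in> A4_plus \<and> w \<in> W4}"


section \<open>The quotient space\<close>

text \<open>
  The type \<open>cosets\<close> consists of the cosets \<open>f + A4_plus_W4\<close> of arbitrary functions \<open>f\<close>; the quotient
  of \<^const>\<open>W4\<close> is the subspace of the cosets of elements of \<^const>\<open>W4\<close>.
\<close>

definition coset_rel :: "(config \<Rightarrow> complex) \<Rightarrow> (config \<Rightarrow> complex) \<Rightarrow> bool"
  where "coset_rel f g \<longleftrightarrow> f - g \<in> A4_plus_W4"

lemma coset_rel_add:
  assumes "coset_rel f f'" "coset_rel g g'"
  shows "coset_rel (f + g) (f' + g')"
proof -
  have "(f - f') + (g - g') \<in> A4_plus_W4"
    using assms unfolding coset_rel_def A4_plus_W4_def by (intro cfun.span_add)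
  then show ?thesis
    unfolding coset_rel_def by (simp only: add_diff_add)
qed

lemma coset_rel_scale:
  assumes "coset_rel f f'"
  shows "coset_rel (cscale c f) (cscale c f')"
proof -
  have "cscale c (f - f') \<in> A4_plus_W4"
    using assms unfolding coset_rel_def A4_plus_W4_def by (intro cfun.span_scale)
  then show ?thesis
    unfolding coset_rel_def by (simp only: cfun.scale_right_diff_distrib)
qed

lemma equivp_coset_rel: "equivp coset_rel"
proof (rule equivpI)
  show "reflp coset_rel"
    unfolding coset_rel_def A4_plus_W4_def by (rule reflpI) (simp only: diff_self cfun.span_zero)
  show "symp coset_rel"
  proof (rule sympI)
    fix f g assume "coset_rel f g"
    then have "- (f - g) \<in> A4_plus_W4"
      unfolding coset_rel_def A4_plus_W4_def by (rule cfun.span_neg)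
    then show "coset_rel g f"
      unfolding coset_rel_def by (simp only: minus_diff_eq)
  qed
  show "transp coset_rel"
  proof (rule transpI)
    fix f g h assume "coset_rel f g" "coset_rel g h"
    then have "(f - g) + (g - h) \<in> A4_plus_W4"
      unfolding coset_rel_def A4_plus_W4_def by (rule cfun.span_add)
    then show "coset_rel f h"
      unfolding coset_rel_def by (simp only: diff_add_cancel add_diff_eq)
  qed
qed

quotient_type cosets = "config \<Rightarrow> complex" / coset_rel
  morphisms rep_coset coset_of
  by (rule equivp_coset_rel)

instantiation cosets :: ab_group_add
begin

lift_definition zero_cosets :: cosets is 0 .

lift_definition plus_cosets :: "cosets \<Rightarrow> cosets \<Rightarrow> cosets" is "(+)"
  by (rule coset_rel_add)

lift_definition uminus_cosets :: "cosets \<Rightarrow> cosets" is "cscale (-1)"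
  by (rule coset_rel_scale)

definition minus_cosets :: "cosets \<Rightarrow> cosets \<Rightarrow> cosets"
  where "minus_cosets x y = x + (- y)"

instance
proof
  fix a b c :: cosets
  have eq: "f = g \<Longrightarrow> coset_rel f g" for f g
    using equivp_coset_rel by (simp add: equivp_reflp)
  show "a + b + c = a + (b + c)"
    by transfer (rule eq, simp add: algebra_simps)
  show "a + b = b + a"
    by transfer (rule eq, simp add: algebra_simps)
  show "0 + a = a"
    by transfer (rule eq, simp)
  show "- a + a = 0"
    by transfer (rule eq, simp add: cscale_def fun_eq_iff)
  show "a - b = a + - b"
    by (rule minus_cosets_def)
qed

end

lift_definition qscale :: "complex \<Rightarrow> cosets \<Rightarrow> cosets" is cscale
  by (rule coset_rel_scale)

global_interpretation quot: vector_space qscale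
proof
  fix a b :: complex and x y :: cosets
  have eq: "f = g \<Longrightarrow> coset_rel f g" for f g
    using equivp_coset_rel by (simp add: equivp_reflp)
  show "qscale a (x + y) = qscale a x + qscale a y"
    by transfer (rule eq, rule cfun.scale_right_distrib)
  show "qscale (a + b) x = qscale a x + qscale b x"
    by transfer (rule eq, rule cfun.scale_left_distrib)
  show "qscale a (qscale b x) = qscale (a * b) x"
    by transfer (rule eq, rule cfun.scale_scale)
  show "qscale 1 x = x"
    by transfer (rule eq, rule cfun.scale_one)
qed

definition Q4 :: "cosets set"
  where "Q4 = coset_of ` W4"

definition Q4_deg :: "nat \<Rightarrow> cosets set"
  where "Q4_deg k = coset_of ` W4_deg k"


section \<open>Generating systems\<close>

definition A4_generated :: "(config \<Rightarrow> complex) set \<Rightarrow> (config \<Rightarrow> complex) set"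
  where "A4_generated S = {\<Sum>g\<in>F. a g * g | F a. finite F \<and> F \<subseteq> S \<and> (\<forall>g\<in>F. a g \<in> A4)}"

definition minimal_homogeneous_generating_system :: "(config \<Rightarrow> complex) set \<Rightarrow> bool"
  where "minimal_homogeneous_generating_system S \<longleftrightarrow>
    S \<subseteq> (\<Union>k. W4_deg k) \<and> A4_generated S = W4 \<and> (\<forall>S'. S' \<subset> S \<longrightarrow> A4_generated S' \<noteq> W4)"


section \<open>The explicit invariants\<close>

definition D :: "4 \<Rightarrow> 4 \<Rightarrow> 4 \<Rightarrow> config \<Rightarrow> complex"
  where "D i j k = on_M4 (\<lambda>z. det (vector [rowL z i, rowL z j, rowL z k] :: complex ^ 3 ^ 3))"

definition C :: "4 \<Rightarrow> 4 \<Rightarrow> config \<Rightarrow> complex"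
  where "C i j = on_M4 (\<lambda>z. scalar_product (rowL z i) (colA z j))"

definition d :: "4 \<Rightarrow> config \<Rightarrow> complex"
  where "d i = (if i = 1 then D 2 3 4 else if i = 2 then - D 1 3 4
                else if i = 3 then D 1 2 4 else - D 1 2 3)"

definition F_inv :: "4 \<Rightarrow> 4 \<Rightarrow> config \<Rightarrow> complex"
  where "F_inv i j = d i ^ 2 * (\<Prod>p\<in>UNIV - {i, j}. d p) * C i j"

definition G_inv :: "4 \<Rightarrow> 4 \<Rightarrow> config \<Rightarrow> complex"
  where "G_inv i r = d i ^ 3 * d r * (\<Prod>p\<in>UNIV - {i, r}. C i p)"

text \<open>
  \<open>H_inv a b p q\<close> is \<open>H\<^bsub>ab\<^esub>\<close> and \<open>K_inv a b p q\<close> is \<open>K\<^bsub>ab;p\<^esub>\<close>; in both, \<open>{p, q}\<close> is the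
  complement of \<open>{a, b}\<close>, with \<open>p < q\<close> for \<open>H\<close> and in either order for \<open>K\<close>.
\<close>

definition H_inv :: "4 \<Rightarrow> 4 \<Rightarrow> 4 \<Rightarrow> 4 \<Rightarrow> config \<Rightarrow> complex"
  where "H_inv a b p q = d a ^ 2 * d b ^ 2 * C a p * C b q"

definition K_inv :: "4 \<Rightarrow> 4 \<Rightarrow> 4 \<Rightarrow> 4 \<Rightarrow> config \<Rightarrow> complex"
  where "K_inv a b p q = d a ^ 2 * d b ^ 2 * C a p * C b p * C p q"

text \<open>The pairs \<open>(a, b)\<close> with \<open>1 \<le> a < b \<le> 4\<close>.\<close>

definition ordered_pairs :: "(4 \<times> 4) set"
  where "ordered_pairs = {(1, 2), (1, 3), (1, 4), (2, 3), (2, 4), (3, 4)}"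

definition gens0 :: "(config \<Rightarrow> complex) set"
  where "gens0 = {D 1 2 3 * D 1 2 4 * D 1 3 4 * D 2 3 4}"

definition gens1 :: "(config \<Rightarrow> complex) set"
  where "gens1 = {F_inv 2 1, F_inv 3 1, F_inv 1 2, F_inv 3 2, F_inv 1 3, F_inv 2 3, F_inv 1 4, F_inv 2 4}"

definition gens2_G :: "(config \<Rightarrow> complex) set"
  where "gens2_G = {G_inv i r | i r. i \<noteq> r}"

definition gens2_H :: "(config \<Rightarrow> complex) set"
  where "gens2_H = {H_inv a b p q | a b p q.
    (a, b) \<in> ordered_pairs \<and> (p, q) \<in> ordered_pairs \<and> {p, q} = UNIV - {a, b}}"

definition gens3 :: "(config \<Rightarrow> complex) set"
  where "gens3 = {K_inv a b p q | a b p q. (a, b) \<in> ordered_pairs \<and> {p, q} = UNIV - {a, b}}"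

end

theory Submission
  imports Defs "HOL-Computational_Algebra.Polynomial"
begin

text \<open>
  A monomial in the \<open>d\<^sub>i\<close> and \<open>C\<^sub>i\<^sub>j\<close> is encoded by the directed multigraph \<open>E\<close> of its factors \<open>C\<^sub>i\<^sub>j\<close>:
  the torus weight determines the exponents of the \<open>d\<^sub>i\<close>.  The only relations that are used are
  \<open>\<Sum>\<^sub>i d\<^sub>i C\<^sub>i\<^sub>j = 0\<close>; they replace an edge \<open>i \<rightarrow> j\<close> by the two other edges into \<open>j\<close>.

  First fundamental theorem: where \<open>d\<^sub>4 \<noteq> 0\<close>, an invariant is determined by its values on a slice with
  \<open>\<ell>\<^sub>1, \<ell>\<^sub>2, \<ell>\<^sub>3\<close> proportional to the standard basis, so it becomes a polynomial in the \<open>d\<^sub>i\<close> and \<open>C\<^sub>i\<^sub>j\<close> after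
  multiplication with a power of \<open>d\<^sub>4\<close>.  This power is cancelled one factor at a time: a multihomogeneous
  polynomial of positive \<open>d\<close>-degree that vanishes on \<open>d\<^sub>4 = 0\<close> is reduced modulo \<open>d\<^sub>4\<close> to normal forms
  that are linearly independent on \<open>d\<^sub>4 = 0\<close>.

  A graph that contains a directed cycle lies in \<open>A\<^sup>+ W\<close>, and the relations reduce the acyclic
  graphs to the 39 generators.  Conversely, at configurations where only two columns \<open>A\<^sub>p, A\<^sub>q\<close> are nonzero and
  \<open>C\<^sub>q\<^sub>p = 0\<close>, every monomial with a cycle vanishes, and evaluation there shows that the
  generators are independent modulo \<open>A\<^sup>+ W\<close>.
\<close>

section \<open>Weights of an algebraic torus\<close>

text \<open>Division by \<open>d 4\<close> fails in \<open>d\<close>-degree 0. The 3 x 3 determinant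
  of the \<open>C i j\<close> with rows 1, 2, 3 and columns 1, 2, 4 vanishes where
  \<open>d 4\<close> does, but the quotient is, up to sign, the determinant of A_1, A_2, A_4, which
  is not a polynomial in the \<open>d i\<close> and \<open>C i j\<close>. A spare factor lets the
  linear relations act: if R_i denotes row i of the \<open>C i j\<close>, then d_1 det(R_1, R_2,
  R_3) = - d_4 det(R_4, R_2, R_3). Invariants of weight exponent \<open>e\<close> have
  \<open>d\<close>-degree 4e, so before each cancellation the \<open>d\<close>-degree is positive,
  even for e = 0.

  The numbers of generators count graphs. There are 12 edges and one relation for each of the 4
  heads, which leaves 8. With two edges there are 12 forks and, for each pair of heads, two
  matchings of which one is kept: 12 + 6 = 18. With three edges there is one graph for each ordered
  pair (p, q): the two other vertices point to p, and p points to q. Acyclic graphs with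
  \<open>ind E i \<le> outd E i + 1\<close> are finite in number, and exchanging edges reduces the
  remaining ones to these and to graphs with cycles.\<close>

lemma prod_UNIV_3: "prod f (UNIV::3 set) = f 1 * f 2 * f 3"
  unfolding UNIV_3 by (simp add: ac_simps)

lemma prod_UNIV_4: "prod f (UNIV::4 set) = f 1 * f 2 * f 3 * f 4"
  unfolding UNIV_4 by (simp add: ac_simps)

definition tchar :: "('i::finite \<Rightarrow> int) \<Rightarrow> ('i \<Rightarrow> complex) \<Rightarrow> complex"
  where "tchar w s = (\<Prod>i\<in>UNIV. s i powi w i)"

abbreviation torus :: "('i \<Rightarrow> complex) set"
  where "torus \<equiv> {s. \<forall>i. s i \<noteq> 0}"

lemma tchar_mult: "tchar w (\<lambda>i. s i * t i) = tchar w s * tchar w t"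
  by (simp add: tchar_def power_int_mult_distrib prod.distrib)

lemma tchar_one: "tchar w (\<lambda>i. 1) = 1"
  by (simp add: tchar_def)

lemma tchar_separates:
  assumes "w \<noteq> w'"
  shows "\<exists>s\<in>torus. tchar w s \<noteq> tchar w' s"
proof -
  obtain i where i: "w i \<noteq> w' i" using assms by auto
  \<comment> \<open>The number 2 is not a root of unity, so its integer powers are distinct; the
    norm moves the comparison to the reals, where exponentiation with base 2 is strictly
    monotone.\<close>
  define s where "s = (\<lambda>j. if j = i then 2 else (1::complex))"
  have "tchar v s = 2 powi v i" for v
  proof -
    have "tchar v s = (\<Prod>j\<in>UNIV. if j = i then 2 powi v i else 1)"
      unfolding tchar_def s_def by (rule prod.cong) auto
    then show ?thesis by simp
  qed
  moreover have "(2::complex) powi w i \<noteq> 2 powi w' i"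
  proof
    assume "(2::complex) powi w i = 2 powi w' i"
    then have "norm ((2::complex) powi w i) = norm ((2::complex) powi w' i)" by simp
    then have "(2::real) powi w i = 2 powi w' i" by (simp add: norm_power_int)
    then show False
      using i by (metis linorder_neq_iff one_less_numeral_iff power_int_strict_increasing semiring_norm(76))
  qed
  ultimately show ?thesis by (intro bexI[of _ s]) (auto simp: s_def)
qed

text \<open>Dedekind's independence of characters. Subtracting \<open>tchar v t\<close> times the
  relation at \<open>s\<close> from the relation at the product of \<open>s\<close> and
  \<open>t\<close> eliminates \<open>v\<close>; the induction hypothesis gives
  \<open>a w * (tchar w t - tchar v t) = 0\<close>, and a separating \<open>t\<close> makes the
  second factor nonzero.\<close>

lemma tchar_independent:
  assumes "finite K" and "\<And>s. s \<in> torus \<Longrightarrow> (\<Sum>w\<in>K. a w * tchar w s) = 0"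
  shows "\<forall>w\<in>K. a w = 0"
  using assms
proof (induction K arbitrary: a rule: finite_induct)
  case (insert v K)
  have vanish: "a w * (tchar w t - tchar v t) = 0" if "w \<in> K" "t \<in> torus" for w t
  proof -
    have "(\<Sum>w\<in>K. (a w * (tchar w t - tchar v t)) * tchar w s) = 0" if s: "s \<in> torus" for s
    proof -
      have "(\<lambda>i. s i * t i) \<in> torus" using s \<open>t \<in> torus\<close> by auto
      from insert.prems[OF this] insert.prems[OF s]
      have "a v * (tchar v s * tchar v t) + (\<Sum>w\<in>K. a w * (tchar w s * tchar w t)) = 0"
        and "a v * tchar v s + (\<Sum>w\<in>K. a w * tchar w s) = 0"
        using insert.hyps by (auto simp: tchar_mult)
      then have "(\<Sum>w\<in>K. a w * (tchar w s * tchar w t)) = (\<Sum>w\<in>K. a w * tchar w s) * tchar v t"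
        by algebra
      then show ?thesis
        by (simp add: algebra_simps sum_subtractf sum_distrib_left sum_distrib_right)
    qed
    from insert.IH[of "\<lambda>w. a w * (tchar w t - tchar v t)", OF this] show ?thesis
      using \<open>w \<in> K\<close> by blast
  qed
  have K: "\<forall>w\<in>K. a w = 0"
  proof
    fix w assume w: "w \<in> K"
    then have "w \<noteq> v" using insert.hyps by auto
    then obtain t where "t \<in> torus" "tchar w t \<noteq> tchar v t" using tchar_separates by blast
    then show "a w = 0" using vanish[OF w, of t] by simp
  qed
  moreover have "a v = 0"
    using insert.prems[of "\<lambda>i. 1"] K insert.hyps by (simp add: tchar_one)
  ultimately show ?case by simp
qed simp

section \<open>Weight components of a function in a span\<close>

lemma sum_fun_apply: "(\<Sum>a\<in>A. f a) x = (\<Sum>a\<in>A. f a x)"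
  by (induction A rule: infinite_finite_induct) auto

lemma span_image_finite_sum:
  assumes "f \<in> cfun.span (\<phi> ` I)"
  obtains F a where "finite F" "F \<subseteq> I" "f = (\<lambda>z. \<Sum>i\<in>F. a i * \<phi> i z)"
proof -
  obtain T r where T: "finite T" "T \<subseteq> \<phi> ` I" and f: "f = (\<Sum>x\<in>T. cscale (r x) x)"
    using assms unfolding cfun.span_explicit by auto
  \<comment> \<open>\<open>\<phi>\<close> may identify indices; on \<open>F\<close> it is injective,
    so the coefficients can be indexed by \<open>i\<close> itself.\<close>
  obtain F where F: "F \<subseteq> I" "inj_on \<phi> F" "\<phi> ` F = T"
    using T(2) by (metis subset_image_inj)
  have "f z = (\<Sum>i\<in>F. r (\<phi> i) * \<phi> i z)" for z
  proof -
    have "f z = (\<Sum>x\<in>T. r x * x z)" unfolding f by (simp add: cscale_def sum_fun_apply)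
    also have "\<dots> = (\<Sum>i\<in>F. r (\<phi> i) * \<phi> i z)"
      using F by (simp add: sum.reindex flip: F(3))
    finally show ?thesis .
  qed
  moreover have "finite F" using F T finite_image_iff by fastforce
  ultimately show ?thesis using that[of F "\<lambda>i. r (\<phi> i)"] F by blast
qed

lemma finite_sum_in_span:
  assumes "F \<subseteq> I"
  shows "(\<lambda>z. \<Sum>i\<in>F. a i * \<phi> i z) \<in> cfun.span (\<phi> ` I)"
proof -
  have "(\<lambda>z. \<Sum>i\<in>F. a i * \<phi> i z) = (\<Sum>i\<in>F. cscale (a i) (\<phi> i))"
    by (auto simp: fun_eq_iff cscale_def sum_fun_apply)
  also have "\<dots> \<in> cfun.span (\<phi> ` I)"
    using assms by (intro cfun.span_sum cfun.span_scale cfun.span_base) auto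
  finally show ?thesis .
qed

text \<open>Independence of characters, applied at each point \<open>z\<close>, shows that in an
  expansion of \<open>f\<close> only the part of weight \<open>w\<close> survives. The
  \<open>\<phi> i\<close> may satisfy linear relations, so the expansion is not unique; any one
  serves.\<close>

lemma span_weight:
  fixes act :: "('i::finite \<Rightarrow> complex) \<Rightarrow> 'a \<Rightarrow> 'a"
  assumes f: "f \<in> cfun.span (\<phi> ` I)"
    and \<phi>: "\<And>i s z. i \<in> I \<Longrightarrow> s \<in> torus \<Longrightarrow> \<phi> i (act s z) = tchar (wt i) s * \<phi> i z"
    and fw: "\<And>s z. s \<in> torus \<Longrightarrow> f (act s z) = tchar w s * f z"
  shows "f \<in> cfun.span (\<phi> ` {i \<in> I. wt i = w})"
proof -
  obtain F a where F: "finite F" "F \<subseteq> I" and fs: "f = (\<lambda>z. \<Sum>i\<in>F. a i * \<phi> i z)"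
    using span_image_finite_sum[OF f] by metis
  \<comment> \<open>\<open>w\<close> need not occur among the weights of \<open>F\<close>; including
    it makes \<open>g w\<close> an empty sum in that case, and \<open>f\<close> is then
    zero.\<close>
  define K where "K = insert w (wt ` F)"
  define g where "g v z = (\<Sum>i\<in>{i\<in>F. wt i = v}. a i * \<phi> i z)" for v z
  have fg: "f z = (\<Sum>v\<in>K. g v z)" for z
    unfolding fs g_def K_def using F by (intro sum.group[symmetric]) auto
  have "\<forall>v\<in>K. g v z - (if v = w then f z else 0) = 0" for z
  proof (rule tchar_independent)
    show "finite K" using F by (simp add: K_def)
    fix s :: "'i \<Rightarrow> complex" assume s: "s \<in> torus"
    have "f (act s z) = (\<Sum>v\<in>K. g v (act s z))" by (rule fg)
    also have "\<dots> = (\<Sum>v\<in>K. g v z * tchar v s)"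
      using F by (intro sum.cong refl) (auto simp: g_def sum_distrib_right \<phi>[OF _ s] intro!: sum.cong)
    finally have "(\<Sum>v\<in>K. g v z * tchar v s) = f z * tchar w s"
      by (simp add: fw[OF s] mult.commute)
    moreover have "(\<Sum>v\<in>K. (if v = w then f z else 0) * tchar v s)
        = (\<Sum>v\<in>K. if v = w then f z * tchar w s else 0)"
      by (intro sum.cong) auto
    moreover have "\<dots> = f z * tchar w s" using F by (simp add: K_def)
    ultimately show "(\<Sum>v\<in>K. (g v z - (if v = w then f z else 0)) * tchar v s) = 0"
      by (simp add: left_diff_distrib sum_subtractf)
  qed
  then have "f z = g w z" for z by (auto simp: K_def)
  then have "f = (\<lambda>z. g w z)" by auto
  also have "\<dots> \<in> cfun.span (\<phi> ` {i \<in> I. wt i = w})"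
    unfolding g_def using F by (intro finite_sum_in_span) auto
  finally show ?thesis .
qed

section \<open>Monomials in the basic invariants\<close>

lemma scalar_product_3: "scalar_product u v = u$1 * v$1 + u$2 * v$2 + u$3 * v$3"
  for u v :: "complex ^ 3"
  by (simp add: scalar_product_def sum_3)

lemma C_on_M4: "z \<in> M4 \<Longrightarrow> C i j z = scalar_product (rowL z i) (colA z j)"
  by (simp add: C_def on_M4_def)

lemma D_on_M4: "z \<in> M4 \<Longrightarrow> D i j k z = det (vector [rowL z i, rowL z j, rowL z k] :: complex ^ 3 ^ 3)"
  by (simp add: D_def on_M4_def)

lemma C_off_M4: "z \<notin> M4 \<Longrightarrow> C i j z = 0"
  by (simp add: C_def on_M4_def)

lemma D_off_M4: "z \<notin> M4 \<Longrightarrow> D i j k z = 0"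
  by (simp add: D_def on_M4_def)

lemma C_diag: "C i i z = 0"
  by (simp add: C_def on_M4_def M4_def)

lemma d_simps: "d 1 z = D 2 3 4 z" "d 2 z = - D 1 3 4 z" "d 3 z = D 1 2 4 z" "d 4 z = - D 1 2 3 z"
  by (simp_all add: d_def)

text \<open>Cramer's rule: the \<open>d i\<close> are the signed maximal minors of the matrix with
  rows l_1, ..., l_4, hence the coefficients of a linear relation between these rows; pairing it
  with column \<open>j\<close> gives the claim. The signs in \<open>d\<close> are made for
  this.\<close>

lemma d_C_relation: "(\<Sum>i\<in>UNIV. d i z * C i j z) = 0"
proof (cases "z \<in> M4")
  case True
  then show ?thesis
    unfolding sum_4 d_simps
    by (simp add: C_on_M4 D_on_M4 det_3 scalar_product_3) (simp add: algebra_simps)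
qed (simp add: C_off_M4)

lemma d_row_relation: "z \<in> M4 \<Longrightarrow> (\<Sum>i\<in>UNIV. d i z * rowL z i $ a) = 0"
  using exhaust_3[of a] unfolding sum_4 d_simps
  by (auto simp: D_on_M4 det_3 algebra_simps)

section \<open>Monomials encoded by directed multigraphs\<close>

type_synonym digraph = "4 \<Rightarrow> 4 \<Rightarrow> nat"

definition outd :: "digraph \<Rightarrow> 4 \<Rightarrow> nat"
  where "outd E i = (\<Sum>j\<in>UNIV. E i j)"

definition ind :: "digraph \<Rightarrow> 4 \<Rightarrow> nat"
  where "ind E j = (\<Sum>i\<in>UNIV. E i j)"

definition edges :: "digraph \<Rightarrow> nat"
  where "edges E = (\<Sum>j\<in>UNIV. ind E j)"

definition loopless :: "digraph \<Rightarrow> bool"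
  where "loopless E \<longleftrightarrow> (\<forall>i. E i i = 0)"

definition edge :: "4 \<Rightarrow> 4 \<Rightarrow> digraph"
  where "edge i j = (\<lambda>a b. if a = i \<and> b = j then 1 else 0)"

definition dC_monom :: "(4 \<Rightarrow> nat) \<Rightarrow> digraph \<Rightarrow> config \<Rightarrow> complex"
  where "dC_monom m E = on_M4 (\<lambda>z. (\<Prod>i\<in>UNIV. d i z ^ m i) * (\<Prod>i\<in>UNIV. \<Prod>j\<in>UNIV. C i j z ^ E i j))"

lemma outd_add: "outd (E + F) i = outd E i + outd F i"
  by (simp add: outd_def sum.distrib)

lemma ind_add: "ind (E + F) i = ind E i + ind F i"
  by (simp add: ind_def sum.distrib)

lemma edges_add: "edges (E + F) = edges E + edges F"
  by (simp add: edges_def ind_add sum.distrib)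

lemma sum_outd: "(\<Sum>i\<in>UNIV. outd E i) = edges E"
  unfolding edges_def outd_def ind_def by (rule sum.swap)

lemma outd_arc: "outd (edge i j) a = (if a = i then 1 else 0)"
  by (simp add: outd_def edge_def)

lemma ind_arc: "ind (edge i j) b = (if b = j then 1 else 0)"
  by (simp add: ind_def edge_def)

lemma edges_arc: "edges (edge i j) = 1"
  by (simp add: edges_def ind_arc)

lemma loopless_add: "loopless (E + F) \<longleftrightarrow> loopless E \<and> loopless F"
  by (auto simp: loopless_def)

lemma loopless_arc: "loopless (edge i j) \<longleftrightarrow> i \<noteq> j"
  by (auto simp: loopless_def edge_def)

lemma dC_monom_mult: "dC_monom m E * dC_monom m' E' = dC_monom (m + m') (E + E')"
  by (auto simp: dC_monom_def on_M4_def fun_eq_iff power_add prod.distrib)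

lemma dC_monom_off_M4: "z \<notin> M4 \<Longrightarrow> dC_monom m E z = 0"
  by (simp add: dC_monom_def on_M4_def)

lemma dC_monom_d: "dC_monom (\<lambda>a. if a = i then 1 else 0) 0 = d i"
proof
  fix z
  have "(\<Prod>a\<in>UNIV. d a z ^ (if a = i then 1 else 0)) = (\<Prod>a\<in>UNIV. if a = i then d i z else 1)"
    by (rule prod.cong) auto
  then show "dC_monom (\<lambda>a. if a = i then 1 else 0) 0 z = d i z"
    by (auto simp: dC_monom_def on_M4_def d_def D_off_M4)
qed

lemma dC_monom_C: "dC_monom 0 (edge i j) = C i j"
proof
  fix z
  have "(\<Prod>a\<in>UNIV. \<Prod>b\<in>UNIV. C a b z ^ edge i j a b) = (\<Prod>a\<in>UNIV. if a = i then C i j z else 1)"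
  proof (rule prod.cong[OF refl])
    fix a
    have "(\<Prod>b\<in>UNIV. C a b z ^ edge i j a b) = (\<Prod>b\<in>UNIV. if b = j then (if a = i then C i j z else 1) else 1)"
      by (rule prod.cong) (auto simp: edge_def)
    then show "(\<Prod>b\<in>UNIV. C a b z ^ edge i j a b) = (if a = i then C i j z else 1)" by simp
  qed
  then show "dC_monom 0 (edge i j) z = C i j z"
    by (auto simp: dC_monom_def on_M4_def C_off_M4)
qed

lemma dC_monom_loop:
  assumes "\<not> loopless E"
  shows "dC_monom m E = 0"
proof -
  obtain i where i: "E i i > 0" using assms by (auto simp: loopless_def)
  have "(\<Prod>a\<in>UNIV. \<Prod>b\<in>UNIV. C a b z ^ E a b) = 0" for z
    using i by (intro prod_zero bexI[of _ i]) (auto simp: C_diag)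
  then show ?thesis by (auto simp: dC_monom_def on_M4_def fun_eq_iff)
qed

text \<open>The columns and the rows are scaled independently: together an action of an eight-dimensional
  torus, for which all monomials are weight vectors.\<close>

definition scale_cols :: "(4 \<Rightarrow> complex) \<Rightarrow> config \<Rightarrow> config"
  where "scale_cols s z = ((\<chi> i. s i *s colA z i), snd z)"

definition scale_rows :: "(4 \<Rightarrow> complex) \<Rightarrow> config \<Rightarrow> config"
  where "scale_rows s z = (fst z, (\<chi> i. s i *s rowL z i))"

lemma scale_cols_M4: "s \<in> torus \<Longrightarrow> scale_cols s z \<in> M4 \<longleftrightarrow> z \<in> M4"
proof -
  have "scalar_product u (c *s v) = c * scalar_product u v" for c :: complex and u v :: "complex ^ 3"
    by (simp add: scalar_product_3 algebra_simps)
  then show "s \<in> torus \<Longrightarrow> scale_cols s z \<in> M4 \<longleftrightarrow> z \<in> M4"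
    by (auto simp: M4_def scale_cols_def)
qed

lemma scale_rows_M4: "s \<in> torus \<Longrightarrow> scale_rows s z \<in> M4 \<longleftrightarrow> z \<in> M4"
proof -
  have "scalar_product (c *s u) v = c * scalar_product u v" for c :: complex and u v :: "complex ^ 3"
    by (simp add: scalar_product_3 algebra_simps)
  then show "s \<in> torus \<Longrightarrow> scale_rows s z \<in> M4 \<longleftrightarrow> z \<in> M4"
    by (auto simp: M4_def scale_rows_def)
qed

lemma torus_act_eq: "torus_act t z = scale_cols (\<lambda>i. t $ i) (scale_rows (\<lambda>i. inverse (t $ i)) z)"
  by (simp add: torus_act_def scale_cols_def scale_rows_def)

lemma C_scale_cols: "s \<in> torus \<Longrightarrow> C i j (scale_cols s z) = s j * C i j z"
  using scale_cols_M4[of s z]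
  by (cases "z \<in> M4") (simp_all add: C_on_M4 C_off_M4 scalar_product_3 scale_cols_def algebra_simps)

lemma C_scale_rows: "s \<in> torus \<Longrightarrow> C i j (scale_rows s z) = s i * C i j z"
  using scale_rows_M4[of s z]
  by (cases "z \<in> M4") (simp_all add: C_on_M4 C_off_M4 scalar_product_3 scale_rows_def algebra_simps)

lemma D_scale_cols: "s \<in> torus \<Longrightarrow> D i j k (scale_cols s z) = D i j k z"
  using scale_cols_M4[of s z]
  by (cases "z \<in> M4") (simp_all add: D_on_M4 D_off_M4 scale_cols_def)

lemma D_scale_rows: "s \<in> torus \<Longrightarrow> D i j k (scale_rows s z) = s i * s j * s k * D i j k z"
  using scale_rows_M4[of s z]
  by (cases "z \<in> M4") (simp_all add: D_on_M4 D_off_M4 scale_rows_def det_3 algebra_simps)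

lemma d_scale_cols: "s \<in> torus \<Longrightarrow> d i (scale_cols s z) = d i z"
  by (simp add: d_def D_scale_cols)

lemma d_scale_rows: "s \<in> torus \<Longrightarrow> d i (scale_rows s z) = (\<Prod>j\<in>UNIV. s j) * inverse (s i) * d i z"
  using exhaust_4[of i] unfolding prod_UNIV_4 by (auto simp: d_def D_scale_rows)

lemma dC_monom_scale_cols:
  assumes s: "s \<in> torus"
  shows "dC_monom m E (scale_cols s z) = tchar (\<lambda>j. int (ind E j)) s * dC_monom m E z"
proof (cases "z \<in> M4")
  case True
  have "(\<Prod>i\<in>UNIV. \<Prod>j\<in>UNIV. (s j * C i j z) ^ E i j)
     = (\<Prod>i\<in>UNIV. \<Prod>j\<in>UNIV. s j ^ E i j) * (\<Prod>i\<in>UNIV. \<Prod>j\<in>UNIV. C i j z ^ E i j)"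
    by (simp add: power_mult_distrib prod.distrib)
  also have "(\<Prod>i\<in>UNIV. \<Prod>j\<in>UNIV. s j ^ E i j) = (\<Prod>j\<in>UNIV. s j ^ ind E j)"
    by (subst prod.swap) (simp add: ind_def power_sum)
  finally show ?thesis
    using True by (simp add: dC_monom_def on_M4_def scale_cols_M4[OF s] C_scale_cols[OF s]
      d_scale_cols[OF s] tchar_def)
qed (simp add: dC_monom_def on_M4_def scale_cols_M4[OF s])

text \<open>Row \<open>i\<close> enters once for every factor \<open>C i j\<close> and once for
  every factor \<open>d j\<close> with \<open>j \<noteq> i\<close>, because \<open>d j\<close> omits
  exactly row \<open>j\<close>; this gives the exponent.\<close>

lemma dC_monom_scale_rows:
  assumes s: "s \<in> torus"
  shows "dC_monom m E (scale_rows s z)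
    = tchar (\<lambda>i. int (outd E i) + (\<Sum>j\<in>UNIV. int (m j)) - int (m i)) s * dC_monom m E z"
proof (cases "z \<in> M4")
  case True
  have s0: "s i \<noteq> 0" for i using s by simp
  have 1: "(\<Prod>i\<in>UNIV. \<Prod>j\<in>UNIV. (s i * C i j z) ^ E i j)
     = (\<Prod>i\<in>UNIV. s i ^ outd E i) * (\<Prod>i\<in>UNIV. \<Prod>j\<in>UNIV. C i j z ^ E i j)"
    by (simp add: power_mult_distrib prod.distrib outd_def power_sum)
  have 2: "(\<Prod>i\<in>UNIV. ((\<Prod>j\<in>UNIV. s j) * inverse (s i) * d i z) ^ m i)
     = (\<Prod>j\<in>UNIV. s j) ^ (\<Sum>i\<in>UNIV. m i) * (\<Prod>i\<in>UNIV. inverse (s i) ^ m i) * (\<Prod>i\<in>UNIV. d i z ^ m i)"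
    by (simp add: power_mult_distrib prod.distrib power_sum)
  have "s i powi (int (outd E i) + (\<Sum>j\<in>UNIV. int (m j)) - int (m i))
     = s i ^ outd E i * (s i ^ (\<Sum>j\<in>UNIV. m j) * inverse (s i) ^ m i)" for i
    using s0[of i] unfolding of_nat_sum[symmetric]
    by (simp add: power_int_diff power_int_add divide_inverse power_inverse del: of_nat_sum)
  then have 3: "tchar (\<lambda>i. int (outd E i) + (\<Sum>j\<in>UNIV. int (m j)) - int (m i)) s
     = (\<Prod>i\<in>UNIV. s i ^ outd E i) * ((\<Prod>j\<in>UNIV. s j) ^ (\<Sum>i\<in>UNIV. m i) * (\<Prod>i\<in>UNIV. inverse (s i) ^ m i))"
    by (simp add: tchar_def prod.distrib prod_power_distrib)
  show ?thesis
    using True by (simp add: dC_monom_def on_M4_def scale_rows_M4[OF s] C_scale_rows[OF s]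
      d_scale_rows[OF s] 1 2 3)
qed (simp add: dC_monom_def on_M4_def scale_rows_M4[OF s])

lemma monom_scale_cols:
  assumes s: "s \<in> torus"
  shows "on_M4 (monom_fun \<alpha> \<beta>) (scale_cols s z)
    = tchar (\<lambda>i. \<Sum>a\<in>UNIV. int (\<alpha> i a)) s * on_M4 (monom_fun \<alpha> \<beta>) z"
  unfolding on_M4_def scale_cols_M4[OF s] of_nat_sum[symmetric] tchar_def monom_fun_def
  by (simp add: power_mult_distrib prod.distrib power_sum scale_cols_def del: of_nat_sum)

lemma monom_scale_rows:
  assumes s: "s \<in> torus"
  shows "on_M4 (monom_fun \<alpha> \<beta>) (scale_rows s z)
    = tchar (\<lambda>i. \<Sum>a\<in>UNIV. int (\<beta> i a)) s * on_M4 (monom_fun \<alpha> \<beta>) z"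
  unfolding on_M4_def scale_rows_M4[OF s] of_nat_sum[symmetric] tchar_def monom_fun_def
  by (simp add: power_mult_distrib prod.distrib power_sum scale_rows_def del: of_nat_sum)

lemma tchar_inverse: "tchar w (\<lambda>i. inverse (t i)) = tchar (\<lambda>i. - w i) t"
  by (simp add: tchar_def power_int_minus power_int_inverse)

lemma tchar_add: "s \<in> torus \<Longrightarrow> tchar v s * tchar w s = tchar (\<lambda>i. v i + w i) s"
  by (simp add: tchar_def power_int_add prod.distrib)

section \<open>Invariance of the basic invariants under SL(3)\<close>

lemma SL3_matrix_inv:
  assumes "G \<in> SL3"
  shows "matrix_inv G ** G = mat 1" "G ** matrix_inv G = mat 1" "det (matrix_inv G) = 1"
proof -
  have "invertible G" using assms by (simp add: SL3_def invertible_det_nz)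
  then show *: "matrix_inv G ** G = mat 1" "G ** matrix_inv G = mat 1"
    unfolding invertible_def matrix_inv_def by (auto dest!: someI_ex)
  have "det (matrix_inv G) * det G = 1"
    using *(1) by (metis det_mul det_I)
  then show "det (matrix_inv G) = 1" using assms by (simp add: SL3_def)
qed

lemma scalar_product_assoc:
  fixes u v :: "complex ^ 3" and X Y :: "complex ^ 3 ^ 3"
  shows "scalar_product (u v* X) (Y *v v) = scalar_product u ((X ** Y) *v v)"
  by (simp add: scalar_product_3 vector_matrix_mult_def matrix_vector_mult_def matrix_matrix_mult_def
      sum_3 algebra_simps)

lemma scalar_product_sl_act:
  assumes "G \<in> SL3"
  shows "scalar_product (rowL (sl_act G z) i) (colA (sl_act G z) j) = scalar_product (rowL z i) (colA z j)"
  by (simp add: sl_act_def scalar_product_assoc SL3_matrix_inv[OF assms])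

lemma sl_act_M4: "G \<in> SL3 \<Longrightarrow> sl_act G z \<in> M4 \<longleftrightarrow> z \<in> M4"
  unfolding M4_def by (simp only: mem_Collect_eq scalar_product_sl_act)

lemma C_sl_act: "G \<in> SL3 \<Longrightarrow> C i j (sl_act G z) = C i j z"
  unfolding C_def on_M4_def by (simp only: sl_act_M4 scalar_product_sl_act)

lemma D_sl_act:
  assumes "G \<in> SL3"
  shows "D i j k (sl_act G z) = D i j k z"
proof -
  have "vector [u v* X, v v* X, w v* X] = (vector [u, v, w] :: complex ^ 3 ^ 3) ** X"
    for u v w :: "complex ^ 3" and X :: "complex ^ 3 ^ 3"
    by (simp add: vec_eq_iff forall_3 vector_matrix_mult_def matrix_matrix_mult_def sum_3 algebra_simps)
  then show ?thesis
    unfolding D_def on_M4_def sl_act_M4[OF assms]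
    by (simp add: sl_act_def det_mul SL3_matrix_inv[OF assms])
qed

lemma d_sl_act: "G \<in> SL3 \<Longrightarrow> d i (sl_act G z) = d i z"
  by (simp add: d_def D_sl_act)

lemma dC_monom_sl_act: "G \<in> SL3 \<Longrightarrow> dC_monom m E (sl_act G z) = dC_monom m E z"
  by (simp add: dC_monom_def on_M4_def sl_act_M4 C_sl_act d_sl_act)

lemma sl_act_scale_cols: "sl_act G (scale_cols s z) = scale_cols s (sl_act G z)"
  by (simp add: sl_act_def scale_cols_def vec_eq_iff matrix_vector_mult_def sum_3 algebra_simps)

text \<open>Since these preimages are subspaces, closure of a product of two spans has to be checked
  on the spanning functions only, one factor after the other.\<close>

lemma subspace_mult_preimage:
  assumes "cfun.subspace V"
  shows "cfun.subspace {f. f * h \<in> V}" "cfun.subspace {f. h * f \<in> V}"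
proof -
  have "(0 :: 'a \<Rightarrow> complex) * h = 0" "h * 0 = 0" "(x + y) * h = x * h + y * h"
    "h * (x + y) = h * x + h * y" "cscale c x * h = cscale c (x * h)" "h * cscale c x = cscale c (h * x)"
    for h x y :: "'a \<Rightarrow> complex" and c
    by (auto simp: fun_eq_iff cscale_def algebra_simps)
  then show "cfun.subspace {f. f * h \<in> V}" "cfun.subspace {f. h * f \<in> V}"
    using assms unfolding cfun.subspace_def by simp_all
qed

section \<open>Degrees of the basic invariants in the coordinate ring\<close>

lemma subspace_coord_ring_deg: "cfun.subspace (coord_ring_deg k)"
  by (simp add: coord_ring_deg_def)

lemma coord_ring_deg_mult:
  assumes "f \<in> coord_ring_deg a" "g \<in> coord_ring_deg b"
  shows "f * g \<in> coord_ring_deg (a + b)"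
proof -
  have mono: "on_M4 (monom_fun \<alpha> \<beta>) * on_M4 (monom_fun \<alpha>' \<beta>') = on_M4 (monom_fun (\<alpha> + \<alpha>') (\<beta> + \<beta>'))"
    for \<alpha> \<beta> \<alpha>' \<beta>'
    by (auto simp: on_M4_def monom_fun_def fun_eq_iff power_add prod.distrib)
  have 1: "on_M4 (monom_fun \<alpha> \<beta>) * g \<in> coord_ring_deg (a + b)" if "(\<Sum>i\<in>UNIV. \<Sum>c\<in>UNIV. \<alpha> i c) = a" for \<alpha> \<beta>
  proof -
    have "coord_ring_deg b \<subseteq> {g. on_M4 (monom_fun \<alpha> \<beta>) * g \<in> coord_ring_deg (a + b)}"
      unfolding coord_ring_deg_def[of b]
    proof (rule cfun.span_minimal[OF _ subspace_mult_preimage(2)[OF subspace_coord_ring_deg]], rule subsetI)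
      fix x assume "x \<in> {on_M4 (monom_fun \<alpha> \<beta>) |\<alpha> \<beta>. (\<Sum>i\<in>UNIV. \<Sum>a\<in>UNIV. \<alpha> i a) = b}"
      then obtain \<alpha>' \<beta>' where x: "x = on_M4 (monom_fun \<alpha>' \<beta>')" "(\<Sum>i\<in>UNIV. \<Sum>a\<in>UNIV. \<alpha>' i a) = b" by auto
      have "(\<Sum>i\<in>UNIV. \<Sum>c\<in>UNIV. (\<alpha> + \<alpha>') i c) = a + b"
        using that x by (simp add: sum.distrib)
      then show "x \<in> {g. on_M4 (monom_fun \<alpha> \<beta>) * g \<in> coord_ring_deg (a + b)}"
        unfolding x(1) coord_ring_deg_def mono mem_Collect_eq by (intro cfun.span_base) blast
    qed
    then show ?thesis using assms(2) by auto
  qed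
  have "coord_ring_deg a \<subseteq> {f. f * g \<in> coord_ring_deg (a + b)}"
    unfolding coord_ring_deg_def[of a]
    by (rule cfun.span_minimal[OF _ subspace_mult_preimage(1)[OF subspace_coord_ring_deg]]) (use 1 in auto)
  then show ?thesis using assms(1) by auto
qed

lemma one_in_coord_ring_deg: "on_M4 (\<lambda>z. 1) \<in> coord_ring_deg 0"
proof -
  have "on_M4 (monom_fun (\<lambda>_ _. 0) (\<lambda>_ _. 0)) \<in> coord_ring_deg 0"
    unfolding coord_ring_deg_def by (intro cfun.span_base) auto
  then show ?thesis by (simp add: monom_fun_def[abs_def])
qed

definition unit2 :: "4 \<Rightarrow> 3 \<Rightarrow> 4 \<Rightarrow> 3 \<Rightarrow> nat"
  where "unit2 i a = (\<lambda>j b. if j = i \<and> b = a then 1 else 0)"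

lemma prod_unit2: "(\<Prod>j\<in>UNIV. \<Prod>b\<in>UNIV. (x j b :: complex) ^ unit2 i a j b) = x i a"
proof -
  have "(\<Prod>b\<in>UNIV. x j b ^ unit2 i a j b) = (if j = i then x i a else 1)" for j
  proof -
    have "(\<Prod>b\<in>UNIV. x j b ^ unit2 i a j b) = (\<Prod>b\<in>UNIV. if b = a then (if j = i then x i a else 1) else 1)"
      by (rule prod.cong) (auto simp: unit2_def)
    then show ?thesis by simp
  qed
  then show ?thesis by simp
qed

lemma sum_unit2: "(\<Sum>j\<in>UNIV. \<Sum>b\<in>UNIV. unit2 i a j b) = 1"
proof -
  have "(\<Sum>b\<in>UNIV. unit2 i a j b) = (if j = i then 1 else 0)" for j
    by (simp add: unit2_def if_distrib cong: if_cong)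
  then show ?thesis by simp
qed

lemma row_coord: "on_M4 (\<lambda>z. rowL z i $ a) \<in> coord_ring_deg 0"
proof -
  have "on_M4 (monom_fun (\<lambda>_ _. 0) (unit2 i a)) \<in> coord_ring_deg 0"
    unfolding coord_ring_deg_def by (intro cfun.span_base) auto
  then show ?thesis by (simp add: monom_fun_def[abs_def] prod_unit2)
qed

lemma col_coord: "on_M4 (\<lambda>z. colA z i $ a) \<in> coord_ring_deg 1"
proof -
  have "on_M4 (monom_fun (unit2 i a) (\<lambda>_ _. 0)) \<in> coord_ring_deg 1"
    unfolding coord_ring_deg_def using sum_unit2[of i a] by (intro cfun.span_base) blast
  then show ?thesis by (simp add: monom_fun_def[abs_def] prod_unit2)
qed

lemma coord_ring_deg_lin:
  "f \<in> coord_ring_deg n \<Longrightarrow> g \<in> coord_ring_deg n \<Longrightarrow> f + g \<in> coord_ring_deg n"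
  "f \<in> coord_ring_deg n \<Longrightarrow> g \<in> coord_ring_deg n \<Longrightarrow> f - g \<in> coord_ring_deg n"
  "f \<in> coord_ring_deg n \<Longrightarrow> - f \<in> coord_ring_deg n"
  by (simp_all add: coord_ring_deg_def cfun.span_add cfun.span_diff cfun.span_neg)

lemma C_in_coord_ring_deg: "C i j \<in> coord_ring_deg 1"
proof -
  have "C i j = on_M4 (\<lambda>z. rowL z i $ 1) * on_M4 (\<lambda>z. colA z j $ 1)
     + on_M4 (\<lambda>z. rowL z i $ 2) * on_M4 (\<lambda>z. colA z j $ 2)
     + on_M4 (\<lambda>z. rowL z i $ 3) * on_M4 (\<lambda>z. colA z j $ 3)"
    by (auto simp: fun_eq_iff C_def on_M4_def scalar_product_3)
  also have "\<dots> \<in> coord_ring_deg 1"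
    using coord_ring_deg_mult[OF row_coord col_coord] by (intro coord_ring_deg_lin) auto
  finally show ?thesis .
qed

lemma D_in_coord_ring_deg: "D i j k \<in> coord_ring_deg 0"
proof -
  let ?x = "\<lambda>i a. on_M4 (\<lambda>z. rowL z i $ a)"
  have "D i j k = ?x i 1 * ?x j 2 * ?x k 3 + ?x i 2 * ?x j 3 * ?x k 1 + ?x i 3 * ?x j 1 * ?x k 2
      - ?x i 1 * ?x j 3 * ?x k 2 - ?x i 2 * ?x j 1 * ?x k 3 - ?x i 3 * ?x j 2 * ?x k 1"
    by (auto simp: fun_eq_iff D_def on_M4_def det_3)
  also have "\<dots> \<in> coord_ring_deg 0"
    using coord_ring_deg_mult[OF coord_ring_deg_mult[OF row_coord row_coord] row_coord]
    by (intro coord_ring_deg_lin) auto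
  finally show ?thesis .
qed

lemma d_in_coord_ring_deg: "d i \<in> coord_ring_deg 0"
  by (simp add: d_def D_in_coord_ring_deg coord_ring_deg_lin)

lemma on_M4_mult: "on_M4 (\<lambda>z. f z * g z) = on_M4 f * on_M4 g"
  by (auto simp: on_M4_def)

lemma on_M4_prod_in_coord_ring_deg:
  assumes "finite I" "\<And>i. i \<in> I \<Longrightarrow> on_M4 (f i) \<in> coord_ring_deg (n i)"
  shows "on_M4 (\<lambda>z. \<Prod>i\<in>I. f i z) \<in> coord_ring_deg (\<Sum>i\<in>I. n i)"
  using assms
proof (induction I rule: finite_induct)
  case (insert i I)
  then have "on_M4 (f i) * on_M4 (\<lambda>z. \<Prod>i\<in>I. f i z) \<in> coord_ring_deg (n i + (\<Sum>i\<in>I. n i))"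
    by (intro coord_ring_deg_mult) auto
  then show ?case using insert by (simp add: on_M4_mult del: times_fun_apply)
qed (simp add: one_in_coord_ring_deg)

lemma on_M4_power_in_coord_ring_deg:
  assumes "f \<in> coord_ring_deg n"
  shows "on_M4 (\<lambda>z. f z ^ k) \<in> coord_ring_deg (k * n)"
proof (induction k)
  case (Suc k)
  have "f * on_M4 (\<lambda>z. f z ^ k) = on_M4 (\<lambda>z. f z ^ Suc k)"
    by (auto simp: on_M4_def fun_eq_iff)
  with coord_ring_deg_mult[OF assms Suc.IH] show ?case by simp
qed (simp add: one_in_coord_ring_deg)

lemma dC_monom_in_coord_ring_deg: "dC_monom m E \<in> coord_ring_deg (edges E)"
proof -
  have "on_M4 (\<lambda>z. \<Prod>i\<in>UNIV. d i z ^ m i) \<in> coord_ring_deg (\<Sum>i\<in>UNIV. m i * 0)"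
    by (intro on_M4_prod_in_coord_ring_deg on_M4_power_in_coord_ring_deg d_in_coord_ring_deg) auto
  moreover have "on_M4 (\<lambda>z. \<Prod>i\<in>UNIV. \<Prod>j\<in>UNIV. C i j z ^ E i j) \<in> coord_ring_deg (\<Sum>i\<in>UNIV. \<Sum>j\<in>UNIV. E i j * 1)"
    by (intro on_M4_prod_in_coord_ring_deg on_M4_power_in_coord_ring_deg C_in_coord_ring_deg) auto
  moreover have "edges E = (\<Sum>i\<in>UNIV. m i * 0) + (\<Sum>i\<in>UNIV. \<Sum>j\<in>UNIV. E i j * 1)"
    by (simp add: sum_outd[symmetric] outd_def)
  ultimately show ?thesis
    unfolding dC_monom_def on_M4_mult by (simp only: coord_ring_deg_mult)
qed

lemma coord_ring_deg_subset: "coord_ring_deg n \<subseteq> coord_ring"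
  unfolding coord_ring_deg_def coord_ring_def by (intro cfun.span_mono) auto

section \<open>Division by \<open>d\<^sub>4\<close>\<close>

text \<open>The bound \<open>c\<close> makes the exponent \<open>outd E i - c i\<close> of
  \<open>d i\<close> in \<open>mono_at\<close> nonnegative. For fixed in-degrees all monomials
  \<open>mono_at c E\<close> have the same weight under row scaling, namely \<open>c i\<close> plus
  the common \<open>d\<close>-degree. \<open>c\<close> takes integer values because clearing
  denominators makes \<open>c 4\<close> negative.\<close>

definition adm :: "(4 \<Rightarrow> int) \<Rightarrow> digraph \<Rightarrow> bool"
  where "adm c E \<longleftrightarrow> loopless E \<and> (\<forall>i. c i \<le> int (outd E i))"

definition mono_at :: "(4 \<Rightarrow> int) \<Rightarrow> digraph \<Rightarrow> config \<Rightarrow> complex"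
  where "mono_at c E = dC_monom (\<lambda>i. nat (int (outd E i) - c i)) E"

definition mono_span :: "(4 \<Rightarrow> int) \<Rightarrow> (4 \<Rightarrow> nat) \<Rightarrow> (config \<Rightarrow> complex) set"
  where "mono_span c k = cfun.span (mono_at c ` {E. adm c E \<and> ind E = k})"

lemma adm_arc: "adm c E \<Longrightarrow> i \<noteq> j \<Longrightarrow> adm c (E + edge i j)"
  by (auto simp: adm_def loopless_add loopless_arc outd_add outd_arc intro: order_trans)

lemma mono_at_arc:
  assumes "adm c E"
  shows "mono_at c (E + edge i j) = mono_at c E * d i * C i j"
proof -
  have "mono_at c E * d i * C i j
      = dC_monom ((\<lambda>i. nat (int (outd E i) - c i)) + (\<lambda>a. if a = i then 1 else 0) + 0) (E + 0 + edge i j)"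
    unfolding mono_at_def dC_monom_mult[symmetric] dC_monom_d dC_monom_C ..
  moreover have "(\<lambda>i. nat (int (outd E i) - c i)) + (\<lambda>a. if a = i then 1 else 0) + 0
      = (\<lambda>a. nat (int (outd (E + edge i j) a) - c a))"
  proof
    fix a
    have "c a \<le> int (outd E a)" using assms by (simp add: adm_def)
    then show "((\<lambda>i. nat (int (outd E i) - c i)) + (\<lambda>a. if a = i then 1 else 0) + 0) a
      = nat (int (outd (E + edge i j) a) - c a)"
      by (simp add: outd_add outd_arc)
  qed
  ultimately show ?thesis by (simp add: mono_at_def)
qed

text \<open>Adding an edge from \<open>i\<close> to \<open>j\<close> raises the exponent of
  \<open>d i\<close> along with that of \<open>C i j\<close>, so the sum is
  \<open>mono_at c E\<close> times the basic relation; the term \<open>i = j\<close> drops out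
  because \<open>C j j\<close> is zero.\<close>

lemma mono_at_relation:
  assumes "adm c E"
  shows "(\<Sum>i\<in>UNIV - {j}. mono_at c (E + edge i j)) = 0"
proof
  fix z
  have "(\<Sum>i\<in>UNIV - {j}. mono_at c (E + edge i j)) z = (\<Sum>i\<in>UNIV - {j}. mono_at c E z * (d i z * C i j z))"
    by (simp add: sum_fun_apply mono_at_arc[OF assms] mult.assoc)
  also have "\<dots> = mono_at c E z * (\<Sum>i\<in>UNIV. d i z * C i j z)"
    by (simp add: sum_distrib_left sum_diff1 C_diag)
  finally show "(\<Sum>i\<in>UNIV - {j}. mono_at c (E + edge i j)) z = 0 z"
    by (simp add: d_C_relation)
qed

lemma mono_at_raise:
  assumes "c a < int (outd E a)"
  shows "mono_at c E = d a * mono_at (c(a := c a + 1)) E"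
proof -
  have "d a * mono_at (c(a := c a + 1)) E
      = dC_monom ((\<lambda>b. if b = a then 1 else 0) + (\<lambda>i. nat (int (outd E i) - (c(a := c a + 1)) i))) (0 + E)"
    unfolding mono_at_def dC_monom_mult[symmetric] dC_monom_d ..
  moreover have "(\<lambda>b. if b = a then 1 else 0) + (\<lambda>i. nat (int (outd E i) - (c(a := c a + 1)) i))
      = (\<lambda>i. nat (int (outd E i) - c i))"
    using assms by (auto simp: fun_eq_iff)
  ultimately show ?thesis by (simp add: mono_at_def)
qed

text \<open>The arguments are the entries of row \<open>4\<close>, of column \<open>4\<close>, and the two remaining entries of each of the
  columns \<open>1, 2, 3\<close>.\<close>

definition dgr :: "nat \<Rightarrow> nat \<Rightarrow> nat \<Rightarrow> nat \<Rightarrow> nat \<Rightarrow> nat \<Rightarrow> nat \<Rightarrow> nat \<Rightarrow> nat \<Rightarrow> nat \<Rightarrow> nat \<Rightarrow> nat \<Rightarrow> digraph"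
  where "dgr p1 p2 p3 g1 g2 g3 x x' y y' w w' = (\<lambda>i j.
    if i = 4 then (if j = 1 then p1 else if j = 2 then p2 else if j = 3 then p3 else 0)
    else if j = 4 then (if i = 1 then g1 else if i = 2 then g2 else g3)
    else if j = 1 then (if i = 2 then x else if i = 3 then x' else 0)
    else if j = 2 then (if i = 1 then y else if i = 3 then y' else 0)
    else (if i = 1 then w else if i = 2 then w' else 0))"

lemma dgr_entries:
  assumes "E = dgr p1 p2 p3 g1 g2 g3 x x' y y' w w'"
  shows "E 4 1 = p1" "E 4 2 = p2" "E 4 3 = p3" "E 4 4 = 0" "E 1 4 = g1" "E 2 4 = g2" "E 3 4 = g3"
    "E 1 1 = 0" "E 2 1 = x" "E 3 1 = x'" "E 1 2 = y" "E 2 2 = 0" "E 3 2 = y'"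
    "E 1 3 = w" "E 2 3 = w'" "E 3 3 = 0"
  by (simp_all add: assms dgr_def)

lemma digraph_eqI: "(\<And>i j. i \<in> {1,2,3,4} \<Longrightarrow> j \<in> {1,2,3,4} \<Longrightarrow> E i j = F i j) \<Longrightarrow> E = F" for E F :: digraph
  using UNIV_4 by (metis UNIV_I ext)

lemma loopless_dgr: "loopless (dgr p1 p2 p3 g1 g2 g3 x x' y y' w w')"
  unfolding loopless_def forall_4 by (simp add: dgr_entries[OF refl])

lemma loopless_eq_dgr:
  assumes "loopless E"
  shows "E = dgr (E 4 1) (E 4 2) (E 4 3) (E 1 4) (E 2 4) (E 3 4) (E 2 1) (E 3 1) (E 1 2) (E 3 2) (E 1 3) (E 2 3)"
    (is "_ = ?F")
  using assms unfolding loopless_def by (intro digraph_eqI) (auto simp: dgr_entries[OF refl])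

lemma loopless_cases:
  assumes "loopless E"
  obtains p1 p2 p3 g1 g2 g3 x x' y y' w w' where "E = dgr p1 p2 p3 g1 g2 g3 x x' y y' w w'"
  using loopless_eq_dgr[OF assms] by blast

lemma outd_dgr:
  "outd (dgr p1 p2 p3 g1 g2 g3 x x' y y' w w') 1 = g1 + y + w"
  "outd (dgr p1 p2 p3 g1 g2 g3 x x' y y' w w') 2 = g2 + x + w'"
  "outd (dgr p1 p2 p3 g1 g2 g3 x x' y y' w w') 3 = g3 + x' + y'"
  "outd (dgr p1 p2 p3 g1 g2 g3 x x' y y' w w') 4 = p1 + p2 + p3"
  by (simp_all add: outd_def sum_4 dgr_entries[OF refl])

lemma ind_dgr:
  "ind (dgr p1 p2 p3 g1 g2 g3 x x' y y' w w') 1 = p1 + x + x'"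
  "ind (dgr p1 p2 p3 g1 g2 g3 x x' y y' w w') 2 = p2 + y + y'"
  "ind (dgr p1 p2 p3 g1 g2 g3 x x' y y' w w') 3 = p3 + w + w'"
  "ind (dgr p1 p2 p3 g1 g2 g3 x x' y y' w w') 4 = g1 + g2 + g3"
  by (simp_all add: ind_def sum_4 dgr_entries[OF refl])

lemma adm_dgr: "adm c (dgr p1 p2 p3 g1 g2 g3 x x' y y' w w') \<longleftrightarrow>
   c 1 \<le> int (g1 + y + w) \<and> c 2 \<le> int (g2 + x + w') \<and> c 3 \<le> int (g3 + x' + y') \<and> c 4 \<le> int (p1 + p2 + p3)"
  unfolding adm_def forall_4 outd_dgr using loopless_dgr by simp

lemma dgr_add_arc:
  "dgr p1 p2 p3 g1 g2 g3 x x' y y' w w' + edge 2 1 = dgr p1 p2 p3 g1 g2 g3 (Suc x) x' y y' w w'"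
  "dgr p1 p2 p3 g1 g2 g3 x x' y y' w w' + edge 3 1 = dgr p1 p2 p3 g1 g2 g3 x (Suc x') y y' w w'"
  "dgr p1 p2 p3 g1 g2 g3 x x' y y' w w' + edge 1 2 = dgr p1 p2 p3 g1 g2 g3 x x' (Suc y) y' w w'"
  "dgr p1 p2 p3 g1 g2 g3 x x' y y' w w' + edge 3 2 = dgr p1 p2 p3 g1 g2 g3 x x' y (Suc y') w w'"
  "dgr p1 p2 p3 g1 g2 g3 x x' y y' w w' + edge 1 3 = dgr p1 p2 p3 g1 g2 g3 x x' y y' (Suc w) w'"
  "dgr p1 p2 p3 g1 g2 g3 x x' y y' w w' + edge 2 3 = dgr p1 p2 p3 g1 g2 g3 x x' y y' w (Suc w')"
  "dgr p1 p2 p3 g1 g2 g3 x x' y y' w w' + edge 1 4 = dgr p1 p2 p3 (Suc g1) g2 g3 x x' y y' w w'"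
  "dgr p1 p2 p3 g1 g2 g3 x x' y y' w w' + edge 2 4 = dgr p1 p2 p3 g1 (Suc g2) g3 x x' y y' w w'"
  "dgr p1 p2 p3 g1 g2 g3 x x' y y' w w' + edge 3 4 = dgr p1 p2 p3 g1 g2 (Suc g3) x x' y y' w w'"
  "dgr p1 p2 p3 g1 g2 g3 x x' y y' w w' + edge 4 1 = dgr (Suc p1) p2 p3 g1 g2 g3 x x' y y' w w'"
  "dgr p1 p2 p3 g1 g2 g3 x x' y y' w w' + edge 4 2 = dgr p1 (Suc p2) p3 g1 g2 g3 x x' y y' w w'"
  "dgr p1 p2 p3 g1 g2 g3 x x' y y' w w' + edge 4 3 = dgr p1 p2 (Suc p3) g1 g2 g3 x x' y y' w w'"
  by (intro digraph_eqI, auto simp: dgr_entries[OF refl] edge_def)+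

lemma UNIV_minus_4: "UNIV - {1} = {2,3,4::4}" "UNIV - {2} = {1,3,4::4}" "UNIV - {3} = {1,2,4::4}"
  "UNIV - {4} = {1,2,3::4}"
  unfolding UNIV_4 by auto

text \<open>Divisibility within the span of the monomials: the quotient must again be a polynomial
  in the basic invariants. The raised bound at 4 accounts for the factor taken out.\<close>

definition d4_multiples :: "(4 \<Rightarrow> int) \<Rightarrow> (4 \<Rightarrow> nat) \<Rightarrow> (config \<Rightarrow> complex) set"
  where "d4_multiples c k = {d 4 * g | g. g \<in> mono_span (c(4 := c 4 + 1)) k}"

lemma subspace_d4_multiples: "cfun.subspace (d4_multiples c k)"
proof -
  have *: "d 4 * x + d 4 * y = d 4 * (x + y)" "cscale a (d 4 * x) = d 4 * cscale a x" "0 = d 4 * 0" for x y a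
    by (auto simp: fun_eq_iff cscale_def algebra_simps)
  show ?thesis
    unfolding d4_multiples_def mono_span_def
  proof (rule cfun.subspaceI)
    fix x y a
    let ?S = "cfun.span (mono_at (c(4 := c 4 + 1)) ` {E. adm (c(4 := c 4 + 1)) E \<and> ind E = k})"
    let ?T = "{d 4 * g |g. g \<in> ?S}"
    show "0 \<in> ?T" using *(3) cfun.span_zero[of "mono_at (c(4 := c 4 + 1)) ` {E. adm (c(4 := c 4 + 1)) E \<and> ind E = k}"] by blast
    show "x + y \<in> ?T" if "x \<in> ?T" "y \<in> ?T" using that *(1) cfun.span_add by blast
    show "cscale a x \<in> ?T" if "x \<in> ?T" using that *(2) cfun.span_scale by blast
  qed
qed

lemma mono_at_d4_multiple:
  assumes "adm c E" "ind E = k" "c 4 < int (outd E 4)"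
  shows "mono_at c E \<in> d4_multiples c k"
proof -
  have "adm (c(4 := c 4 + 1)) E" using assms by (auto simp: adm_def)
  then have "mono_at (c(4 := c 4 + 1)) E \<in> mono_span (c(4 := c 4 + 1)) k"
    unfolding mono_span_def using assms by (intro cfun.span_base) auto
  then show ?thesis
    unfolding d4_multiples_def mono_at_raise[of c 4, OF assms(3)] by auto
qed

text \<open>Of the three terms of the relation in column \<open>j\<close>, the one with tail 4
  contains a factor \<open>d 4\<close>; hence the other two cancel modulo
  \<open>d 4\<close>.\<close>

lemma swap_mod_d4:
  assumes "adm c E" "UNIV - {j} = {a, b, 4}" "a \<noteq> b" "a \<noteq> 4" "b \<noteq> 4" "j \<noteq> 4" "ind (E + edge 4 j) = k"
  shows "mono_at c (E + edge a j) + mono_at c (E + edge b j) \<in> d4_multiples c k"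
proof -
  have "mono_at c (E + edge a j) + mono_at c (E + edge b j) + mono_at c (E + edge 4 j) = 0"
    using mono_at_relation[OF assms(1), of j] assms(2-5) by (simp add: add.assoc)
  then have "mono_at c (E + edge a j) + mono_at c (E + edge b j) = - mono_at c (E + edge 4 j)"
    by (simp add: eq_neg_iff_add_eq_0)
  moreover have "mono_at c (E + edge 4 j) \<in> d4_multiples c k"
  proof (rule mono_at_d4_multiple)
    show "adm c (E + edge 4 j)" using assms by (intro adm_arc) auto
    have "c 4 \<le> int (outd E 4)" using assms(1) by (simp add: adm_def)
    then show "c 4 < int (outd (E + edge 4 j) 4)" by (simp add: outd_add outd_arc)
  qed (rule assms(7))
  ultimately show ?thesis using cfun.subspace_neg[OF subspace_d4_multiples] by metis
qed

text \<open>For each head 1, 2, 3 one of the two tails other than 4 is counted, so every swap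
  changes the count by one and the sign absorbs the minus of the congruence.\<close>

definition class_sign :: "digraph \<Rightarrow> complex"
  where "class_sign E = (-1) ^ (E 3 1 + E 3 2 + E 2 3)"

text \<open>Modulo \<open>d\<^sub>4\<close>, the relations in the columns \<open>1, 2, 3\<close> become \<open>d\<^sub>a C\<^sub>a\<^sub>j = - d\<^sub>b C\<^sub>b\<^sub>j\<close>; such swaps preserve
  row \<open>4\<close> and column \<open>4\<close>, and up to sign they connect all graphs that agree there.\<close>

definition d4_class :: "digraph \<Rightarrow> nat list"
  where "d4_class E = [E 4 1, E 4 2, E 4 3, E 1 4, E 2 4, E 3 4]"

definition signed_mono :: "(4 \<Rightarrow> int) \<Rightarrow> digraph \<Rightarrow> config \<Rightarrow> complex"
  where "signed_mono c E = cscale (class_sign E) (mono_at c E)"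

lemma signed_swap:
  assumes "adm c E" "UNIV - {j} = {a, b, 4}" "a \<noteq> b" "a \<noteq> 4" "b \<noteq> 4" "j \<noteq> 4" "ind (E + edge 4 j) = k"
    and "class_sign (E + edge a j) = - class_sign (E + edge b j)"
  shows "signed_mono c (E + edge a j) - signed_mono c (E + edge b j) \<in> d4_multiples c k"
proof -
  have "signed_mono c (E + edge a j) - signed_mono c (E + edge b j)
    = cscale (class_sign (E + edge a j)) (mono_at c (E + edge a j) + mono_at c (E + edge b j))"
    unfolding signed_mono_def assms(8) by (simp add: fun_eq_iff cscale_def distrib_left)
  then show ?thesis
    using cfun.subspace_scale[OF subspace_d4_multiples swap_mod_d4[OF assms(1-7)]] by simp
qed

lemma ind_dgr_iff: "ind (dgr p1 p2 p3 g1 g2 g3 x x' y y' w w') = k \<longleftrightarrow>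
   k 1 = p1 + x + x' \<and> k 2 = p2 + y + y' \<and> k 3 = p3 + w + w' \<and> k 4 = g1 + g2 + g3"
  unfolding fun_eq_iff[of "ind _"] forall_4 ind_dgr by (auto simp: eq_commute)

lemma class_moves:
  fixes c k
  defines "eqv f g \<equiv> f - g \<in> d4_multiples c k"
  assumes "adm c (dgr p1 p2 p3 g1 g2 g3 x x' y y' w w')" (is "adm c ?E")
  shows "ind (dgr p1 p2 p3 g1 g2 g3 (Suc x) x' y y' w w') = k \<Longrightarrow>
     eqv (signed_mono c (dgr p1 p2 p3 g1 g2 g3 (Suc x) x' y y' w w')) (signed_mono c (dgr p1 p2 p3 g1 g2 g3 x (Suc x') y y' w w'))"
   "ind (dgr p1 p2 p3 g1 g2 g3 x x' (Suc y) y' w w') = k \<Longrightarrow>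
     eqv (signed_mono c (dgr p1 p2 p3 g1 g2 g3 x x' (Suc y) y' w w')) (signed_mono c (dgr p1 p2 p3 g1 g2 g3 x x' y (Suc y') w w'))"
   "ind (dgr p1 p2 p3 g1 g2 g3 x x' y y' (Suc w) w') = k \<Longrightarrow>
     eqv (signed_mono c (dgr p1 p2 p3 g1 g2 g3 x x' y y' (Suc w) w')) (signed_mono c (dgr p1 p2 p3 g1 g2 g3 x x' y y' w (Suc w')))"
proof -
  have ar: "ind (?E + edge i j) = ind (?E + edge 4 j)" for i j by (auto simp: fun_eq_iff ind_add ind_arc)
  { assume "ind (dgr p1 p2 p3 g1 g2 g3 (Suc x) x' y y' w w') = k"
    then have "ind (?E + edge 4 1) = k" using ar[of 2 1] unfolding dgr_add_arc by simp
    from signed_swap[OF assms(2) UNIV_minus_4(1) _ _ _ _ this]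
    show "eqv (signed_mono c (dgr p1 p2 p3 g1 g2 g3 (Suc x) x' y y' w w')) (signed_mono c (dgr p1 p2 p3 g1 g2 g3 x (Suc x') y y' w w'))"
      unfolding dgr_add_arc eqv_def by (simp add: class_sign_def dgr_entries[OF refl]) }
  { assume "ind (dgr p1 p2 p3 g1 g2 g3 x x' (Suc y) y' w w') = k"
    then have "ind (?E + edge 4 2) = k" using ar[of 1 2] unfolding dgr_add_arc by simp
    from signed_swap[OF assms(2) UNIV_minus_4(2) _ _ _ _ this]
    show "eqv (signed_mono c (dgr p1 p2 p3 g1 g2 g3 x x' (Suc y) y' w w')) (signed_mono c (dgr p1 p2 p3 g1 g2 g3 x x' y (Suc y') w w'))"
      unfolding dgr_add_arc eqv_def by (simp add: class_sign_def dgr_entries[OF refl]) }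
  { assume "ind (dgr p1 p2 p3 g1 g2 g3 x x' y y' (Suc w) w') = k"
    then have "ind (?E + edge 4 3) = k" using ar[of 1 3] unfolding dgr_add_arc by simp
    from signed_swap[OF assms(2) UNIV_minus_4(3) _ _ _ _ this]
    show "eqv (signed_mono c (dgr p1 p2 p3 g1 g2 g3 x x' y y' (Suc w) w')) (signed_mono c (dgr p1 p2 p3 g1 g2 g3 x x' y y' w (Suc w')))"
      unfolding dgr_add_arc eqv_def by (simp add: class_sign_def dgr_entries[OF refl]) }
qed

text \<open>If no unit step brings one point closer to the other, then the slacks \<open>m\<^sub>i\<close> of the first all vanish.\<close>

lemma unit_step_exists:
  fixes a b e m1 m2 m3 :: int
  assumes "0 \<le> m1" "0 \<le> m2" "0 \<le> m3" "0 < m1 + m2 + m3"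
    and "b + e \<le> m1" "a - e \<le> m2" "- a - b \<le> m3"
  shows "a = 0 \<and> b = 0 \<and> e = 0 \<or> 0 < a \<and> 0 < m2 \<or> a < 0 \<and> 0 < m3 \<or> 0 < b \<and> 0 < m1
    \<or> b < 0 \<and> 0 < m3 \<or> 0 < e \<and> 0 < m1 \<or> e < 0 \<and> 0 < m2"
  using assms by smt

text \<open>With row 4, column 4 and the in-degrees fixed, \<open>x\<close>, \<open>y\<close>,
  \<open>w\<close> determine the graph, and the induction is on the distance in these three
  coordinates. A swap lowers one out-degree and raises another; it is allowed when the former has
  slack over \<open>c\<close>.\<close>

lemma class_equiv_dgr:
  fixes c k
  assumes "adm c (dgr p1 p2 p3 g1 g2 g3 x x' y y' w w')"
    and "adm c (dgr p1 p2 p3 g1 g2 g3 X X' Y Y' W W')"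
    and "ind (dgr p1 p2 p3 g1 g2 g3 x x' y y' w w') = k" "ind (dgr p1 p2 p3 g1 g2 g3 X X' Y Y' W W') = k"
    and "c 4 = int (p1 + p2 + p3)" "(\<Sum>i\<in>UNIV. c i) < int (\<Sum>i\<in>UNIV. k i)"
  shows "signed_mono c (dgr p1 p2 p3 g1 g2 g3 x x' y y' w w') - signed_mono c (dgr p1 p2 p3 g1 g2 g3 X X' Y Y' W W') \<in> d4_multiples c k"
  using assms
proof (induction "nat (\<bar>int x - int X\<bar> + \<bar>int y - int Y\<bar> + \<bar>int w - int W\<bar>)" arbitrary: x x' y y' w w' rule: less_induct)
  case (less x y w x' y' w')
  let ?J = "d4_multiples c k" and ?E = "dgr p1 p2 p3 g1 g2 g3"
  have k: "k 1 = p1 + x + x'" "k 2 = p2 + y + y'" "k 3 = p3 + w + w'" "k 4 = g1 + g2 + g3"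
    using less.prems(3) ind_dgr by metis+
  have K: "k 1 = p1 + X + X'" "k 2 = p2 + Y + Y'" "k 3 = p3 + W + W'"
    using less.prems(4) ind_dgr by metis+
  have close: ?case
    if "signed_mono c (?E x x' y y' w w') - signed_mono c (?E a a' b b' e e') \<in> ?J"
      "adm c (?E a a' b b' e e')" "ind (?E a a' b b' e e') = k"
      "nat (\<bar>int a - int X\<bar> + \<bar>int b - int Y\<bar> + \<bar>int e - int W\<bar>)
        < nat (\<bar>int x - int X\<bar> + \<bar>int y - int Y\<bar> + \<bar>int w - int W\<bar>)" for a a' b b' e e'
  proof -
    have "signed_mono c (?E a a' b b' e e') - signed_mono c (?E X X' Y Y' W W') \<in> ?J"
      by (rule less.hyps[OF that(4,2) less.prems(2) that(3) less.prems(4-6)])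
    with that(1) show ?case using cfun.subspace_add[OF subspace_d4_multiples] by fastforce
  qed
  have sym: "g - f \<in> ?J" if "f - g \<in> ?J" for f g
    using cfun.subspace_neg[OF subspace_d4_multiples that] by simp
  note adm = less.prems(1,2)[unfolded adm_dgr]
  \<comment> \<open>Vertex 4 has no slack, so the surplus of edges over the sum of \<open>c\<close>
    lies at the vertices 1, 2, 3. This is where positive \<open>d\<close>-degree enters.\<close>
  have n: "c 1 + c 2 + c 3 < int (g1 + y + w) + int (g2 + x + w') + int (g3 + x' + y')"
    using less.prems(5,6) k by (simp add: sum_4)
  have a: "0 \<le> int (g1 + y + w) - c 1" "0 \<le> int (g2 + x + w') - c 2" "0 \<le> int (g3 + x' + y') - c 3"
    "0 < int (g1 + y + w) - c 1 + (int (g2 + x + w') - c 2) + (int (g3 + x' + y') - c 3)"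
    using adm n by linarith+
  \<comment> \<open>The bounds that the target graph satisfies, rewritten as bounds on the
    displacement by the slacks of the current graph.\<close>
  have b: "int y - int Y + (int w - int W) \<le> int (g1 + y + w) - c 1"
    "int x - int X - (int w - int W) \<le> int (g2 + x + w') - c 2"
    "- (int x - int X) - (int y - int Y) \<le> int (g3 + x' + y') - c 3"
    using adm k K by linarith+
  have "x = X \<and> y = Y \<and> w = W \<or> X < x \<and> c 2 < int (g2 + x + w') \<or> x < X \<and> c 3 < int (g3 + x' + y')
    \<or> Y < y \<and> c 1 < int (g1 + y + w) \<or> y < Y \<and> c 3 < int (g3 + x' + y')
    \<or> W < w \<and> c 1 < int (g1 + y + w) \<or> w < W \<and> c 2 < int (g2 + x + w')"
    using unit_step_exists[OF a b] by simp
  then consider (eq) "x = X" "y = Y" "w = W"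
    | (x1) "X < x" "c 2 < int (g2 + x + w')" | (x2) "x < X" "c 3 < int (g3 + x' + y')"
    | (y1) "Y < y" "c 1 < int (g1 + y + w)" | (y2) "y < Y" "c 3 < int (g3 + x' + y')"
    | (w1) "W < w" "c 1 < int (g1 + y + w)" | (w2) "w < W" "c 2 < int (g2 + x + w')"
    by blast
  then show ?case
  proof cases
    case eq
    then have "x' = X'" "y' = Y'" "w' = W'" using k K by simp_all
    then show ?thesis using eq cfun.subspace_0[OF subspace_d4_multiples] by simp
  next
    case x1
    then obtain v where v: "x = Suc v" using k K by (cases x) auto
    have a: "adm c (?E v x' y y' w w')" "adm c (?E v (Suc x') y y' w w')"
      using adm x1(2) v by (simp_all add: adm_dgr)
    show ?thesis
      by (rule close[OF class_moves(1)[OF a(1), folded v] a(2)]) (use x1(1) v k in \<open>simp_all add: ind_dgr_iff\<close>)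
  next
    case x2
    then obtain v where v: "x' = Suc v" using k K by (cases x') auto
    have a: "adm c (?E x v y y' w w')" "adm c (?E (Suc x) v y y' w w')"
      using adm x2(2) v by (simp_all add: adm_dgr)
    show ?thesis
      by (rule close[OF sym[OF class_moves(1)[OF a(1), folded v]] a(2)]) (use x2(1) v k in \<open>simp_all add: ind_dgr_iff\<close>)
  next
    case y1
    then obtain v where v: "y = Suc v" using k K by (cases y) auto
    have a: "adm c (?E x x' v y' w w')" "adm c (?E x x' v (Suc y') w w')"
      using adm y1(2) v by (simp_all add: adm_dgr)
    show ?thesis
      by (rule close[OF class_moves(2)[OF a(1), folded v] a(2)]) (use y1(1) v k in \<open>simp_all add: ind_dgr_iff\<close>)
  next
    case y2
    then obtain v where v: "y' = Suc v" using k K by (cases y') auto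
    have a: "adm c (?E x x' y v w w')" "adm c (?E x x' (Suc y) v w w')"
      using adm y2(2) v by (simp_all add: adm_dgr)
    show ?thesis
      by (rule close[OF sym[OF class_moves(2)[OF a(1), folded v]] a(2)]) (use y2(1) v k in \<open>simp_all add: ind_dgr_iff\<close>)
  next
    case w1
    then obtain v where v: "w = Suc v" using k K by (cases w) auto
    have a: "adm c (?E x x' y y' v w')" "adm c (?E x x' y y' v (Suc w'))"
      using adm w1(2) v by (simp_all add: adm_dgr)
    show ?thesis
      by (rule close[OF class_moves(3)[OF a(1), folded v] a(2)]) (use w1(1) v k in \<open>simp_all add: ind_dgr_iff\<close>)
  next
    case w2
    then obtain v where v: "w' = Suc v" using k K by (cases w') auto
    have a: "adm c (?E x x' y y' w v)" "adm c (?E x x' y y' (Suc w) v)"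
      using adm w2(2) v by (simp_all add: adm_dgr)
    show ?thesis
      by (rule close[OF sym[OF class_moves(3)[OF a(1), folded v]] a(2)]) (use w2(1) v k in \<open>simp_all add: ind_dgr_iff\<close>)
  qed
qed

lemma class_equiv:
  assumes "adm c E" "adm c F" "ind E = k" "ind F = k" "d4_class E = d4_class F"
    and "c 4 = int (outd E 4)" "(\<Sum>i\<in>UNIV. c i) < int (\<Sum>i\<in>UNIV. k i)"
  shows "signed_mono c E - signed_mono c F \<in> d4_multiples c k"
proof -
  have E: "loopless E" and F: "loopless F" using assms(1,2) by (simp_all add: adm_def)
  have eq: "F 4 1 = E 4 1" "F 4 2 = E 4 2" "F 4 3 = E 4 3" "F 1 4 = E 1 4" "F 2 4 = E 2 4" "F 3 4 = E 3 4"
    using assms(5) by (simp_all add: d4_class_def)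
  note E' = loopless_eq_dgr[OF E] and F' = loopless_eq_dgr[OF F, unfolded eq]
  have "c 4 = int (E 4 1 + E 4 2 + E 4 3)"
    using assms(6) E by (simp add: outd_def sum_4 loopless_def)
  with assms show ?thesis
    using class_equiv_dgr[of c "E 4 1" "E 4 2" "E 4 3" "E 1 4" "E 2 4" "E 3 4" "E 2 1" "E 3 1" "E 1 2" "E 3 2" "E 1 3" "E 2 3"
      "F 2 1" "F 3 1" "F 1 2" "F 3 2" "F 1 3" "F 2 3" k]
    unfolding E'[symmetric] F'[symmetric] by simp
qed

text \<open>Hall's condition for orienting a multigraph on three vertices with prescribed lower bounds
  for the out-degrees.\<close>

lemma orientation_exists:
  fixes D1 D2 D3 :: int and \<kappa>1 \<kappa>2 \<kappa>3 :: nat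
  assumes "D1 \<le> \<kappa>2 + \<kappa>3" "D2 \<le> \<kappa>1 + \<kappa>3" "D3 \<le> \<kappa>1 + \<kappa>2"
    and "D1 + D2 \<le> \<kappa>1 + \<kappa>2 + \<kappa>3" "D1 + D3 \<le> \<kappa>1 + \<kappa>2 + \<kappa>3" "D2 + D3 \<le> \<kappa>1 + \<kappa>2 + \<kappa>3"
    and "D1 + D2 + D3 \<le> \<kappa>1 + \<kappa>2 + \<kappa>3"
  obtains x x' y y' w w' :: nat where "x + x' = \<kappa>1" "y + y' = \<kappa>2" "w + w' = \<kappa>3"
    "D1 \<le> y + w" "D2 \<le> x + w'" "D3 \<le> x' + y'"
proof -
  \<comment> \<open>A greedy choice: \<open>w\<close> is the least value that leaves room for the
    bounds D1 and D3 together, and \<open>y\<close> and \<open>x\<close> are then the least values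
    that meet D1 and D2.\<close>
  define w where "w = max 0 (max (D1 - \<kappa>2) (D1 + D3 - \<kappa>1 - \<kappa>2))"
  define y where "y = max 0 (D1 - w)"
  define x where "x = max 0 (D2 - \<kappa>3 + w)"
  have w: "0 \<le> w" "w \<le> \<kappa>3" and y: "0 \<le> y" "y \<le> \<kappa>2" and x: "0 \<le> x" "x \<le> \<kappa>1"
    using assms unfolding x_def y_def w_def by linarith+
  have D: "D1 \<le> y + w" "D2 \<le> x + (\<kappa>3 - w)" "D3 \<le> (\<kappa>1 - x) + (\<kappa>2 - y)"
    using assms unfolding x_def y_def w_def by linarith+
  show ?thesis
    using w y x D
    by (intro that[of "nat x" "nat (\<kappa>1 - x)" "nat y" "nat (\<kappa>2 - y)" "nat w" "nat (\<kappa>3 - w)"])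
      (simp_all flip: of_nat_add)
qed

text \<open>On the plane v_1 + v_2 + v_3 = 0 the monomials are binary forms and may be dependent.
  The assumption \<open>top\<close> prevents this: only the largest exponent of v_3 may occur more
  than once. Hence the smallest exponent of v_3 with a nonzero coefficient either occurs once and
  can be read off as a lowest coefficient, or all exponents of v_3 involved are equal and that power
  of v_3 cancels.\<close>

lemma binary_forms_independent:
  fixes \<beta> :: "'a \<Rightarrow> complex" and g1 g2 g3 :: "'a \<Rightarrow> nat"
  assumes S: "finite S" and deg: "\<And>x. x \<in> S \<Longrightarrow> g1 x + g2 x + g3 x = K"
    and inj: "\<And>x y. x \<in> S \<Longrightarrow> y \<in> S \<Longrightarrow> g1 x = g1 y \<Longrightarrow> g3 x = g3 y \<Longrightarrow> x = y"
    and top: "\<And>x y z. x \<in> S \<Longrightarrow> y \<in> S \<Longrightarrow> z \<in> S \<Longrightarrow> x \<noteq> y \<Longrightarrow> g3 x = g3 y \<Longrightarrow> g3 z \<le> g3 x"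
    and zero: "\<And>v1 v2 v3. v1 + v2 + v3 = 0 \<Longrightarrow> (\<Sum>x\<in>S. \<beta> x * (v1 ^ g1 x * v2 ^ g2 x * v3 ^ g3 x)) = 0"
  shows "\<forall>x\<in>S. \<beta> x = 0"
proof (rule ccontr)
  define T where "T = {x \<in> S. \<beta> x \<noteq> 0}"
  assume "\<not> (\<forall>x\<in>S. \<beta> x = 0)"
  then have T: "finite T" "T \<noteq> {}" "T \<subseteq> S" using S by (auto simp: T_def)
  have zeroT: "(\<Sum>x\<in>T. \<beta> x * (v1 ^ g1 x * v2 ^ g2 x * v3 ^ g3 x)) = 0" if "v1 + v2 + v3 = 0" for v1 v2 v3
  proof -
    have "(\<Sum>x\<in>T. \<beta> x * (v1 ^ g1 x * v2 ^ g2 x * v3 ^ g3 x)) = (\<Sum>x\<in>S. \<beta> x * (v1 ^ g1 x * v2 ^ g2 x * v3 ^ g3 x))"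
      using S by (intro sum.mono_neutral_left) (auto simp: T_def)
    then show ?thesis using zero[OF that] by simp
  qed
  define t where "t = Min (g3 ` T)"
  have "t \<in> g3 ` T" unfolding t_def using T by (intro Min_in) auto
  then obtain x where x: "x \<in> T" "g3 x = t" by auto
  have t: "t \<le> g3 y" if "y \<in> T" for y using that T by (simp add: t_def)
  show False
  proof (cases "\<exists>y\<in>T. y \<noteq> x \<and> g3 y = t")
    case False
    \<comment> \<open>Dehomogenization by v_2 = 1, v_3 = u, v_1 = - 1 - u: the coefficient of degree
      \<open>t\<close> comes from \<open>x\<close> alone.\<close>
    define P where "P = (\<Sum>y\<in>T. smult (\<beta> y) (monom 1 (g3 y) * [:-1, -1:] ^ g1 y))"
    have "poly P u = 0" for u
      using zeroT[of "- 1 - u" 1 u] by (simp add: P_def poly_sum poly_monom poly_power mult.commute[of "u ^ _"])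
    then have "P = 0" using poly_all_0_iff_0 by blast
    moreover have "coeff P t = (\<Sum>y\<in>T. if y = x then \<beta> x * (-1) ^ g1 x else 0)"
      unfolding P_def coeff_sum
    proof (rule sum.cong[OF refl])
      fix y assume y: "y \<in> T"
      have "coeff ([:-1, -1 :: complex:] ^ g1 x) 0 = (-1) ^ g1 x"
        by (simp flip: poly_0_coeff_0)
      moreover have "t < g3 y" if "y \<noteq> x" using False t[OF y] y that by (metis le_neq_implies_less)
      ultimately show "coeff (smult (\<beta> y) (monom 1 (g3 y) * [:-1, -1:] ^ g1 y)) t
          = (if y = x then \<beta> x * (-1) ^ g1 x else 0)"
        using x by (auto simp: coeff_monom_mult)
    qed
    moreover have "\<beta> x * (-1) ^ g1 x \<noteq> 0" using x by (simp add: T_def)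
    ultimately show False using x T by simp
  next
    case True
    then obtain y where y: "y \<in> T" "y \<noteq> x" "g3 y = t" by blast
    have g3: "g3 z = t" if "z \<in> T" for z
      using top[of x y z] that t[OF that] x y T by force
    \<comment> \<open>Now v_1 = u, v_2 = 1 and v_3 = - 1 - u: the common power of v_3 splits off,
      and distinct elements have distinct exponents of v_1.\<close>
    define P where "P = (\<Sum>z\<in>T. monom (\<beta> z) (g1 z))"
    have "poly (P * [:-1, -1:] ^ t) u = 0" for u
    proof -
      have "poly (P * [:-1, -1:] ^ t) u = (\<Sum>z\<in>T. \<beta> z * (u ^ g1 z * 1 ^ g2 z * (- 1 - u) ^ g3 z))"
        by (simp add: P_def poly_sum poly_monom g3 sum_distrib_right mult.assoc)
      then show ?thesis using zeroT[of u 1 "- 1 - u"] by simp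
    qed
    then have "P * [:-1, -1:] ^ t = 0" using poly_all_0_iff_0 by blast
    then have "P = 0" by simp
    have "coeff P (g1 x) = (\<Sum>z\<in>T. if z = x then \<beta> x else 0)"
      unfolding P_def coeff_sum using inj T x g3 by (intro sum.cong refl) (auto simp: subset_iff)
    then show False using \<open>P = 0\<close> T x by (simp add: T_def)
  qed
qed

text \<open>A family of configurations with \<open>d\<^sub>4 = 0\<close>, on which the monomials without a factor \<open>d\<^sub>4\<close>
  become signed monomials in \<open>q\<close> and \<open>v\<close>.\<close>

definition d4_locus :: "complex \<Rightarrow> complex \<Rightarrow> complex \<Rightarrow> complex \<Rightarrow> complex \<Rightarrow> config"
  where "d4_locus q1 q2 q3 v1 v2 =
    ((\<chi> i. if i = 1 then vector [0, 1, q1] else if i = 2 then vector [1, 0, q2]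
           else if i = 3 then vector [1, -1, q3] else vector [v1, v2, 0]),
     (\<chi> i. if i = 1 then vector [1, 0, 0] else if i = 2 then vector [0, 1, 0]
           else if i = 3 then vector [-1, -1, 0] else vector [0, 0, 1]))"

lemma d4_locus_M4: "d4_locus q1 q2 q3 v1 v2 \<in> M4"
  by (simp add: M4_def forall_4 d4_locus_def scalar_product_3)

lemma d4_locus_d:
  "d 1 (d4_locus q1 q2 q3 v1 v2) = 1" "d 2 (d4_locus q1 q2 q3 v1 v2) = 1"
  "d 3 (d4_locus q1 q2 q3 v1 v2) = 1" "d 4 (d4_locus q1 q2 q3 v1 v2) = 0"
  by (simp_all add: d_simps D_on_M4[OF d4_locus_M4] det_3) (simp_all add: d4_locus_def)

lemma d4_locus_C:
  fixes q1 q2 q3 v1 v2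
  defines "z \<equiv> d4_locus q1 q2 q3 v1 v2"
  shows "C 2 1 z = 1" "C 3 1 z = -1" "C 4 1 z = q1" "C 1 2 z = 1" "C 3 2 z = -1" "C 4 2 z = q2"
    "C 1 3 z = 1" "C 2 3 z = -1" "C 4 3 z = q3" "C 1 4 z = v1" "C 2 4 z = v2" "C 3 4 z = - v1 - v2"
  unfolding z_def C_on_M4[OF d4_locus_M4] scalar_product_3 by (simp_all add: d4_locus_def)

lemma mono_at_d4_locus:
  assumes "loopless E" "c 4 = int (outd E 4)" "v1 + v2 + v3 = 0"
  shows "mono_at c E (d4_locus q1 q2 q3 v1 v2)
    = class_sign E * (q1 ^ E 4 1 * q2 ^ E 4 2 * q3 ^ E 4 3) * (v1 ^ E 1 4 * v2 ^ E 2 4 * v3 ^ E 3 4)"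
proof -
  have v3: "v3 = - v1 - v2" using assms(3) by (simp add: add_eq_0_iff algebra_simps)
  have "(\<Prod>i\<in>UNIV. \<Prod>j\<in>UNIV. C i j (d4_locus q1 q2 q3 v1 v2) ^ E i j)
    = class_sign E * (q1 ^ E 4 1 * q2 ^ E 4 2 * q3 ^ E 4 3) * (v1 ^ E 1 4 * v2 ^ E 2 4 * v3 ^ E 3 4)"
    using assms(1) unfolding prod_UNIV_4 d4_locus_C v3 class_sign_def power_add loopless_def
    by simp
  moreover have "(\<Prod>i\<in>UNIV. d i (d4_locus q1 q2 q3 v1 v2) ^ nat (int (outd E i) - c i)) = 1"
    using assms(2) by (simp add: prod_UNIV_4 d4_locus_d)
  ultimately show ?thesis
    by (simp add: mono_at_def dC_monom_def on_M4_def d4_locus_M4)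
qed

text \<open>The graphs to which the relation in column \<open>4\<close> cannot be applied in order to lower \<open>E 1 4\<close>.\<close>

definition d4_terminal :: "(4 \<Rightarrow> int) \<Rightarrow> (4 \<Rightarrow> nat) \<Rightarrow> digraph \<Rightarrow> bool"
  where "d4_terminal c k E \<longleftrightarrow> adm c E \<and> ind E = k \<and> c 4 = int (outd E 4) \<and>
    \<not> (\<exists>E'. adm c E' \<and> ind (E' + edge 1 4) = k \<and> d4_class (E' + edge 1 4) = d4_class E)"

text \<open>This provides the assumption \<open>top\<close> of
  \<open>binary_forms_independent\<close> for terminal graphs. If \<open>E''\<close> had more edges
  3 -> 4 than \<open>E'\<close>, then one edge 1 -> 4 of \<open>E'\<close> could be removed after
  reorienting the edges among 1, 2, 3, against terminality.\<close>

lemma d4_terminal_top: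
  assumes T: "d4_terminal c k E" "d4_terminal c k E'" "d4_terminal c k E''"
    and p: "E 4 1 = E' 4 1" "E 4 2 = E' 4 2" "E 4 3 = E' 4 3" "E'' 4 1 = E' 4 1" "E'' 4 2 = E' 4 2" "E'' 4 3 = E' 4 3"
    and lt: "E 1 4 < E' 1 4" and eq: "E 3 4 = E' 3 4"
    and n: "(\<Sum>i\<in>UNIV. c i) < int (\<Sum>i\<in>UNIV. k i)"
  shows "E'' 3 4 \<le> E' 3 4"
proof (rule ccontr)
  assume gt: "\<not> E'' 3 4 \<le> E' 3 4"
  have l: "loopless E" "loopless E'" "loopless E''" using T by (auto simp: d4_terminal_def adm_def)
  obtain p1 p2 p3 g1 g2 g3 x x' y y' w w' where E: "E = dgr p1 p2 p3 g1 g2 g3 x x' y y' w w'"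
    using loopless_cases[OF l(1)] by blast
  obtain p1' p2' p3' h1 h2 h3 a a' b b' e e' where E': "E' = dgr p1' p2' p3' h1 h2 h3 a a' b b' e e'"
    using loopless_cases[OF l(2)] by blast
  obtain p1'' p2'' p3'' f1 f2 f3 r r' s s' t t' where E'': "E'' = dgr p1'' p2'' p3'' f1 f2 f3 r r' s s' t t'"
    using loopless_cases[OF l(3)] by blast
  have pp: "p1' = p1" "p2' = p2" "p3' = p3" "p1'' = p1" "p2'' = p2" "p3'' = p3"
    using p by (simp_all add: dgr_entries[OF E] dgr_entries[OF E'] dgr_entries[OF E''])
  have lt': "g1 < h1" "g3 = h3" "h3 < f3"
    using lt eq gt by (simp_all add: dgr_entries[OF E] dgr_entries[OF E'] dgr_entries[OF E''])
  obtain h where h: "h1 = Suc h" using lt'(1) by (cases h1) auto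
  define \<kappa>1 \<kappa>2 \<kappa>3 where "\<kappa>1 = a + a'" and "\<kappa>2 = b + b'" and "\<kappa>3 = e + e'"
  have "adm c E" "ind E = k" "c 4 = int (outd E 4)"
    using T(1) unfolding d4_terminal_def by blast+
  then have A: "c 1 \<le> int (g1 + y + w)" "c 2 \<le> int (g2 + x + w')" "c 3 \<le> int (g3 + x' + y')" "c 4 = int (p1 + p2 + p3)"
     "k 1 = p1 + x + x'" "k 2 = p2 + y + y'" "k 3 = p3 + w + w'" "k 4 = g1 + g2 + g3"
    unfolding E adm_dgr ind_dgr_iff outd_dgr by blast+
  have "adm c E'" "ind E' = k" using T(2) unfolding d4_terminal_def by blast+
  then have A': "c 1 \<le> int (h1 + b + e)" "c 2 \<le> int (h2 + a + e')" "c 3 \<le> int (h3 + a' + b')"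
     "k 1 = p1 + a + a'" "k 2 = p2 + b + b'" "k 3 = p3 + e + e'" "k 4 = h1 + h2 + h3"
    unfolding E' adm_dgr ind_dgr_iff pp by blast+
  have "adm c E''" "ind E'' = k" using T(3) unfolding d4_terminal_def by blast+
  then have A'': "c 1 \<le> int (f1 + s + t)" "c 2 \<le> int (f2 + r + t')" "c 3 \<le> int (f3 + r' + s')"
     "k 1 = p1 + r + r'" "k 2 = p2 + s + s'" "k 3 = p3 + t + t'" "k 4 = f1 + f2 + f3"
    unfolding E'' adm_dgr ind_dgr_iff pp by blast+
  have sums: "x + x' = \<kappa>1" "y + y' = \<kappa>2" "w + w' = \<kappa>3" "r + r' = \<kappa>1" "s + s' = \<kappa>2" "t + t' = \<kappa>3"
    unfolding \<kappa>1_def \<kappa>2_def \<kappa>3_def using A(5-7) A'(4-6) A''(4-6) by linarith+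
  have K: "g1 + g2 + g3 = h1 + h2 + h3" "f1 + f2 + f3 = h1 + h2 + h3" using A(8) A'(7) A''(7) by linarith+
  have n': "c 1 + c 2 + c 3 < int (\<kappa>1 + \<kappa>2 + \<kappa>3 + h1 + h2 + h3)"
    using n A'(4-7) A(4) unfolding sum_4 \<kappa>1_def \<kappa>2_def \<kappa>3_def by linarith
  have kk: "a + a' = \<kappa>1" "b + b' = \<kappa>2" "e + e' = \<kappa>3" by (simp_all add: \<kappa>1_def \<kappa>2_def \<kappa>3_def)
  obtain X X' Y Y' W W' :: nat where XYW: "X + X' = \<kappa>1" "Y + Y' = \<kappa>2" "W + W' = \<kappa>3"
    "c 1 - h \<le> Y + W" "c 2 - h2 \<le> X + W'" "c 3 - h3 \<le> X' + Y'"
  \<comment> \<open>Hall's conditions without that edge. Those for 1 and for 1, 3 come from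
    \<open>E\<close>, which has fewer edges 1 -> 4 and equally many 3 -> 4; the one for 1, 2 from
    \<open>E''\<close>, which has fewer edges from 1 and 2 into 4; those that avoid 1 from
    \<open>E'\<close> itself; the one for 1, 2, 3 from positive \<open>d\<close>-degree.\<close>
  proof (rule orientation_exists[of "c 1 - h" \<kappa>2 \<kappa>3 "c 2 - h2" \<kappa>1 "c 3 - h3"])
    show "c 1 - h \<le> \<kappa>2 + \<kappa>3" using A(1) sums lt' h by linarith
    show "c 2 - h2 \<le> \<kappa>1 + \<kappa>3" using A'(2) kk by linarith
    show "c 3 - h3 \<le> \<kappa>1 + \<kappa>2" using A'(3) kk by linarith
    show "c 1 - h + (c 2 - h2) \<le> \<kappa>1 + \<kappa>2 + \<kappa>3" using A''(1,2) sums K lt' h by linarith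
    show "c 1 - h + (c 3 - h3) \<le> \<kappa>1 + \<kappa>2 + \<kappa>3" using A(1,3) sums lt' h by linarith
    show "c 2 - h2 + (c 3 - h3) \<le> \<kappa>1 + \<kappa>2 + \<kappa>3" using A'(2,3) kk by linarith
    show "c 1 - h + (c 2 - h2) + (c 3 - h3) \<le> \<kappa>1 + \<kappa>2 + \<kappa>3" using n' h by linarith
  qed
  let ?F = "dgr p1 p2 p3 h h2 h3 X X' Y Y' W W'"
  have "adm c ?F" using XYW A(4) unfolding adm_dgr by linarith
  moreover have "ind (?F + edge 1 4) = k"
    using XYW(1-3) A'(4-7) h unfolding dgr_add_arc ind_dgr_iff \<kappa>1_def \<kappa>2_def \<kappa>3_def by linarith
  moreover have "d4_class (?F + edge 1 4) = d4_class E'"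
    unfolding dgr_add_arc E' pp h by (simp add: d4_class_def dgr_entries[OF refl])
  ultimately show False using T(2) by (auto simp: d4_terminal_def)
qed

text \<open>A graph that is not terminal and has no factor \<open>d 4\<close> is congruent, up to
  sign, to one with a removable edge 1 -> 4. The relation in column 4 replaces this edge by 2 -> 4
  or 3 -> 4, which lowers the induction measure.\<close>

lemma mono_at_mod_d4:
  assumes "adm c E" "ind E = k" and n: "(\<Sum>i\<in>UNIV. c i) < int (\<Sum>i\<in>UNIV. k i)"
  shows "mono_at c E \<in> cfun.span (d4_multiples c k \<union> mono_at c ` {E. d4_terminal c k E})"
  using assms(1,2)
proof (induction "E 1 4" arbitrary: E rule: less_induct)
  case less
  let ?V = "cfun.span (d4_multiples c k \<union> mono_at c ` {E. d4_terminal c k E})"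
  have J: "f \<in> ?V" if "f \<in> d4_multiples c k" for f using that by (simp add: cfun.span_base)
  consider "c 4 < int (outd E 4)" | "c 4 = int (outd E 4)" "d4_terminal c k E"
    | E' where "c 4 = int (outd E 4)" "adm c E'" "ind (E' + edge 1 4) = k" "d4_class (E' + edge 1 4) = d4_class E"
    using less.prems unfolding d4_terminal_def adm_def by (metis order_le_less)
  then show ?case
  proof cases
    case 1
    then show ?thesis using less.prems by (intro J mono_at_d4_multiple) auto
  next
    case 2
    then show ?thesis by (intro cfun.span_base) auto
  next
    case 3
    have ar: "ind (E' + edge i 4) = k" for i using 3(3) by (auto simp: fun_eq_iff ind_add ind_arc)
    have adm: "adm c (E' + edge i 4)" if "i \<noteq> 4" for i using 3(2) that by (rule adm_arc)
    have g1: "(E' + edge i 4) 1 4 < E 1 4" if "i \<noteq> 1" for i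
      using 3(4) that by (simp add: d4_class_def edge_def)
    have "mono_at c (E' + edge 2 4) \<in> ?V" "mono_at c (E' + edge 3 4) \<in> ?V"
      using less.hyps g1 adm ar by simp_all
    moreover have "mono_at c (E' + edge 1 4) = - (mono_at c (E' + edge 2 4) + mono_at c (E' + edge 3 4))"
      using mono_at_relation[OF 3(2), of 4] unfolding UNIV_minus_4
      by (simp add: eq_neg_iff_add_eq_0 add.assoc del: minus_add_distrib)
    ultimately have 1: "mono_at c (E' + edge 1 4) \<in> ?V"
      by (metis cfun.span_add cfun.span_neg)
    have "signed_mono c E - signed_mono c (E' + edge 1 4) \<in> ?V"
      using class_equiv[OF less.prems(1) adm[of 1] less.prems(2) 3(3) 3(4)[symmetric] 3(1) n] by (intro J) simp
    moreover have "signed_mono c (E' + edge 1 4) \<in> ?V"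
      unfolding signed_mono_def using 1 by (rule cfun.span_scale)
    ultimately have "signed_mono c E \<in> ?V" using cfun.span_add by fastforce
    then have "cscale (class_sign E) (signed_mono c E) \<in> ?V" by (rule cfun.span_scale)
    moreover have "cscale (class_sign E) (signed_mono c E) = mono_at c E"
      by (simp add: signed_mono_def class_sign_def cscale_def flip: mult.assoc power_mult_distrib)
    ultimately show ?thesis by simp
  qed
qed

text \<open>Modulo \<open>d 4\<close> one terminal graph per class suffices. On
  \<open>d4_locus\<close> the exponents of q are the entries of row 4, which independence of
  characters separates; for a fixed row 4 there remains a relation between binary forms in v whose
  exponents are the entries of column 4. So all coefficients vanish.\<close>

theorem divide_by_d4:
  assumes f: "f \<in> mono_span c k" and n: "(\<Sum>i\<in>UNIV. c i) < int (\<Sum>i\<in>UNIV. k i)"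
    and zero: "\<And>z. z \<in> M4 \<Longrightarrow> d 4 z = 0 \<Longrightarrow> f z = 0"
  shows "\<exists>g \<in> mono_span (c(4 := c 4 + 1)) k. f = d 4 * g"
proof -
  let ?J = "d4_multiples c k"
  define cls where "cls = d4_class ` {E. d4_terminal c k E}"
  define rp where "rp \<kappa> = (SOME E. d4_terminal c k E \<and> d4_class E = \<kappa>)" for \<kappa>
  have rp: "d4_terminal c k (rp \<kappa>)" "d4_class (rp \<kappa>) = \<kappa>" if "\<kappa> \<in> cls" for \<kappa>
    using that someI_ex[of "\<lambda>E. d4_terminal c k E \<and> d4_class E = \<kappa>"] unfolding cls_def rp_def by auto
  let ?R = "(\<lambda>\<kappa>. signed_mono c (rp \<kappa>)) ` cls"
  have reduce: "mono_at c E \<in> cfun.span (?J \<union> ?R)" if "d4_terminal c k E" for E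
  proof -
    have \<kappa>: "d4_class E \<in> cls" using that by (auto simp: cls_def)
    note r = rp[OF \<kappa>]
    have "signed_mono c E - signed_mono c (rp (d4_class E)) \<in> ?J"
      using that r n by (intro class_equiv) (auto simp: d4_terminal_def)
    then have "signed_mono c E - signed_mono c (rp (d4_class E)) \<in> cfun.span (?J \<union> ?R)"
      by (simp add: cfun.span_base)
    moreover have "signed_mono c (rp (d4_class E)) \<in> cfun.span (?J \<union> ?R)"
      using \<kappa> by (intro cfun.span_base) auto
    ultimately have "signed_mono c E \<in> cfun.span (?J \<union> ?R)" using cfun.span_add by fastforce
    then have "cscale (class_sign E) (signed_mono c E) \<in> cfun.span (?J \<union> ?R)" by (rule cfun.span_scale)
    moreover have "cscale (class_sign E) (signed_mono c E) = mono_at c E"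
      by (simp add: signed_mono_def class_sign_def cscale_def flip: mult.assoc power_mult_distrib)
    ultimately show ?thesis by simp
  qed
  have "mono_at c E \<in> cfun.span (?J \<union> ?R)" if "adm c E" "ind E = k" for E
  proof -
    have "cfun.span (?J \<union> mono_at c ` {E. d4_terminal c k E}) \<subseteq> cfun.span (?J \<union> ?R)"
      using reduce by (intro cfun.span_minimal cfun.subspace_span) (auto intro: cfun.span_base)
    then show ?thesis using mono_at_mod_d4[OF that n] by blast
  qed
  then have "f \<in> cfun.span (?J \<union> ?R)"
    using f cfun.span_minimal[OF _ cfun.subspace_span, of "mono_at c ` {E. adm c E \<and> ind E = k}" "?J \<union> ?R"]
    unfolding mono_span_def by blast
  then obtain j s where j: "j \<in> ?J" and s: "s \<in> cfun.span ?R" and fjs: "f = j + s"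
    unfolding cfun.span_Un cfun.span_eq_iff[THEN iffD2, OF subspace_d4_multiples] by auto
  obtain F \<beta> where F: "finite F" "F \<subseteq> cls" and s_eq: "s = (\<lambda>z. \<Sum>\<kappa>\<in>F. \<beta> \<kappa> * signed_mono c (rp \<kappa>) z)"
    by (rule span_image_finite_sum[OF s])
  define P where "P \<kappa> i = (if i = (1::3) then \<kappa> ! 0 else if i = 2 then \<kappa> ! 1 else \<kappa> ! 2 :: nat)" for \<kappa> i
  have rp_entries: "rp \<kappa> 4 1 = \<kappa> ! 0" "rp \<kappa> 4 2 = \<kappa> ! 1" "rp \<kappa> 4 3 = \<kappa> ! 2"
     "rp \<kappa> 1 4 = \<kappa> ! 3" "rp \<kappa> 2 4 = \<kappa> ! 4" "rp \<kappa> 3 4 = \<kappa> ! 5" if "\<kappa> \<in> cls" for \<kappa>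
  proof -
    have eq: "d4_class (rp \<kappa>) ! i = \<kappa> ! i" for i using rp(2)[OF that] by simp
    show "rp \<kappa> 4 1 = \<kappa> ! 0" "rp \<kappa> 4 2 = \<kappa> ! 1" "rp \<kappa> 4 3 = \<kappa> ! 2"
      "rp \<kappa> 1 4 = \<kappa> ! 3" "rp \<kappa> 2 4 = \<kappa> ! 4" "rp \<kappa> 3 4 = \<kappa> ! 5"
      unfolding eq[symmetric] d4_class_def by simp_all
  qed
  have key: "(\<Sum>\<kappa>\<in>F. \<beta> \<kappa> * (v1 ^ (\<kappa> ! 3) * v2 ^ (\<kappa> ! 4) * v3 ^ (\<kappa> ! 5)) * tchar (\<lambda>i. int (P \<kappa> i)) q) = 0"
    if v: "v1 + v2 + v3 = 0" for v1 v2 v3 q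
  proof -
    let ?z = "d4_locus (q 1) (q 2) (q 3) v1 v2"
    have "j ?z = 0" using j by (auto simp: d4_multiples_def d4_locus_d)
    then have "0 = s ?z" using zero[OF d4_locus_M4 d4_locus_d(4), of "q 1" "q 2" "q 3" v1 v2] by (simp add: fjs)
    also have "s ?z = (\<Sum>\<kappa>\<in>F. \<beta> \<kappa> * (v1 ^ (\<kappa> ! 3) * v2 ^ (\<kappa> ! 4) * v3 ^ (\<kappa> ! 5)) * tchar (\<lambda>i. int (P \<kappa> i)) q)"
      unfolding s_eq
    proof (rule sum.cong[OF refl])
      fix \<kappa> assume "\<kappa> \<in> F"
      then have \<kappa>: "\<kappa> \<in> cls" using F by auto
      then have l: "loopless (rp \<kappa>)" "c 4 = int (outd (rp \<kappa>) 4)" using rp(1) by (auto simp: d4_terminal_def adm_def)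
      have sg: "class_sign (rp \<kappa>) * (class_sign (rp \<kappa>) * x) = x" for x
        by (simp add: class_sign_def flip: mult.assoc power_mult_distrib)
      show "\<beta> \<kappa> * signed_mono c (rp \<kappa>) ?z
        = \<beta> \<kappa> * (v1 ^ (\<kappa> ! 3) * v2 ^ (\<kappa> ! 4) * v3 ^ (\<kappa> ! 5)) * tchar (\<lambda>i. int (P \<kappa> i)) q"
        unfolding signed_mono_def cscale_def mono_at_d4_locus[of _ c, OF l v] rp_entries[OF \<kappa>]
        by (simp add: sg tchar_def prod_UNIV_3 P_def mult.assoc mult.commute)
    qed
    finally show ?thesis by simp
  qed
  have "\<beta> \<kappa> = 0" if "\<kappa> \<in> F" for \<kappa>
  proof -
    \<comment> \<open>The classes in \<open>F\<close> with the same row 4, hence with the same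
      monomial in q.\<close>
    define S where "S = {\<kappa>'\<in>F. P \<kappa>' = P \<kappa>}"
    have inS: "\<kappa>' \<in> cls" "\<kappa>' ! 0 = \<kappa> ! 0" "\<kappa>' ! 1 = \<kappa> ! 1" "\<kappa>' ! 2 = \<kappa> ! 2" if "\<kappa>' \<in> S" for \<kappa>'
    proof -
      have "P \<kappa>' 1 = P \<kappa> 1" "P \<kappa>' 2 = P \<kappa> 2" "P \<kappa>' 3 = P \<kappa> 3" using that by (auto simp: S_def)
      then show "\<kappa>' \<in> cls" "\<kappa>' ! 0 = \<kappa> ! 0" "\<kappa>' ! 1 = \<kappa> ! 1" "\<kappa>' ! 2 = \<kappa> ! 2"
        using that F by (auto simp: S_def P_def)
    qed
    have deg: "\<kappa>' ! 3 + \<kappa>' ! 4 + \<kappa>' ! 5 = k 4" if "\<kappa>' \<in> cls" for \<kappa>'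
    proof -
      have "loopless (rp \<kappa>')" "ind (rp \<kappa>') = k" using rp(1)[OF that] by (auto simp: d4_terminal_def adm_def)
      then have "ind (rp \<kappa>') 4 = k 4" "rp \<kappa>' 4 4 = 0" by (auto simp: loopless_def)
      then show ?thesis by (simp add: ind_def sum_4 rp_entries[OF that])
    qed
    have len: "length \<kappa>' = 6" if "\<kappa>' \<in> cls" for \<kappa>' using that by (auto simp: cls_def d4_class_def)
    have inj: "x = y" if "x \<in> S" "y \<in> S" "x ! 3 = y ! 3" "x ! 5 = y ! 5" for x y
    proof (rule nth_equalityI)
      show "length x = length y" using len inS that by simp
      fix i assume "i < length x"
      then have "i = 0 \<or> i = 1 \<or> i = 2 \<or> i = 3 \<or> i = 4 \<or> i = 5" using len[OF inS(1)[OF that(1)]] by auto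
      moreover have "x ! 4 = y ! 4" using deg[OF inS(1)[OF that(1)]] deg[OF inS(1)[OF that(2)]] that by simp
      ultimately show "x ! i = y ! i" using that inS(2-4)[OF that(1)] inS(2-4)[OF that(2)] by auto
    qed
    have "\<forall>x\<in>S. \<beta> x = 0"
    proof (rule binary_forms_independent[of S "\<lambda>\<kappa>. \<kappa> ! 3" "\<lambda>\<kappa>. \<kappa> ! 4" "\<lambda>\<kappa>. \<kappa> ! 5" "k 4"])
      show "finite S" using F by (simp add: S_def)
      show "x ! 3 + x ! 4 + x ! 5 = k 4" if "x \<in> S" for x using deg inS(1) that by blast
      show "x = y" if "x \<in> S" "y \<in> S" "x ! 3 = y ! 3" "x ! 5 = y ! 5" for x y by (rule inj[OF that])
      show "z ! 5 \<le> x ! 5" if xyz: "x \<in> S" "y \<in> S" "z \<in> S" "x \<noteq> y" "x ! 5 = y ! 5" for x y z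
      proof -
        have "x ! 3 \<noteq> y ! 3" using inj xyz by blast
        then consider "x ! 3 < y ! 3" | "y ! 3 < x ! 3" by linarith
        then show ?thesis
        proof cases
          case 1
          then show ?thesis
            using d4_terminal_top[OF rp(1) rp(1) rp(1), of x y z] n inS[OF xyz(1)] inS[OF xyz(2)] inS[OF xyz(3)] xyz(5)
            by (simp add: rp_entries)
        next
          case 2
          then show ?thesis
            using d4_terminal_top[OF rp(1) rp(1) rp(1), of y x z] n inS[OF xyz(1)] inS[OF xyz(2)] inS[OF xyz(3)] xyz(5)
            by (simp add: rp_entries)
        qed
      qed
      show "(\<Sum>x\<in>S. \<beta> x * (v1 ^ x ! 3 * v2 ^ x ! 4 * v3 ^ x ! 5)) = 0" if v: "v1 + v2 + v3 = 0" for v1 v2 v3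
      proof -
        define w where "w \<kappa> = (\<lambda>i. int (P \<kappa> i))" for \<kappa>
        have "\<forall>u\<in>w ` F. (\<Sum>x\<in>{x\<in>F. w x = u}. \<beta> x * (v1 ^ x ! 3 * v2 ^ x ! 4 * v3 ^ x ! 5)) = 0"
        proof (rule tchar_independent)
          fix q :: "3 \<Rightarrow> complex"
          have "(\<Sum>u\<in>w ` F. (\<Sum>x\<in>{x\<in>F. w x = u}. \<beta> x * (v1 ^ x ! 3 * v2 ^ x ! 4 * v3 ^ x ! 5)) * tchar u q)
             = (\<Sum>u\<in>w ` F. \<Sum>x\<in>{x\<in>F. w x = u}. \<beta> x * (v1 ^ x ! 3 * v2 ^ x ! 4 * v3 ^ x ! 5) * tchar (w x) q)"
            by (auto simp: sum_distrib_right intro!: sum.cong)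
          also have "\<dots> = (\<Sum>x\<in>F. \<beta> x * (v1 ^ x ! 3 * v2 ^ x ! 4 * v3 ^ x ! 5) * tchar (w x) q)"
            using F by (intro sum.group) auto
          also have "\<dots> = 0" using key[OF v, of q] by (simp add: w_def)
          finally show "(\<Sum>u\<in>w ` F. (\<Sum>x\<in>{x\<in>F. w x = u}. \<beta> x * (v1 ^ x ! 3 * v2 ^ x ! 4 * v3 ^ x ! 5)) * tchar u q) = 0" .
        qed (use F in simp)
        moreover have "S = {x\<in>F. w x = w \<kappa>}" by (auto simp: S_def w_def fun_eq_iff)
        ultimately show ?thesis using \<open>\<kappa> \<in> F\<close> by auto
      qed
    qed
    then show ?thesis using that by (simp add: S_def)
  qed
  then have "s = 0" unfolding s_eq by (auto simp: fun_eq_iff)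
  then have "f \<in> ?J" using j fjs by simp
  then show ?thesis by (auto simp: d4_multiples_def)
qed

section \<open>The first fundamental theorem\<close>

lemma coord_ring_along_path:
  fixes pc pr :: "4 \<Rightarrow> 3 \<Rightarrow> complex poly"
  assumes f: "f \<in> coord_ring"
    and path: "\<And>\<epsilon>. ((\<chi> i. \<chi> a. poly (pc i a) \<epsilon>), (\<chi> i. \<chi> a. poly (pr i a) \<epsilon>)) \<in> M4"
  shows "\<exists>p. \<forall>\<epsilon>. f ((\<chi> i. \<chi> a. poly (pc i a) \<epsilon>), (\<chi> i. \<chi> a. poly (pr i a) \<epsilon>)) = poly p \<epsilon>"
proof -
  let ?z = "\<lambda>\<epsilon>. ((\<chi> i. \<chi> a. poly (pc i a) \<epsilon>), (\<chi> i. \<chi> a. poly (pr i a) \<epsilon>)) :: config"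
  have "cfun.subspace {f. \<exists>p. \<forall>\<epsilon>. f (?z \<epsilon>) = poly p \<epsilon>}"
  proof (rule cfun.subspaceI; unfold mem_Collect_eq)
    show "\<exists>p. \<forall>\<epsilon>. 0 (?z \<epsilon>) = poly p \<epsilon>" by (intro exI[of _ 0]) simp
    fix x y and a :: complex
    show "\<exists>p. \<forall>\<epsilon>. (x + y) (?z \<epsilon>) = poly p \<epsilon>"
      if x: "\<exists>p. \<forall>\<epsilon>. x (?z \<epsilon>) = poly p \<epsilon>" and y: "\<exists>p. \<forall>\<epsilon>. y (?z \<epsilon>) = poly p \<epsilon>"
    proof -
      obtain p where "\<forall>\<epsilon>. x (?z \<epsilon>) = poly p \<epsilon>" using x by (elim exE)
      moreover obtain q where "\<forall>\<epsilon>. y (?z \<epsilon>) = poly q \<epsilon>" using y by (elim exE)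
      ultimately show ?thesis by (intro exI[of _ "p + q"]) simp
    qed
    show "\<exists>p. \<forall>\<epsilon>. cscale a x (?z \<epsilon>) = poly p \<epsilon>" if x: "\<exists>p. \<forall>\<epsilon>. x (?z \<epsilon>) = poly p \<epsilon>"
    proof -
      obtain p where "\<forall>\<epsilon>. x (?z \<epsilon>) = poly p \<epsilon>" using x by (elim exE)
      then show ?thesis by (intro exI[of _ "smult a p"]) (simp add: cscale_def)
    qed
  qed
  moreover have "on_M4 (monom_fun \<alpha> \<beta>) (?z \<epsilon>)
    = poly ((\<Prod>i\<in>UNIV. \<Prod>a\<in>UNIV. pc i a ^ \<alpha> i a) * (\<Prod>i\<in>UNIV. \<Prod>a\<in>UNIV. pr i a ^ \<beta> i a)) \<epsilon>" for \<alpha> \<beta> \<epsilon>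
    using path[of \<epsilon>] by (simp add: on_M4_def monom_fun_def poly_prod)
  then have "{on_M4 (monom_fun \<alpha> \<beta>) |\<alpha> \<beta>. True} \<subseteq> {f. \<exists>p. \<forall>\<epsilon>. f (?z \<epsilon>) = poly p \<epsilon>}"
    by blast
  ultimately have "coord_ring \<subseteq> {f. \<exists>p. \<forall>\<epsilon>. f (?z \<epsilon>) = poly p \<epsilon>}"
    unfolding coord_ring_def by (intro cfun.span_minimal)
  then show ?thesis using f by blast
qed

definition ccross :: "complex ^ 3 \<Rightarrow> complex ^ 3 \<Rightarrow> complex ^ 3"
  where "ccross b u = vector [b$2 * u$3 - b$3 * u$2, b$3 * u$1 - b$1 * u$3, b$1 * u$2 - b$2 * u$1]"

text \<open>Keeping the scalar \<open>c\<close> apart makes the parametrization of the quadric cone surjective, also over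
  the points with \<open>a = 0\<close>.\<close>

lemma quadric_cone_param:
  fixes a l :: "complex ^ 3"
  assumes "scalar_product l a = 0"
  obtains b u c where "a = c *s b" "l = ccross b u"
proof -
  have ex: "\<exists>u. l = ccross b u" if lb: "scalar_product l b = 0" and b: "b \<noteq> 0" for b
  proof -
    have eq: "l$1 * b$1 + l$2 * b$2 + l$3 * b$3 = 0" using lb by (simp add: scalar_product_3)
    have "b$1 \<noteq> 0 \<or> b$2 \<noteq> 0 \<or> b$3 \<noteq> 0"
      using b by (auto simp: vec_eq_iff forall_3)
    then consider "b$1 \<noteq> 0" | "b$2 \<noteq> 0" | "b$3 \<noteq> 0" by blast
    then show ?thesis
    proof cases
      case 1
      show ?thesis using 1 eq
        by (intro exI[of _ "vector [0, l$3 / b$1, - l$2 / b$1]"])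
          (simp add: vec_eq_iff forall_3 ccross_def field_simps eq_neg_iff_add_eq_0)
    next
      case 2
      show ?thesis using 2 eq
        by (intro exI[of _ "vector [- l$3 / b$2, 0, l$1 / b$2]"])
          (simp add: vec_eq_iff forall_3 ccross_def field_simps eq_neg_iff_add_eq_0)
    next
      case 3
      show ?thesis using 3 eq
        by (intro exI[of _ "vector [l$2 / b$3, - l$1 / b$3, 0]"])
          (simp add: vec_eq_iff forall_3 ccross_def field_simps eq_neg_iff_add_eq_0)
    qed
  qed
  show ?thesis
  proof (cases "a = 0")
    case False
    then obtain u where "l = ccross a u" using ex assms by blast
    then show ?thesis using that[of 1 a u] by simp
  next
    case True
    \<comment> \<open>For \<open>a = 0\<close> one takes \<open>c = 0\<close> and any nonzero
      \<open>b\<close> that the row annihilates.\<close>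
    define b :: "complex ^ 3" where "b = (if l$1 = 0 \<and> l$2 = 0 then vector [1, 0, 0] else vector [- l$2, l$1, 0])"
    have "scalar_product l b = 0" "b \<noteq> 0"
      by (auto simp: b_def scalar_product_3 vec_eq_iff forall_3)
    then obtain u where "l = ccross b u" using ex by blast
    then show ?thesis using that[of 0 b u] True by simp
  qed
qed

text \<open>\<open>M4\<close> is the image of an affine space under the cone parametrization. A
  segment in the parameters joins \<open>z\<close> to a point with \<open>d 4 \<noteq> 0\<close>;
  along it \<open>f\<close> and \<open>d 4\<close> are polynomials with product zero, and the second
  one is not zero.\<close>

lemma d4_nonzero_dense:
  assumes f: "f \<in> coord_ring" and zero: "\<And>z. z \<in> M4 \<Longrightarrow> d 4 z \<noteq> 0 \<Longrightarrow> f z = 0"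
  shows "f = 0"
proof
  fix z
  show "f z = 0 z"
  proof (cases "z \<in> M4")
    case False
    have "coord_ring \<subseteq> {f. f z = 0}" unfolding coord_ring_def
      by (rule cfun.span_minimal) (use False in \<open>auto simp: on_M4_def cscale_def intro!: cfun.subspaceI\<close>)
    then show ?thesis using f by auto
  next
    case True
    then have "\<forall>i. \<exists>b u c. colA z i = c *s b \<and> rowL z i = ccross b u"
      unfolding M4_def by (metis (mono_tags, lifting) mem_Collect_eq quadric_cone_param)
    then obtain b u c where bu: "\<And>i. colA z i = c i *s b i" "\<And>i. rowL z i = ccross (b i) (u i)"
      by metis
    \<comment> \<open>The cross products of these parameters are the standard basis vectors e_1,
      e_2, e_3 for the first three rows, so \<open>d 4\<close> is -1 at the end of the
      segment.\<close>
    define b' :: "4 \<Rightarrow> complex ^ 3" where "b' i = (if i = 1 then vector [0, 1, 0] else if i = 2 then vector [0, 0, 1] else vector [1, 0, 0])" for i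
    define u' :: "4 \<Rightarrow> complex ^ 3" where "u' i = (if i = 1 then vector [0, 0, 1] else if i = 2 then vector [1, 0, 0] else vector [0, 1, 0])" for i
    define pb where "pb i a = [:b i $ a, b' i $ a - b i $ a:]" for i a
    define pu where "pu i a = [:u i $ a, u' i $ a - u i $ a:]" for i a
    define pc where "pc i a = smult (c i) (pb i a)" for i a
    define pr where "pr i a = (if a = (1::3) then pb i 2 * pu i 3 - pb i 3 * pu i 2
      else if a = 2 then pb i 3 * pu i 1 - pb i 1 * pu i 3 else pb i 1 * pu i 2 - pb i 2 * pu i 1)" for i a
    let ?z = "\<lambda>\<epsilon>. ((\<chi> i. \<chi> a. poly (pc i a) \<epsilon>), (\<chi> i. \<chi> a. poly (pr i a) \<epsilon>)) :: config"
    have M4: "?z \<epsilon> \<in> M4" for \<epsilon>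
      by (simp add: M4_def scalar_product_3 pr_def pc_def algebra_simps)
    have z0: "?z 0 = z"
      by (simp add: prod_eq_iff vec_eq_iff forall_3 bu pc_def pr_def pb_def pu_def ccross_def)
    have d1: "d 4 (?z 1) \<noteq> 0"
      unfolding d_simps D_on_M4[OF M4] det_3
      by (simp add: pr_def pb_def pu_def b'_def u'_def algebra_simps)
    obtain p where p: "\<And>\<epsilon>. f (?z \<epsilon>) = poly p \<epsilon>"
      using coord_ring_along_path[OF f M4] by blast
    obtain q where q: "\<And>\<epsilon>. d 4 (?z \<epsilon>) = poly q \<epsilon>"
      using coord_ring_along_path[OF _ M4] d_in_coord_ring_deg coord_ring_deg_subset by blast
    have "poly (p * q) \<epsilon> = 0" for \<epsilon> using zero[OF M4, of \<epsilon>] p q by auto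
    then have "p * q = 0" using poly_all_0_iff_0 by blast
    moreover have "q \<noteq> 0" using d1 unfolding q by auto
    ultimately have "p = 0" by simp
    then show ?thesis using p[of 0] unfolding z0 by simp
  qed
qed

section \<open>The slice and the evaluation of monomials there\<close>

definition emb :: "3 \<Rightarrow> 4"
  where "emb a = (if a = 1 then 1 else if a = 2 then 2 else 3)"

text \<open>The intended \<open>G\<close> has the rows l_a / r for a = 1, 2, 3, so it carries these
  rows to r times the standard basis; determinant 1 forces \<open>r ^ 3 = - d 4 z\<close>. The
  entries of the last row come from the linear relation between the four rows.\<close>

definition to_slice :: "config \<Rightarrow> complex ^ 3 ^ 3 \<Rightarrow> complex \<Rightarrow> bool"
  where "to_slice z G r \<longleftrightarrow> z \<in> M4 \<and> d 4 z \<noteq> 0 \<and> G \<in> SL3 \<and> r ^ 3 = - d 4 z \<and>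
    (\<forall>j a. colA (sl_act G z) j $ a = C (emb a) j z / r) \<and>
    (\<forall>i a. rowL (sl_act G z) i $ a
      = r * (if i = 4 then - d (emb a) z / d 4 z else if i = emb a then 1 else 0))"

lemma slice_point:
  assumes z: "z \<in> M4" and nz: "d 4 z \<noteq> 0"
  obtains G r where "to_slice z G r"
proof -
  obtain r where r: "r ^ 3 = - d 4 z"
    using that nz by (metis exists_complex_root zero_neq_numeral)
  have r0: "r \<noteq> 0" using r nz by auto
  define G :: "complex ^ 3 ^ 3" where "G = (\<chi> a b. rowL z (emb a) $ b / r)"
  have "det G = D 1 2 3 z / r ^ 3"
    unfolding det_3 D_on_M4[OF z] by (simp add: G_def emb_def power3_eq_cube add_divide_distrib diff_divide_distrib)
  also have "\<dots> = 1" using r nz by (simp add: d_simps)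
  finally have G: "G \<in> SL3" by (simp add: SL3_def)
  have col: "colA (sl_act G z) j $ a = C (emb a) j z / r" for j a
    by (simp add: sl_act_def matrix_vector_mult_def G_def C_on_M4[OF z] scalar_product_3 sum_3 add_divide_distrib)
  \<comment> \<open>The expected rows; they are compared after multiplication by \<open>G\<close>,
    which spares the computation of the inverse.\<close>
  define R :: "4 \<Rightarrow> complex ^ 3" where
    "R i = (\<chi> a. r * (if i = 4 then - d (emb a) z / d 4 z else if i = emb a then 1 else 0))" for i
  have "R i v* G = rowL z i" for i
  proof -
    have "(R i v* G) $ b = rowL z i $ b" for b
    proof -
      have "d 1 z * rowL z 1 $ b + d 2 z * rowL z 2 $ b + d 3 z * rowL z 3 $ b = - d 4 z * rowL z 4 $ b"
        using d_row_relation[OF z, of b] by (simp add: sum_4 eq_neg_iff_add_eq_0)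
      moreover have "(R 4 v* G) $ b = - (d 1 z * rowL z 1 $ b + d 2 z * rowL z 2 $ b + d 3 z * rowL z 3 $ b) / d 4 z"
        using r0 nz by (simp add: vector_matrix_mult_def R_def G_def sum_3 emb_def field_simps)
      ultimately have "(R 4 v* G) $ b = rowL z 4 $ b"
        using nz by simp
      moreover have "(R i v* G) $ b = rowL z i $ b" if "i \<noteq> 4"
        using r0 that exhaust_4[of i] by (auto simp: vector_matrix_mult_def R_def G_def sum_3 emb_def)
      ultimately show ?thesis by (cases "i = 4") simp_all
    qed
    then show ?thesis by (simp add: vec_eq_iff)
  qed
  then have "rowL z i v* matrix_inv G = R i v* (G ** matrix_inv G)" for i
    by (metis vector_matrix_mul_assoc)
  then have "rowL (sl_act G z) i = R i" for i
    by (simp add: sl_act_def SL3_matrix_inv[OF G] vector_matrix_mul_rid)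
  then have "to_slice z G r" using z nz G r col by (simp add: to_slice_def R_def)
  then show ?thesis by (rule that)
qed

definition slice_degrees :: "(4 \<Rightarrow> nat) \<Rightarrow> (4 \<Rightarrow> nat) \<Rightarrow> ((4 \<Rightarrow> 3 \<Rightarrow> nat) \<times> (4 \<Rightarrow> 3 \<Rightarrow> nat)) set"
  where "slice_degrees k b = {(\<alpha>, \<beta>). (\<lambda>j. \<Sum>a\<in>UNIV. \<alpha> j a) = k \<and> (\<lambda>i. \<Sum>a\<in>UNIV. \<beta> i a) = b}"

definition monom_of :: "(4 \<Rightarrow> 3 \<Rightarrow> nat) \<times> (4 \<Rightarrow> 3 \<Rightarrow> nat) \<Rightarrow> config \<Rightarrow> complex"
  where "monom_of = (\<lambda>(\<alpha>, \<beta>). on_M4 (monom_fun \<alpha> \<beta>))"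

text \<open>The value of a monomial at the slice point: the rows \<open>\<ell>\<^sub>1, \<ell>\<^sub>2, \<ell>\<^sub>3\<close> contribute \<open>0\<close> or \<open>1\<close> there,
  and the row \<open>\<ell>\<^sub>4\<close> contributes the coordinates \<open>- d\<^sub>a / d\<^sub>4\<close>.\<close>

lemma monom_at_slice:
  fixes \<alpha> \<beta> :: "4 \<Rightarrow> 3 \<Rightarrow> nat" and k :: "4 \<Rightarrow> nat" and e :: nat
  assumes deg: "(\<alpha>, \<beta>) \<in> slice_degrees k (\<lambda>i. k i + 3 * e)"
  obtains \<gamma> m E where "m 4 > 0" "ind E = k"
    "\<And>z G r. to_slice z G r \<Longrightarrow>
      d 4 z ^ (k 4 + 3 * e + 1) * on_M4 (monom_fun \<alpha> \<beta>) (sl_act G z) = \<gamma> * dC_monom m E z"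
proof -
  have \<alpha>: "(\<Sum>a\<in>UNIV. \<alpha> j a) = k j" and \<beta>: "(\<Sum>a\<in>UNIV. \<beta> i a) = k i + 3 * e" for i j
    using deg by (auto simp: slice_degrees_def fun_eq_iff)
  \<comment> \<open>Coordinate \<open>a\<close> of column \<open>j\<close> is
    \<open>C (emb a) j z / r\<close> at the slice, so the column exponents become edges with tails
    1, 2, 3.\<close>
  define E :: digraph where "E = (\<lambda>i j. if i = 1 then \<alpha> j 1 else if i = 2 then \<alpha> j 2 else if i = 3 then \<alpha> j 3 else 0)"
  \<comment> \<open>The powers of r leave \<open>d 4 ^ (4 * e)\<close>. The additional factor keeps
    \<open>m 4\<close> positive, so that the monomial vanishes wherever \<open>d 4\<close>
    does.\<close>
  define m :: "4 \<Rightarrow> nat" where "m = (\<lambda>i. if i = 1 then \<beta> 4 1 else if i = 2 then \<beta> 4 2 else if i = 3 then \<beta> 4 3 else 4 * e + 1)"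
  define \<delta> :: "4 \<Rightarrow> 3 \<Rightarrow> complex" where "\<delta> i a = (if i = emb a then 1 else 0)" for i a
  define \<gamma>0 where "\<gamma>0 = (\<Prod>a\<in>UNIV. \<delta> 1 a ^ \<beta> 1 a) * (\<Prod>a\<in>UNIV. \<delta> 2 a ^ \<beta> 2 a) * (\<Prod>a\<in>UNIV. \<delta> 3 a ^ \<beta> 3 a)"
  define \<gamma> where "\<gamma> = (-1) ^ (k 4 + 3 * e) * \<gamma>0"
  show ?thesis
  proof (rule that[of m E \<gamma>])
    show "m 4 > 0" by (simp add: m_def)
    show "ind E = k"
    proof
      fix j show "ind E j = k j" using \<alpha>[of j] by (simp add: ind_def sum_4 sum_3 E_def)
    qed
  next
    fix z G r
    assume "to_slice z G r"
    then have z: "z \<in> M4" and nz: "d 4 z \<noteq> 0" and G: "G \<in> SL3" and r: "r ^ 3 = - d 4 z"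
      and col: "\<And>j a. colA (sl_act G z) j $ a = C (emb a) j z / r"
      and row: "\<And>i a. rowL (sl_act G z) i $ a
        = r * (if i = 4 then - d (emb a) z / d 4 z else if i = emb a then 1 else 0)"
      unfolding to_slice_def by blast+
    define N where "N = k 4 + 3 * e"
    have r0: "r \<noteq> 0" using r nz by auto
    have cols: "(\<Prod>j\<in>UNIV. \<Prod>a\<in>UNIV. (colA (sl_act G z) j $ a) ^ \<alpha> j a)
       = (\<Prod>i\<in>UNIV. \<Prod>j\<in>UNIV. C i j z ^ E i j) / r ^ (\<Sum>j\<in>UNIV. k j)"
    proof -
      have "(\<Prod>j\<in>UNIV. \<Prod>a\<in>UNIV. (colA (sl_act G z) j $ a) ^ \<alpha> j a)
        = (\<Prod>j\<in>UNIV. \<Prod>a\<in>UNIV. C (emb a) j z ^ \<alpha> j a) / (\<Prod>j\<in>UNIV. r ^ k j)"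
        unfolding col \<alpha>[symmetric] by (simp add: power_divide prod_dividef power_sum)
      also have "(\<Prod>j\<in>UNIV. \<Prod>a\<in>UNIV. C (emb a) j z ^ \<alpha> j a) = (\<Prod>j\<in>UNIV. \<Prod>i\<in>UNIV. C i j z ^ E i j)"
        by (rule prod.cong[OF refl]) (simp add: prod_UNIV_3 prod_UNIV_4 emb_def E_def)
      also have "\<dots> = (\<Prod>i\<in>UNIV. \<Prod>j\<in>UNIV. C i j z ^ E i j)" by (rule prod.swap)
      finally show ?thesis by (simp add: power_sum)
    qed
    \<comment> \<open>The columns contribute r with exponent - sum k and the rows r with exponent
      sum k + 12 e, so r survives only through \<open>r ^ 3 = - d 4 z\<close>; the sign is lost
      because 4 e is even.\<close>
    have rows: "(\<Prod>i\<in>UNIV. \<Prod>a\<in>UNIV. (rowL (sl_act G z) i $ a) ^ \<beta> i a)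
       = r ^ (\<Sum>j\<in>UNIV. k j) * (r ^ 3) ^ (4 * e) * \<gamma>0 * (\<Prod>a\<in>UNIV. (- d (emb a) z / d 4 z) ^ \<beta> 4 a)"
    proof -
      have *: "(\<Prod>a\<in>UNIV. (r * x a) ^ \<beta> i a) = r ^ (k i + 3 * e) * (\<Prod>a\<in>UNIV. x a ^ \<beta> i a)" for i x
        unfolding \<beta>[symmetric] power_mult_distrib prod.distrib by (simp add: power_sum)
      have "(\<Prod>i\<in>UNIV. \<Prod>a\<in>UNIV. (rowL (sl_act G z) i $ a) ^ \<beta> i a)
        = (\<Prod>i\<in>UNIV. r ^ (k i + 3 * e)) * (\<gamma>0 * (\<Prod>a\<in>UNIV. (- d (emb a) z / d 4 z) ^ \<beta> 4 a))"
        unfolding row * prod.distrib by (simp add: prod_UNIV_4 \<gamma>0_def \<delta>_def)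
      also have "(\<Prod>i\<in>UNIV. r ^ (k i + 3 * e)) = r ^ (\<Sum>j\<in>UNIV. k j) * (r ^ 3) ^ (4 * e)"
        by (simp add: power_add power_sum prod.distrib flip: power_mult)
      finally show ?thesis by simp
    qed
    have last: "(\<Prod>a\<in>UNIV. (- d (emb a) z / d 4 z) ^ \<beta> 4 a)
      = (-1) ^ N * (d 1 z ^ \<beta> 4 1 * d 2 z ^ \<beta> 4 2 * d 3 z ^ \<beta> 4 3) / d 4 z ^ N"
    proof -
      have "(\<Prod>a\<in>UNIV. (- d (emb a) z / d 4 z) ^ \<beta> 4 a) = (\<Prod>a\<in>UNIV. (-1 / d 4 z) ^ \<beta> 4 a * d (emb a) z ^ \<beta> 4 a)"
        by (simp flip: power_mult_distrib)
      also have "\<dots> = (-1 / d 4 z) ^ N * (d 1 z ^ \<beta> 4 1 * d 2 z ^ \<beta> 4 2 * d 3 z ^ \<beta> 4 3)"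
        unfolding N_def \<beta>[symmetric] prod.distrib by (simp add: power_sum prod_UNIV_3 emb_def)
      finally show ?thesis by (simp only: power_divide times_divide_eq_left)
    qed
    have pow: "(r ^ 3) ^ (4 * e) = d 4 z ^ (4 * e)"
      unfolding r by (simp add: power_mult)
    have "on_M4 (monom_fun \<alpha> \<beta>) (sl_act G z) = (\<Prod>i\<in>UNIV. \<Prod>j\<in>UNIV. C i j z ^ E i j) * d 4 z ^ (4 * e) * \<gamma>0
       * ((-1) ^ N * (d 1 z ^ \<beta> 4 1 * d 2 z ^ \<beta> 4 2 * d 3 z ^ \<beta> 4 3) / d 4 z ^ N)"
    proof -
      have "on_M4 (monom_fun \<alpha> \<beta>) (sl_act G z) = (\<Prod>j\<in>UNIV. \<Prod>a\<in>UNIV. (colA (sl_act G z) j $ a) ^ \<alpha> j a)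
        * (\<Prod>i\<in>UNIV. \<Prod>a\<in>UNIV. (rowL (sl_act G z) i $ a) ^ \<beta> i a)"
        using z G by (simp add: on_M4_def monom_fun_def sl_act_M4)
      then show ?thesis unfolding cols rows last pow using r0 by simp
    qed
    moreover have "dC_monom m E z = (d 1 z ^ \<beta> 4 1 * d 2 z ^ \<beta> 4 2 * d 3 z ^ \<beta> 4 3) * d 4 z ^ (4 * e + 1)
       * (\<Prod>i\<in>UNIV. \<Prod>j\<in>UNIV. C i j z ^ E i j)"
    proof -
      have "(\<Prod>i\<in>UNIV. d i z ^ m i) = (d 1 z ^ \<beta> 4 1 * d 2 z ^ \<beta> 4 2 * d 3 z ^ \<beta> 4 3) * d 4 z ^ (4 * e + 1)"
        unfolding prod_UNIV_4 by (simp add: m_def)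
      then show ?thesis using z by (simp only: dC_monom_def on_M4_def if_True)
    qed
    ultimately show "d 4 z ^ (k 4 + 3 * e + 1) * on_M4 (monom_fun \<alpha> \<beta>) (sl_act G z) = \<gamma> * dC_monom m E z"
      using nz unfolding N_def[symmetric] by (simp add: \<gamma>_def N_def[symmetric])
  qed
qed

text \<open>Invariance allows \<open>H\<close> to be evaluated at the slice point. Off
  \<open>M4\<close> and where \<open>d 4 = 0\<close> both sides vanish, so the identity found where
  \<open>d 4 \<noteq> 0\<close> is an equality of functions.\<close>

lemma slice_clear_denominator:
  fixes k :: "4 \<Rightarrow> nat" and e :: nat
  assumes H: "H \<in> cfun.span (monom_of ` slice_degrees k (\<lambda>i. k i + 3 * e))"
    and inv: "\<And>G z. G \<in> SL3 \<Longrightarrow> z \<in> M4 \<Longrightarrow> H (sl_act G z) = H z"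
  defines "N \<equiv> k 4 + 3 * e + 1"
  shows "(\<lambda>z. d 4 z ^ N * H z) \<in> cfun.span ((\<lambda>(m, E). dC_monom m E) ` {(m, E). m 4 > 0 \<and> ind E = k})"
proof -
  let ?X = "(\<lambda>(m, E). dC_monom m E) ` {(m, E). m 4 > (0::nat) \<and> ind E = k}"
  let ?P = "\<lambda>f. \<exists>g\<in>cfun.span ?X. \<forall>z G r. to_slice z G r \<longrightarrow> d 4 z ^ N * f (sl_act G z) = g z"
  have "cfun.subspace {f. ?P f}"
  proof (rule cfun.subspaceI; unfold mem_Collect_eq)
    show "?P 0" by (intro bexI[of _ 0] cfun.span_zero) simp
    fix x y and a :: complex
    assume x: "?P x"
    then obtain g where g: "g \<in> cfun.span ?X" "\<forall>z G r. to_slice z G r \<longrightarrow> d 4 z ^ N * x (sl_act G z) = g z"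
      by (elim bexE)
    show "?P (cscale a x)"
      using g by (intro bexI[of _ "cscale a g"] cfun.span_scale) (auto simp: cscale_def)
    assume y: "?P y"
    then obtain h where h: "h \<in> cfun.span ?X" "\<forall>z G r. to_slice z G r \<longrightarrow> d 4 z ^ N * y (sl_act G z) = h z"
      by (elim bexE)
    show "?P (x + y)"
      using g h by (intro bexI[of _ "g + h"] cfun.span_add) (auto simp: algebra_simps)
  qed
  moreover have "monom_of ` slice_degrees k (\<lambda>i. k i + 3 * e) \<subseteq> {f. ?P f}"
  proof safe
    fix \<alpha> \<beta> assume ab: "(\<alpha>, \<beta>) \<in> slice_degrees k (\<lambda>i. k i + 3 * e)"
    obtain \<gamma> m E where g: "m 4 > 0" "ind E = k"
      "\<And>z G r. to_slice z G r \<Longrightarrow>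
      d 4 z ^ (k 4 + 3 * e + 1) * on_M4 (monom_fun \<alpha> \<beta>) (sl_act G z) = \<gamma> * dC_monom m E z"
      by (rule monom_at_slice[OF ab]) blast
    show "?P (monom_of (\<alpha>, \<beta>))"
    proof (rule bexI[of _ "cscale \<gamma> (dC_monom m E)"])
      show "cscale \<gamma> (dC_monom m E) \<in> cfun.span ?X"
        using g(1,2) by (intro cfun.span_scale cfun.span_base image_eqI[of _ _ "(m, E)"]) auto
      show "\<forall>z G r. to_slice z G r \<longrightarrow> d 4 z ^ N * monom_of (\<alpha>, \<beta>) (sl_act G z) = cscale \<gamma> (dC_monom m E) z"
        using g(3) unfolding N_def monom_of_def cscale_def case_prod_conv by blast
    qed
  qed
  ultimately have "cfun.span (monom_of ` slice_degrees k (\<lambda>i. k i + 3 * e)) \<subseteq> {f. ?P f}"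
    by (intro cfun.span_minimal)
  then have "?P H" using H by blast
  then obtain g where g: "g \<in> cfun.span ?X" "\<forall>z G r. to_slice z G r \<longrightarrow> d 4 z ^ N * H (sl_act G z) = g z"
    by (elim bexE)
  have zero: "cfun.span ?X \<subseteq> {g. g z = 0}" if "z \<notin> M4 \<or> d 4 z = 0" for z
    using that
    by (intro cfun.span_minimal)
      (auto simp: cscale_def dC_monom_def on_M4_def prod_UNIV_4[of "\<lambda>i. d i z ^ _ i"] intro!: cfun.subspaceI)
  have "d 4 z ^ N * H z = g z" for z
  proof (cases "z \<in> M4 \<and> d 4 z \<noteq> 0")
    case True
    then obtain G r where "to_slice z G r" using slice_point[of z] by blast
    then show ?thesis using g(2) inv unfolding to_slice_def by metis
  next
    case False
    then have "d 4 z = 0" by (auto simp: d_simps D_off_M4)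
    moreover have "g z = 0" using zero[of z] g(1) False by blast
    ultimately show ?thesis by (simp add: N_def)
  qed
  then have "(\<lambda>z. d 4 z ^ N * H z) = g" by auto
  then show ?thesis using g(1) by simp
qed


lemma monom_of_in_coord_ring_deg:
  assumes "x \<in> slice_degrees k b"
  shows "monom_of x \<in> coord_ring_deg (\<Sum>j\<in>UNIV. k j)"
proof -
  obtain \<alpha> \<beta> where x: "x = (\<alpha>, \<beta>)" by (cases x)
  then have "(\<Sum>j\<in>UNIV. \<Sum>a\<in>UNIV. \<alpha> j a) = (\<Sum>j\<in>UNIV. k j)"
    using assms by (auto simp: slice_degrees_def)
  then show ?thesis
    unfolding x monom_of_def coord_ring_deg_def case_prod_conv by (intro cfun.span_base) blast
qed

lemma mono_span_coord_ring_deg: "mono_span c k \<subseteq> coord_ring_deg (\<Sum>j\<in>UNIV. k j)"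
proof -
  have "mono_at c E \<in> coord_ring_deg (\<Sum>j\<in>UNIV. k j)" if "ind E = k" for E
    using dC_monom_in_coord_ring_deg[of _ E] that by (auto simp: mono_at_def edges_def)
  then show ?thesis
    unfolding mono_span_def coord_ring_deg_def[of "\<Sum>j\<in>UNIV. k j"]
    by (intro cfun.span_minimal cfun.subspace_span) (auto simp: coord_ring_deg_def)
qed

lemma d_power_in_coord_ring_deg: "on_M4 (\<lambda>z. d i z ^ n) \<in> coord_ring_deg 0"
  using on_M4_power_in_coord_ring_deg[OF d_in_coord_ring_deg, of i n] by simp

text \<open>\<open>H\<close> has row degrees \<open>k i + 3 * e\<close>, and \<open>d 4\<close>
  contains every row except the fourth, which gives the weight \<open>w\<close> of the product.
  Within this weight and these in-degrees the graph determines the exponents of the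
  \<open>d i\<close>.\<close>

lemma clear_denominator_weight:
  fixes k :: "4 \<Rightarrow> nat" and e :: nat
  assumes H: "H \<in> cfun.span (monom_of ` slice_degrees k (\<lambda>i. k i + 3 * e))"
    and inv: "\<And>G z. G \<in> SL3 \<Longrightarrow> z \<in> M4 \<Longrightarrow> H (sl_act G z) = H z"
  defines "N \<equiv> k 4 + 3 * e + 1"
  shows "(\<lambda>z. d 4 z ^ N * H z) \<in> mono_span (\<lambda>i. int (k i) - int e - (if i = 4 then int N else 0)) k"
proof -
  let ?c = "\<lambda>i. int (k i) - int e - (if i = 4 then int N else 0)"
  let ?I = "{(m, E). m 4 > (0::nat) \<and> ind E = k}"
  define wt where "wt = (\<lambda>(m :: 4 \<Rightarrow> nat, E) i. int (outd E i) + (\<Sum>j\<in>UNIV. int (m j)) - int (m i))"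
  define w where "w i = int (k i) + 3 * int e + (if i = 4 then 0 else int N)" for i :: 4
  have "(\<lambda>z. d 4 z ^ N * H z) \<in> cfun.span ((\<lambda>(m, E). dC_monom m E) ` {x \<in> ?I. wt x = w})"
  proof (rule span_weight[where act = scale_rows])
    show "(\<lambda>z. d 4 z ^ N * H z) \<in> cfun.span ((\<lambda>(m, E). dC_monom m E) ` ?I)"
      unfolding N_def by (rule slice_clear_denominator[OF H inv])
    fix s :: "4 \<Rightarrow> complex" and z assume s: "s \<in> torus"
    show "(case x of (m, E) \<Rightarrow> dC_monom m E) (scale_rows s z) = tchar (wt x) s * (case x of (m, E) \<Rightarrow> dC_monom m E) z" for x
      by (cases x) (simp add: wt_def dC_monom_scale_rows[OF s])
    let ?b = "\<lambda>i. int (k i + 3 * e)"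
    have "cfun.span (monom_of ` slice_degrees k (\<lambda>i. k i + 3 * e))
       \<subseteq> {f. f (scale_rows s z) = tchar ?b s * f z}"
    proof (rule cfun.span_minimal)
      show "cfun.subspace {f. f (scale_rows s z) = tchar ?b s * f z}"
        by (rule cfun.subspaceI) (auto simp: cscale_def algebra_simps)
      show "monom_of ` slice_degrees k (\<lambda>i. k i + 3 * e) \<subseteq> {f. f (scale_rows s z) = tchar ?b s * f z}"
      proof safe
        fix \<alpha> \<beta> assume "(\<alpha>, \<beta>) \<in> slice_degrees k (\<lambda>i. k i + 3 * e)"
        then have "(\<lambda>i. \<Sum>a\<in>UNIV. int (\<beta> i a)) = ?b"
          by (auto simp: slice_degrees_def fun_eq_iff simp flip: of_nat_sum)
        then show "monom_of (\<alpha>, \<beta>) (scale_rows s z) = tchar ?b s * monom_of (\<alpha>, \<beta>) z"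
          unfolding monom_of_def case_prod_conv monom_scale_rows[OF s] by simp
      qed
    qed
    then have 1: "H (scale_rows s z) = tchar ?b s * H z" using H by blast
    have s0: "s i \<noteq> 0" for i using s by auto
    have 2: "d 4 (scale_rows s z) = s 1 * s 2 * s 3 * d 4 z"
      using s0[of 4] by (simp add: d_scale_rows[OF s] prod_UNIV_4)
    have 3: "tchar w s = (s 1 * s 2 * s 3) ^ N * tchar ?b s"
      using s0 by (simp add: tchar_def prod_UNIV_4 w_def power_int_add power_mult_distrib)
    show "d 4 (scale_rows s z) ^ N * H (scale_rows s z) = tchar w s * (d 4 z ^ N * H z)"
      unfolding 1 2 3 by (simp add: power_mult_distrib)
  qed
  also have "\<dots> \<subseteq> mono_span ?c k"
    unfolding mono_span_def
  proof (intro cfun.span_minimal cfun.subspace_span subsetI)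
    fix x assume "x \<in> (\<lambda>(m, E). dC_monom m E) ` {x \<in> ?I. wt x = w}"
    then obtain m E where x: "x = dC_monom m E" and E: "wt (m, E) = w" "k = ind E" by auto
    define M where "M = (\<Sum>j\<in>UNIV. int (m j))"
    have w: "int (outd E i) + M - int (m i) = w i" for i
      using E(1) by (auto simp: wt_def M_def fun_eq_iff)
    have "(\<Sum>i\<in>UNIV. int (outd E i)) = (\<Sum>i\<in>UNIV. int (k i))"
      using sum_outd[of E] unfolding edges_def E(2) by (simp flip: of_nat_sum)
    \<comment> \<open>The four weight equations add up to edges + 3 M = sum k + 12 e + 3 N, and the
      number of edges is sum k.\<close>
    then have "M = 4 * int e + int N"
      using w[of 1] w[of 2] w[of 3] w[of 4] by (simp add: sum_4 w_def M_def)
    then have m: "int (m i) = int (outd E i) - ?c i" for i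
      using w[of i] by (auto simp: w_def)
    show "x \<in> cfun.span (mono_at ?c ` {E'. adm ?c E' \<and> ind E' = k})"
      unfolding x
    proof (cases "loopless E")
      case True
      have a: "mono_at ?c E = dC_monom m E"
        unfolding mono_at_def m[symmetric] by simp
      have b: "adm ?c E" unfolding adm_def using True m by (metis diff_ge_0_iff_ge of_nat_0_le_iff)
      show "dC_monom m E \<in> cfun.span (mono_at ?c ` {E'. adm ?c E' \<and> ind E' = k})"
        unfolding a[symmetric] by (intro cfun.span_base imageI CollectI conjI b E(2)[symmetric])
    next
      case False
      then show "dC_monom m E \<in> cfun.span (mono_at ?c ` {E'. adm ?c E' \<and> ind E' = k})"
        by (simp add: dC_monom_loop cfun.span_zero)
    qed
  qed
  finally show ?thesis .
qed

lemma multihomogeneous_invariant: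
  fixes k :: "4 \<Rightarrow> nat" and e :: nat
  assumes H: "H \<in> cfun.span (monom_of ` slice_degrees k (\<lambda>i. k i + 3 * e))"
    and inv: "\<And>G z. G \<in> SL3 \<Longrightarrow> z \<in> M4 \<Longrightarrow> H (sl_act G z) = H z"
  shows "H \<in> mono_span (\<lambda>i. int (k i) - int e) k"
proof -
  define N where "N = k 4 + 3 * e + 1"
  \<comment> \<open>The bound for the monomials in \<open>d 4 ^ n * H\<close>; each division raises
    it by one at 4, and \<open>c 0\<close> is the bound in the conclusion.\<close>
  define c where "c n = (\<lambda>i. int (k i) - int e - (if i = 4 then int n else 0))" for n
  have Hdeg: "H \<in> coord_ring_deg (\<Sum>j\<in>UNIV. k j)"
  proof -
    have "cfun.span (monom_of ` slice_degrees k (\<lambda>i. k i + 3 * e)) \<subseteq> coord_ring_deg (\<Sum>j\<in>UNIV. k j)"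
      by (rule cfun.span_minimal) (auto simp: coord_ring_deg_def dest: monom_of_in_coord_ring_deg)
    then show ?thesis using H by blast
  qed
  have off: "H z = 0" if "z \<notin> M4" for z
  proof -
    have "coord_ring_deg n \<subseteq> {f. f z = 0}" for n unfolding coord_ring_deg_def
      by (rule cfun.span_minimal) (use that in \<open>auto simp: on_M4_def cscale_def intro!: cfun.subspaceI\<close>)
    then show ?thesis using Hdeg by blast
  qed
  have "(\<lambda>z. d 4 z ^ (N - j) * H z) \<in> mono_span (c (N - j)) k" if "j \<le> N" for j
    using that
  proof (induction j)
    case 0
    show ?case using clear_denominator_weight[OF H inv] unfolding N_def[symmetric] c_def minus_nat.diff_0 .
  next
    case (Suc j)
    define n where "n = N - Suc j"
    have n: "N - j = Suc n" using Suc.prems by (simp add: n_def)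
    \<comment> \<open>The difference of the two sides is the \<open>d\<close>-degree
      \<open>4 * e + Suc n\<close>.\<close>
    have "(\<Sum>i\<in>UNIV. c (Suc n) i) < int (\<Sum>i\<in>UNIV. k i)"
      by (simp add: sum_4 c_def)
    moreover have "(\<lambda>z. d 4 z ^ Suc n * H z) \<in> mono_span (c (Suc n)) k"
      using Suc.IH Suc.prems n by simp
    ultimately obtain g where g: "g \<in> mono_span ((c (Suc n))(4 := c (Suc n) 4 + 1)) k"
      "(\<lambda>z. d 4 z ^ Suc n * H z) = d 4 * g"
      using divide_by_d4 by force
    have "(c (Suc n))(4 := c (Suc n) 4 + 1) = c n" by (auto simp: c_def)
    with g have g1: "g \<in> mono_span (c n) k" by simp
    let ?f = "on_M4 (\<lambda>z. d 4 z ^ n) * H"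
    \<comment> \<open>Pointwise, \<open>d 4\<close> can be cancelled only where it is nonzero;
      density extends the equality to \<open>M4\<close>.\<close>
    have "g - ?f = 0"
    proof (rule d4_nonzero_dense)
      have "g \<in> coord_ring_deg (\<Sum>j\<in>UNIV. k j)" using g1 mono_span_coord_ring_deg by blast
      moreover have "?f \<in> coord_ring_deg (\<Sum>j\<in>UNIV. k j)"
        using coord_ring_deg_mult[OF d_power_in_coord_ring_deg Hdeg] by simp
      ultimately show "g - ?f \<in> coord_ring" using coord_ring_deg_lin(2) coord_ring_deg_subset by blast
      fix z assume z: "z \<in> M4" "d 4 z \<noteq> 0"
      have "d 4 z * (d 4 z ^ n * H z) = d 4 z * g z" using fun_cong[OF g(2), of z] by simp
      then show "(g - ?f) z = 0" using z by (simp add: on_M4_def)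
    qed
    then have "g = ?f" by simp
    also have "?f = (\<lambda>z. d 4 z ^ n * H z)" using off by (auto simp: on_M4_def fun_eq_iff)
    finally show ?case using g1 by (simp add: n_def)
  qed
  from this[of N] have "H \<in> mono_span (c 0) k" by simp
  moreover have "c 0 = (\<lambda>i. int (k i) - int e)" by (auto simp: c_def)
  ultimately show ?thesis by simp
qed

text \<open>The case \<open>e = 0\<close> is that of the absolute invariants, \<open>e = 1\<close> that of the relative invariants in
  \<^const>\<open>W4\<close>.\<close>

definition rel_mono :: "nat \<Rightarrow> digraph \<Rightarrow> config \<Rightarrow> complex"
  where "rel_mono e E = mono_at (\<lambda>i. int (ind E i) - int e) E"

definition rel_adm :: "nat \<Rightarrow> digraph \<Rightarrow> bool"
  where "rel_adm e E \<longleftrightarrow> loopless E \<and> (\<forall>i. ind E i \<le> outd E i + e)"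

text \<open>The torus weight forces every row to have degree 3 e more than the column with the same
  index. Splitting by the column degrees \<open>k\<close> then leads to
  \<open>multihomogeneous_invariant\<close>.\<close>

theorem first_fundamental_theorem:
  fixes e :: nat
  assumes H: "H \<in> SL_invariants"
    and wt: "\<And>t z. t \<in> T4 \<Longrightarrow> z \<in> M4 \<Longrightarrow> H (torus_act t z) = (\<Prod>i\<in>UNIV. t $ i) powi (- 3 * int e) * H z"
  shows "H \<in> cfun.span (rel_mono e ` {E. rel_adm e E})"
proof -
  have "H \<in> coord_ring" using H by (simp add: SL_invariants_def)
  also have "coord_ring = cfun.span (monom_of ` UNIV)"
    unfolding coord_ring_def monom_of_def by (rule arg_cong[of _ _ cfun.span]) auto
  finally have Hspan: "H \<in> cfun.span (monom_of ` UNIV)" .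
  have off: "H z = 0" if "z \<notin> M4" for z
  proof -
    have "cfun.span (monom_of ` UNIV) \<subseteq> {f. f z = 0}"
      by (rule cfun.span_minimal) (use that in \<open>auto simp: monom_of_def on_M4_def cscale_def intro!: cfun.subspaceI\<close>)
    then show ?thesis using Hspan by blast
  qed
  define ka where "ka x = (\<lambda>i. \<Sum>a\<in>UNIV. fst x i a)" for x :: "(4 \<Rightarrow> 3 \<Rightarrow> nat) \<times> (4 \<Rightarrow> 3 \<Rightarrow> nat)"
  define kb where "kb x = (\<lambda>i. \<Sum>a\<in>UNIV. snd x i a)" for x :: "(4 \<Rightarrow> 3 \<Rightarrow> nat) \<times> (4 \<Rightarrow> 3 \<Rightarrow> nat)"
  define act where "act s z = scale_cols s (scale_rows (\<lambda>i. inverse (s i)) z)" for s z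
  have cols: "monom_of x (scale_cols s z) = tchar (\<lambda>i. int (ka x i)) s * monom_of x z" if "s \<in> torus" for x s z
    using monom_scale_cols[OF that, of "fst x" "snd x" z] by (simp add: monom_of_def ka_def split_beta)
  have rows: "monom_of x (scale_rows s z) = tchar (\<lambda>i. int (kb x i)) s * monom_of x z" if "s \<in> torus" for x s z
    using monom_scale_rows[OF that, of "fst x" "snd x" z] by (simp add: monom_of_def kb_def split_beta)
  have "H \<in> cfun.span (monom_of ` {x \<in> UNIV. (\<lambda>i. int (ka x i) - int (kb x i)) = (\<lambda>i. - 3 * int e)})"
  proof (rule span_weight[where act = act, OF Hspan])
    fix s :: "4 \<Rightarrow> complex" and z assume s: "s \<in> torus"
    then have s': "(\<lambda>i. inverse (s i)) \<in> torus" by auto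
    show "monom_of x (act s z) = tchar (\<lambda>i. int (ka x i) - int (kb x i)) s * monom_of x z" for x
      unfolding act_def cols[OF s] rows[OF s'] tchar_inverse
      using tchar_add[OF s, of "\<lambda>i. int (ka x i)" "\<lambda>i. - int (kb x i)"] by (simp flip: mult.assoc)
    have act: "act s z = torus_act (\<chi> i. s i) z" by (simp add: act_def torus_act_eq)
    show "H (act s z) = tchar (\<lambda>i. - 3 * int e) s * H z"
    proof (cases "z \<in> M4")
      case True
      have "tchar (\<lambda>i. - 3 * int e) s = (\<Prod>i\<in>UNIV. s i) powi (- 3 * int e)"
        by (simp add: tchar_def prod_UNIV_4 power_int_mult_distrib)
      then show ?thesis using wt[of "\<chi> i. s i" z] s True by (simp add: act T4_def)
    next
      case False
      then have "act s z \<notin> M4" using s s' by (simp add: act_def scale_cols_M4 scale_rows_M4)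
      then show ?thesis using off False by simp
    qed
  qed
  then obtain F a where F: "finite F" "F \<subseteq> {x. (\<lambda>i. int (ka x i) - int (kb x i)) = (\<lambda>i. - 3 * int e)}"
    and Hs: "H = (\<lambda>z. \<Sum>x\<in>F. a x * monom_of x z)"
    by (rule span_image_finite_sum) auto
  define Hk where "Hk k z = (\<Sum>x\<in>{x\<in>F. ka x = k}. a x * monom_of x z)" for k z
  have Hsum: "H z = (\<Sum>k\<in>ka ` F. Hk k z)" for z
    unfolding Hs Hk_def using F by (intro sum.group[symmetric]) auto
  \<comment> \<open>Scaling of columns commutes with the action of SL(3), so independence of
    characters makes each column-homogeneous part of \<open>H\<close> invariant by itself.\<close>
  have Hk_inv: "Hk k (sl_act G z) = Hk k z" if G: "G \<in> SL3" and k: "k \<in> ka ` F" for G z k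
  proof -
    define v where "v k = (\<lambda>i::4. int (k i))" for k :: "4 \<Rightarrow> nat"
    have inj: "inj_on v A" for A by (auto simp: inj_on_def v_def fun_eq_iff)
    have "\<forall>w\<in>v ` ka ` F. Hk (inv_into (ka ` F) v w) (sl_act G z) - Hk (inv_into (ka ` F) v w) z = 0"
    proof (rule tchar_independent)
      fix s :: "4 \<Rightarrow> complex" assume s: "s \<in> torus"
      have sc: "H (scale_cols s y) = (\<Sum>k\<in>ka ` F. Hk k y * tchar (v k) s)" for y
        unfolding Hsum by (rule sum.cong[OF refl])
          (auto simp: Hk_def cols[OF s] sum_distrib_right v_def intro!: sum.cong)
      have "H (scale_cols s (sl_act G z)) = H (scale_cols s z)"
      proof (cases "z \<in> M4")
        case True
        then show ?thesis using H G s
          by (simp flip: sl_act_scale_cols add: SL_invariants_def scale_cols_M4)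
      next
        case False
        then show ?thesis using G s by (simp add: off scale_cols_M4 sl_act_M4)
      qed
      then have "(\<Sum>k\<in>ka ` F. (Hk k (sl_act G z) - Hk k z) * tchar (v k) s) = 0"
        unfolding sc by (simp add: left_diff_distrib sum_subtractf)
      then show "(\<Sum>w\<in>v ` ka ` F. (Hk (inv_into (ka ` F) v w) (sl_act G z) - Hk (inv_into (ka ` F) v w) z) * tchar w s) = 0"
        unfolding sum.reindex[OF inj] comp_def by (simp add: inv_into_f_f[OF inj] cong: sum.cong)
    qed (use F in simp)
    then show ?thesis using k inv_into_f_f[OF inj k] by force
  qed
  have "Hk k \<in> cfun.span (rel_mono e ` {E. rel_adm e E})" if k: "k \<in> ka ` F" for k
  proof -
    have sub: "{x\<in>F. ka x = k} \<subseteq> slice_degrees k (\<lambda>i. k i + 3 * e)"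
    proof
      fix x assume "x \<in> {x\<in>F. ka x = k}"
      then have x: "ka x = k" "\<And>i. int (ka x i) - int (kb x i) = - 3 * int e" using F by (auto dest: fun_cong)
      have "kb x i = k i + 3 * e" for i using x(2)[of i] x(1) by simp
      then have "kb x = (\<lambda>i. k i + 3 * e)" by auto
      then show "x \<in> slice_degrees k (\<lambda>i. k i + 3 * e)" using x(1)
        by (cases x) (simp add: slice_degrees_def ka_def kb_def)
    qed
    have "Hk k \<in> cfun.span (monom_of ` slice_degrees k (\<lambda>i. k i + 3 * e))"
      unfolding Hk_def using finite_sum_in_span[OF sub] by blast
    then have "Hk k \<in> mono_span (\<lambda>i. int (k i) - int e) k"
      using Hk_inv k by (intro multihomogeneous_invariant) auto
    also have "\<dots> \<subseteq> cfun.span (rel_mono e ` {E. rel_adm e E})"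
      unfolding mono_span_def
    proof (rule cfun.span_mono, safe)
      fix E assume "adm (\<lambda>i. int (ind E i) - int e) E"
      then have "rel_adm e E" by (simp add: adm_def rel_adm_def algebra_simps flip: of_nat_add)
      then show "mono_at (\<lambda>i. int (ind E i) - int e) E \<in> rel_mono e ` {E. rel_adm e E}"
        by (auto simp: rel_mono_def)
    qed
    finally show ?thesis .
  qed
  then have "(\<Sum>k\<in>ka ` F. Hk k) \<in> cfun.span (rel_mono e ` {E. rel_adm e E})"
    by (intro cfun.span_sum)
  moreover have "H = (\<Sum>k\<in>ka ` F. Hk k)" using Hsum by (auto simp: fun_eq_iff sum_fun_apply)
  ultimately show ?thesis by simp
qed

section \<open>The spaces of invariants\<close>

text \<open>In-degrees and out-degrees have the same sum, so inequalities in one direction at all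
  vertices are equalities: absolute invariants belong to balanced graphs and contain no factor
  \<open>d i\<close>.\<close>

lemma rel_adm_0: "rel_adm 0 E \<longleftrightarrow> loopless E \<and> ind E = outd E"
proof
  assume E: "rel_adm 0 E"
  have "(\<Sum>i\<in>UNIV. outd E i - ind E i) = (\<Sum>i\<in>UNIV. outd E i) - (\<Sum>i\<in>UNIV. ind E i)"
    using E by (intro sum_subtractf_nat) (auto simp: rel_adm_def)
  then have "(\<Sum>i\<in>UNIV. outd E i - ind E i) = 0" by (simp add: sum_outd edges_def)
  then have "outd E i \<le> ind E i" for i by simp
  with E show "loopless E \<and> ind E = outd E" by (auto simp: rel_adm_def fun_eq_iff intro: antisym)
qed (simp add: rel_adm_def)

lemma rel_mono_torus_act:
  assumes E: "rel_adm e E" and t: "t \<in> T4"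
  shows "rel_mono e E (torus_act t z) = (\<Prod>i\<in>UNIV. t $ i) powi (- 3 * int e) * rel_mono e E z"
proof -
  let ?s = "\<lambda>i. t $ i"
  have s: "?s \<in> torus" and s': "(\<lambda>i. inverse (t $ i)) \<in> torus" using t by (auto simp: T4_def)
  define m where "m i = nat (int (outd E i) - (int (ind E i) - int e))" for i
  have m: "int (m i) = int (outd E i) - int (ind E i) + int e" for i
    using E by (simp add: m_def rel_adm_def algebra_simps flip: of_nat_add)
  have "(\<Sum>j\<in>UNIV. int (m j)) = int (\<Sum>j\<in>UNIV. outd E j) - int (\<Sum>j\<in>UNIV. ind E j) + 4 * int e"
    unfolding m by (simp add: sum.distrib sum_subtractf)
  then have M: "(\<Sum>j\<in>UNIV. int (m j)) = 4 * int e" by (simp add: sum_outd edges_def)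
  have "(\<lambda>i. int (ind E i) + - (int (outd E i) + (\<Sum>j\<in>UNIV. int (m j)) - int (m i))) = (\<lambda>i. - 3 * int e)"
    using M m by (intro ext) (smt (verit))
  moreover have "rel_mono e E = dC_monom m E" by (simp add: rel_mono_def mono_at_def m_def[abs_def])
  ultimately have "rel_mono e E (torus_act t z) = tchar (\<lambda>i. - 3 * int e) ?s * rel_mono e E z"
    unfolding torus_act_eq by (simp add: dC_monom_scale_cols[OF s] dC_monom_scale_rows[OF s'] tchar_inverse
        tchar_add[OF s] flip: mult.assoc del: of_nat_sum)
  then show ?thesis by (simp add: tchar_def prod_UNIV_4 power_int_mult_distrib)
qed

lemma rel_mono_deg: "rel_mono e E \<in> coord_ring_deg (edges E)"
  by (simp add: rel_mono_def mono_at_def dC_monom_in_coord_ring_deg)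

lemma rel_mono_SL_invariant: "rel_mono e E \<in> SL_invariants"
  using rel_mono_deg[of e E] coord_ring_deg_subset
  by (auto simp: SL_invariants_def rel_mono_def mono_at_def dC_monom_sl_act)

lemma cscale_apply: "cscale c f z = c * f z"
  by (simp add: cscale_def)

definition rel_inv :: "nat \<Rightarrow> (config \<Rightarrow> complex) set"
  where "rel_inv e = {H \<in> SL_invariants.
    \<forall>t\<in>T4. \<forall>z\<in>M4. H (torus_act t z) = (\<Prod>i\<in>UNIV. t $ i) powi (- 3 * int e) * H z}"

lemma W4_rel_inv: "W4 = rel_inv 1" and A4_rel_inv: "A4 = rel_inv 0"
  by (simp_all add: W4_def A4_def rel_inv_def)

lemma rel_mono_rel_inv: "rel_adm e E \<Longrightarrow> rel_mono e E \<in> rel_inv e"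
  using rel_mono_torus_act[of e E] by (simp add: rel_inv_def rel_mono_SL_invariant)

lemma subspace_rel_inv: "cfun.subspace (rel_inv e)"
  unfolding rel_inv_def SL_invariants_def coord_ring_def
  by (rule cfun.subspaceI)
    (auto simp: cscale_apply algebra_simps intro: cfun.span_zero cfun.span_add cfun.span_scale)

lemma rel_inv_eq: "rel_inv e = cfun.span (rel_mono e ` {E. rel_adm e E})"
proof
  show "rel_inv e \<subseteq> cfun.span (rel_mono e ` {E. rel_adm e E})"
    using first_fundamental_theorem[of _ e] by (auto simp: rel_inv_def)
  show "cfun.span (rel_mono e ` {E. rel_adm e E}) \<subseteq> rel_inv e"
    using rel_mono_rel_inv by (intro cfun.span_minimal subspace_rel_inv) auto
qed

lemma coord_ring_deg_scale:
  assumes "f \<in> coord_ring_deg k" and s: "s \<noteq> 0"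
  shows "f (scale_cols (\<lambda>_. s) z) = s ^ k * f z"
proof -
  have s': "(\<lambda>_. s) \<in> torus" using s by simp
  have "coord_ring_deg k \<subseteq> {f. f (scale_cols (\<lambda>_. s) z) = s ^ k * f z}"
    unfolding coord_ring_deg_def
  proof (rule cfun.span_minimal)
    show "cfun.subspace {f. f (scale_cols (\<lambda>_. s) z) = s ^ k * f z}"
      by (rule cfun.subspaceI) (auto simp: cscale_def algebra_simps)
    show "{on_M4 (monom_fun \<alpha> \<beta>) |\<alpha> \<beta>. (\<Sum>i\<in>UNIV. sum (\<alpha> i) UNIV) = k} \<subseteq> {f. f (scale_cols (\<lambda>_. s) z) = s ^ k * f z}"
      by (auto simp: monom_scale_cols[OF s'] tchar_def power_sum simp flip: of_nat_sum)
  qed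
  then show ?thesis using assms by blast
qed

text \<open>The weight components for the one-dimensional torus that scales all columns alike; its
  index type is \<open>unit\<close>.\<close>

lemma span_homogeneous:
  assumes f: "f \<in> cfun.span (rel_mono e ` S)" and deg: "f \<in> coord_ring_deg k"
  shows "f \<in> cfun.span (rel_mono e ` {E \<in> S. edges E = k})"
proof -
  have "f \<in> cfun.span (rel_mono e ` {E \<in> S. (\<lambda>_::unit. int (edges E)) = (\<lambda>_. int k)})"
  proof (rule span_weight[where act = "\<lambda>s. scale_cols (\<lambda>_. s ())", OF f])
    fix s :: "unit \<Rightarrow> complex" and z assume s: "s \<in> torus"
    have t: "tchar (\<lambda>_. int n) s = s () ^ n" for n by (simp add: tchar_def UNIV_unit)
    show "rel_mono e E (scale_cols (\<lambda>_. s ()) z) = tchar (\<lambda>_. int (edges E)) s * rel_mono e E z" for E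
      unfolding t using s by (intro coord_ring_deg_scale rel_mono_deg) simp
    show "f (scale_cols (\<lambda>_. s ()) z) = tchar (\<lambda>_. int k) s * f z"
      unfolding t using s by (intro coord_ring_deg_scale deg) simp
  qed
  then show ?thesis by (simp add: fun_eq_iff)
qed

lemma rel_inv_deg_eq: "rel_inv e \<inter> coord_ring_deg k = cfun.span (rel_mono e ` {E. rel_adm e E \<and> edges E = k})"
proof
  show "rel_inv e \<inter> coord_ring_deg k \<subseteq> cfun.span (rel_mono e ` {E. rel_adm e E \<and> edges E = k})"
    using span_homogeneous[of _ e "{E. rel_adm e E}" k] by (auto simp: rel_inv_eq)
  show "cfun.span (rel_mono e ` {E. rel_adm e E \<and> edges E = k}) \<subseteq> rel_inv e \<inter> coord_ring_deg k"
    using rel_mono_rel_inv rel_mono_deg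
    by (intro cfun.span_minimal cfun.subspace_inter subspace_rel_inv subspace_coord_ring_deg) auto
qed

lemma W4_deg_eq: "W4_deg k = cfun.span (rel_mono 1 ` {E. rel_adm 1 E \<and> edges E = k})"
  and A4_deg_eq: "A4_deg k = cfun.span (rel_mono 0 ` {E. rel_adm 0 E \<and> edges E = k})"
  by (simp_all only: W4_deg_def A4_deg_def W4_rel_inv A4_rel_inv rel_inv_deg_eq)

lemma rel_mono_W4: "rel_adm 1 E \<Longrightarrow> rel_mono 1 E \<in> W4_deg (edges E)"
  and rel_mono_A4: "rel_adm 0 E \<Longrightarrow> rel_mono 0 E \<in> A4_deg (edges E)"
  by (simp_all add: W4_deg_def A4_deg_def W4_rel_inv A4_rel_inv rel_mono_rel_inv rel_mono_deg del: One_nat_def)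

lemma A4_plus_eq: "A4_plus = cfun.span (rel_mono 0 ` {E. rel_adm 0 E \<and> edges E > 0})"
proof
  show "A4_plus \<subseteq> cfun.span (rel_mono 0 ` {E. rel_adm 0 E \<and> edges E > 0})"
    unfolding A4_plus_def
  proof (intro cfun.span_minimal cfun.subspace_span UN_least)
    fix k :: nat assume "k \<in> {0<..}"
    then show "A4_deg k \<subseteq> cfun.span (rel_mono 0 ` {E. rel_adm 0 E \<and> edges E > 0})"
      unfolding A4_deg_eq by (intro cfun.span_mono) auto
  qed
  show "cfun.span (rel_mono 0 ` {E. rel_adm 0 E \<and> edges E > 0}) \<subseteq> A4_plus"
    unfolding A4_plus_def using rel_mono_A4 by (intro cfun.span_mono) fastforce
qed

lemma rel_mono_mult:
  assumes "rel_adm 0 E" "rel_adm e F"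
  shows "rel_mono 0 E * rel_mono e F = rel_mono e (E + F)"
proof -
  have "(\<lambda>i. nat (int (outd E i) - (int (ind E i) - int 0))) + (\<lambda>i. nat (int (outd F i) - (int (ind F i) - int e)))
    = (\<lambda>i. nat (int (outd (E + F) i) - (int (ind (E + F) i) - int e)))"
    using assms by (auto simp: fun_eq_iff rel_adm_0 outd_add ind_add)
  then show ?thesis by (simp add: rel_mono_def mono_at_def dC_monom_mult)
qed

lemma rel_inv_mult:
  assumes "a \<in> rel_inv 0" "w \<in> rel_inv e"
  shows "a * w \<in> rel_inv e"
proof -
  note sub = subspace_mult_preimage[OF subspace_rel_inv[of e]]
  have "rel_mono 0 E * rel_mono e F \<in> rel_inv e" if "rel_adm 0 E" "rel_adm e F" for E F
  proof -
    have "rel_adm e (E + F)" using that by (simp add: rel_adm_0 rel_adm_def[of e] loopless_add ind_add outd_add)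
    then show ?thesis using that rel_mono_rel_inv by (simp add: rel_mono_mult)
  qed
  then have "rel_inv e \<subseteq> {b. rel_mono 0 E * b \<in> rel_inv e}" if "rel_adm 0 E" for E
    using that by (subst rel_inv_eq) (intro cfun.span_minimal sub, auto)
  then have "rel_inv 0 \<subseteq> {a. a * w \<in> rel_inv e}"
    using assms(2) by (subst rel_inv_eq) (intro cfun.span_minimal sub, auto)
  then show ?thesis using assms(1) by blast
qed

text \<open>A nonempty balanced graph is a union of directed cycles, so for an admissible
  \<open>E\<close> this says that \<open>E\<close> contains a directed cycle.\<close>

definition decomposable :: "digraph \<Rightarrow> bool"
  where "decomposable E \<longleftrightarrow> (\<exists>F G. E = F + G \<and> rel_adm 0 F \<and> edges F > 0 \<and> rel_adm 1 G)"

lemma decomposableI: "rel_adm 0 F \<Longrightarrow> edges F > 0 \<Longrightarrow> rel_adm 1 G \<Longrightarrow> decomposable (F + G)"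
  by (auto simp: decomposable_def)

lemma decomposable_adm: "decomposable E \<Longrightarrow> rel_adm 1 E"
  by (auto simp: decomposable_def rel_adm_0 rel_adm_def[of "Suc 0"] loopless_add ind_add outd_add)

lemma A4_plus_W4_eq: "A4_plus_W4 = cfun.span (rel_mono 1 ` {E. decomposable E})"
proof
  let ?V = "cfun.span (rel_mono 1 ` {E. decomposable E})"
  note sub = subspace_mult_preimage[OF cfun.subspace_span[of "rel_mono 1 ` {E. decomposable E}"]]
  have "a * rel_mono 1 G \<in> ?V" if "a \<in> A4_plus" "rel_adm 1 G" for a G
  proof -
    have "A4_plus \<subseteq> {a. a * rel_mono 1 G \<in> ?V}"
      unfolding A4_plus_eq using that(2)
      by (intro cfun.span_minimal sub) (auto simp: rel_mono_mult simp del: One_nat_def intro!: cfun.span_base imageI decomposableI)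
    then show ?thesis using that by blast
  qed
  then have "W4 \<subseteq> {w. a * w \<in> ?V}" if "a \<in> A4_plus" for a
    unfolding W4_rel_inv rel_inv_eq using that by (intro cfun.span_minimal sub) auto
  then show "A4_plus_W4 \<subseteq> ?V"
    unfolding A4_plus_W4_def by (intro cfun.span_minimal cfun.subspace_span) auto
  show "?V \<subseteq> A4_plus_W4"
    unfolding A4_plus_W4_def
  proof (rule cfun.span_mono, safe)
    fix E assume "decomposable E"
    then obtain F G where FG: "E = F + G" "rel_adm 0 F" "edges F > 0" "rel_adm 1 G" by (auto simp: decomposable_def)
    then have "rel_mono 0 F \<in> A4_plus" "rel_mono 1 G \<in> W4"
      by (auto simp: A4_plus_eq W4_rel_inv rel_inv_eq intro!: cfun.span_base simp del: One_nat_def)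
    moreover have "rel_mono 1 E = rel_mono 0 F * rel_mono 1 G" using FG by (simp add: rel_mono_mult)
    ultimately show "\<exists>a w. rel_mono 1 E = a * w \<and> a \<in> A4_plus \<and> w \<in> W4" by blast
  qed
qed

section \<open>Upper bound\<close>

declare One_nat_def [simp del]

section \<open>Labelled vertices, exchange of edges and directed cycles\<close>

lemma UNIV_labelling: "distinct [p, q, r, s :: 4] \<Longrightarrow> UNIV = {p, q, r, s}"
  by (rule sym, rule card_subset_eq) auto

lemma sum_labelling:
  fixes p q r s :: 4
  assumes "distinct [p, q, r, s]"
  shows "sum f UNIV = f p + f q + f r + f s"
  using assms unfolding UNIV_labelling[OF assms] by (simp add: add.assoc)

lemma digraph_eq_labelling:
  fixes E F :: digraph
  assumes "distinct [p, q, r, s]" "\<And>i j. i \<in> {p, q, r, s} \<Longrightarrow> j \<in> {p, q, r, s} \<Longrightarrow> E i j = F i j"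
  shows "E = F"
  using assms(2) UNIV_labelling[OF assms(1)] by (metis UNIV_I ext)

definition move :: "digraph \<Rightarrow> 4 \<Rightarrow> 4 \<Rightarrow> 4 \<Rightarrow> digraph"
  where "move E i j x = E - edge i j + edge x j"

lemma digraph_split: "(\<And>i j. F i j \<le> E i j) \<Longrightarrow> E = F + (E - F)" for E F :: digraph
  by (auto simp: fun_eq_iff)

lemma remove_arc:
  assumes "0 < E i j"
  shows "E = (E - edge i j) + edge i j"
  using assms by (auto simp: fun_eq_iff edge_def)

lemma ind_move: "0 < E i j \<Longrightarrow> ind (move E i j x) = ind E"
  by (subst (2) remove_arc, assumption) (simp add: move_def fun_eq_iff ind_add ind_arc)

lemma move_ge: "(a, b) \<noteq> (i, j) \<Longrightarrow> E a b \<le> move E i j x a b"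
  by (auto simp: move_def edge_def)

lemma move_new: "x \<noteq> i \<Longrightarrow> 0 < move E i j x x j"
  by (auto simp: move_def edge_def)

text \<open>The exponent of \<open>d i\<close> is \<open>outd E i + 1 - ind E i\<close>, so
  \<open>ind E i \<le> outd E i\<close> says that a factor \<open>d i\<close> is present and can be
  given up together with the edge.\<close>

lemma rel_adm_move:
  assumes "rel_adm 1 E" "0 < E i j" "ind E i \<le> outd E i" "x \<noteq> j"
  shows "rel_adm 1 (move E i j x)"
proof -
  note r = remove_arc[of E i j, OF assms(2)]
  have o: "outd E a = outd (E - edge i j) a + (if a = i then 1 else 0)" for a
    by (subst r) (simp add: outd_add outd_arc)
  have b: "ind E a \<le> outd E a + 1" for a using assms(1) by (simp add: rel_adm_def)
  have "ind E a \<le> outd (E - edge i j) a + 1" for a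
    using o[of a] b[of a] assms(3) by (cases "a = i") auto
  then have "ind E a \<le> outd (move E i j x) a + 1" for a
    by (simp add: move_def outd_add outd_arc le_SucI trans_le_add1)
  then show ?thesis
    using assms by (auto simp: rel_adm_def ind_move) (auto simp: loopless_def move_def edge_def)
qed

text \<open>The three graphs have the same in-degrees, hence the same bound \<open>c\<close>, which
  makes this an instance of \<open>mono_at_relation\<close>.\<close>

lemma rel_mono_relation:
  assumes d: "distinct [j, x, y, w]" and E: "loopless E" "\<And>i. ind (E + edge x j) i \<le> outd E i + 1"
  shows "rel_mono 1 (E + edge x j) + rel_mono 1 (E + edge y j) + rel_mono 1 (E + edge w j) = 0"
proof -
  define c where "c i = int (ind (E + edge x j) i) - 1" for i
  have "c i \<le> int (outd E i)" for i using E(2)[of i] unfolding c_def by linarith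
  then have adm: "adm c E" using E(1) by (simp add: adm_def)
  have "UNIV - {j} = {x, y, w}" using UNIV_labelling[OF d] d by auto
  then have "mono_at c (E + edge x j) + mono_at c (E + edge y j) + mono_at c (E + edge w j) = 0"
    using mono_at_relation[OF adm, of j] d by (simp add: add.assoc)
  moreover have "mono_at c (E + edge i j) = rel_mono 1 (E + edge i j)" for i
    by (simp add: rel_mono_def c_def[abs_def] ind_add ind_arc)
  ultimately show ?thesis by simp
qed

lemma rel_mono_move:
  assumes d: "distinct [i, j, x, y]" and E: "rel_adm 1 E" "0 < E i j" "ind E i \<le> outd E i"
  shows "rel_mono 1 E = - (rel_mono 1 (move E i j x) + rel_mono 1 (move E i j y))"
proof -
  note r = remove_arc[of E i j, OF E(2)]
  have "ind E a \<le> outd (E - edge i j) a + 1" for a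
  proof -
    have "outd E a = outd (E - edge i j) a + (if a = i then 1 else 0)"
      by (subst r) (simp add: outd_add outd_arc)
    moreover have "ind E a \<le> outd E a + 1" using E(1) by (simp add: rel_adm_def)
    ultimately show ?thesis using E(3) by (cases "a = i") auto
  qed
  moreover have "loopless (E - edge i j)" using E(1) by (simp add: rel_adm_def loopless_def)
  ultimately have "rel_mono 1 (E - edge i j + edge i j) + rel_mono 1 (E - edge i j + edge x j) + rel_mono 1 (E - edge i j + edge y j) = 0"
    using d r by (intro rel_mono_relation) auto
  then show ?thesis
    unfolding r[symmetric] move_def by (simp add: eq_neg_iff_add_eq_0 add.assoc del: minus_add_distrib)
qed

text \<open>Removing a balanced part lowers in-degree and out-degree of each vertex equally, so the
  rest stays admissible.\<close>

lemma decomposable_cycle: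
  assumes "rel_adm 1 E" "rel_adm 0 F" "0 < edges F" "\<And>i j. F i j \<le> E i j"
  shows "decomposable E"
proof -
  note s = digraph_split[of F E, OF assms(4)]
  have "loopless (E - F)" using assms(1) by (simp add: rel_adm_def loopless_def)
  moreover have "ind E i = ind F i + ind (E - F) i" "outd E i = outd F i + outd (E - F) i" for i
    by (subst s, simp add: ind_add outd_add)+
  ultimately have "rel_adm 1 (E - F)" using assms(1,2) by (auto simp: rel_adm_def[of 1] rel_adm_0)
  then show ?thesis using decomposableI[OF assms(2,3)] s by metis
qed

lemma cycle2:
  assumes "rel_adm 1 E" "0 < E p q" "0 < E q p"
  shows "decomposable E"
proof (rule decomposable_cycle[OF assms(1), of "edge p q + edge q p"])
  have "p \<noteq> q" using assms by (auto simp: rel_adm_def loopless_def)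
  then show "rel_adm 0 (edge p q + edge q p)"
    by (auto simp: rel_adm_0 loopless_add loopless_arc fun_eq_iff ind_add outd_add ind_arc outd_arc)
  show "(edge p q + edge q p) i j \<le> E i j" for i j
    using assms \<open>p \<noteq> q\<close> by (auto simp: edge_def)
qed (simp add: edges_add edges_arc)

lemma cycle3:
  assumes "rel_adm 1 E" "distinct [p, q, r]" "0 < E p q" "0 < E q r" "0 < E r p"
  shows "decomposable E"
proof (rule decomposable_cycle[OF assms(1), of "edge p q + edge q r + edge r p"])
  show "rel_adm 0 (edge p q + edge q r + edge r p)"
    using assms(2) by (auto simp: rel_adm_0 loopless_add loopless_arc fun_eq_iff ind_add outd_add ind_arc outd_arc)
  show "(edge p q + edge q r + edge r p) i j \<le> E i j" for i j
    using assms by (auto simp: edge_def)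
qed (simp add: edges_add edges_arc)

lemma cycle4:
  assumes "rel_adm 1 E" "distinct [p, q, r, s]" "0 < E p q" "0 < E q r" "0 < E r s" "0 < E s p"
  shows "decomposable E"
proof (rule decomposable_cycle[OF assms(1), of "edge p q + edge q r + edge r s + edge s p"])
  show "rel_adm 0 (edge p q + edge q r + edge r s + edge s p)"
    using assms(2) by (auto simp: rel_adm_0 loopless_add loopless_arc fun_eq_iff ind_add outd_add ind_arc outd_arc)
  show "(edge p q + edge q r + edge r s + edge s p) i j \<le> E i j" for i j
    using assms by (auto simp: edge_def)
qed (simp add: edges_add edges_arc)

text \<open>If every vertex had an incoming edge, walking backwards along chosen edges would close a
  directed cycle of length 2, 3 or 4.\<close>

lemma acyclic_source:
  assumes E: "rel_adm 1 E" "\<not> decomposable E"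
  shows "\<exists>s. ind E s = 0"
proof (rule ccontr)
  assume "\<not> (\<exists>s. ind E s = 0)"
  then have "\<exists>i. 0 < E i s" for s by (auto simp: ind_def)
  then obtain f where f: "0 < E (f s) s" for s by metis
  have ne: "f s \<noteq> s" for s using f[of s] E(1) by (metis less_irrefl loopless_def rel_adm_def)
  have 2: "f (f s) \<noteq> s" for s
    using cycle2[OF E(1), of "f s" s] f[of s] f[of "f s"] E(2) by auto
  have 3: "f (f (f s)) \<noteq> s" for s
  proof
    assume "f (f (f s)) = s"
    moreover have "distinct [f (f s), f s, s]" using ne[of s] ne[of "f s"] 2[of s] by auto
    ultimately show False using cycle3[OF E(1), of "f (f s)" "f s" s] f[of s] f[of "f s"] f[of "f (f s)"] E(2) by auto
  qed
  have d: "distinct [f (f (f 1)), f (f 1), f 1, 1]"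
    using ne[of 1] ne[of "f 1"] ne[of "f (f 1)"] 2[of 1] 2[of "f 1"] 3[of 1] by auto
  then have "f (f (f (f 1))) \<in> {f (f (f 1)), f (f 1), f 1, 1}" using UNIV_labelling by blast
  then have "f (f (f (f 1))) = 1"
    using ne[of "f (f (f 1))"] 2[of "f (f 1)"] 3[of "f 1"] by auto
  then show False
    using cycle4[OF E(1) d] f[of 1] f[of "f 1"] f[of "f (f 1)"] f[of "f (f (f 1))"] E(2) by auto
qed

text \<open>For each head one of the three edges is left out, because the relation in its column
  expresses it by the other two: 4 -> 1, 4 -> 2, 4 -> 3 and 3 -> 4.\<close>

definition gdig1 :: "digraph set"
  where "gdig1 = (\<lambda>(i, j). edge i j) ` {(2, 1), (3, 1), (1, 2), (3, 2), (1, 3), (2, 3), (1, 4), (2, 4)}"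

definition gdig2_G :: "digraph set"
  where "gdig2_G = {edge i p + edge i q | i p q. distinct [i, p, q]}"

definition gdig2_H :: "digraph set"
  where "gdig2_H = {edge a p + edge b q | a b p q.
    (a, b) \<in> ordered_pairs \<and> (p, q) \<in> ordered_pairs \<and> {p, q} = UNIV - {a, b}}"

definition gdig3 :: "digraph set"
  where "gdig3 = {edge a p + edge b p + edge p q | a b p q. (a, b) \<in> ordered_pairs \<and> {p, q} = UNIV - {a, b}}"

definition gdig :: "digraph set"
  where "gdig = {0} \<union> gdig1 \<union> (gdig2_G \<union> gdig2_H) \<union> gdig3"

definition gspan :: "(config \<Rightarrow> complex) set"
  where "gspan = cfun.span (rel_mono 1 ` (gdig \<union> {E. decomposable E}))"

section \<open>Reduction of graphs with up to three edges\<close>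

lemma gspan_gdig: "E \<in> gdig \<Longrightarrow> rel_mono 1 E \<in> gspan"
  by (auto simp: gspan_def intro: cfun.span_base)

lemma gspan_decomposable: "decomposable E \<Longrightarrow> rel_mono 1 E \<in> gspan"
  by (auto simp: gspan_def intro: cfun.span_base)

lemma gspan_solve: "f + g + h = 0 \<Longrightarrow> f \<in> gspan \<Longrightarrow> g \<in> gspan \<Longrightarrow> h \<in> gspan"
  for f g h :: "config \<Rightarrow> complex"
  unfolding gspan_def by (metis add_eq_0_iff cfun.span_add cfun.span_neg)

lemma gspan_move:
  assumes "distinct [i, j, x, y]" "rel_adm 1 E" "0 < E i j" "ind E i \<le> outd E i"
    and "rel_mono 1 (move E i j x) \<in> gspan" "rel_mono 1 (move E i j y) \<in> gspan"
  shows "rel_mono 1 E \<in> gspan"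
  unfolding rel_mono_move[OF assms(1-4)] using assms(5,6) unfolding gspan_def
  by (intro cfun.span_neg cfun.span_add)

lemma gspan_arc:
  assumes "i \<noteq> j"
  shows "rel_mono 1 (edge i j) \<in> gspan"
proof -
  have rel: "rel_mono 1 (edge x j) + rel_mono 1 (edge y j) + rel_mono 1 (edge w j) = 0"
    if "distinct [j, x, y, w]" for j x y w
    using rel_mono_relation[OF that, of 0] that by (simp add: loopless_def ind_arc)
  have base: "rel_mono 1 (edge i j) \<in> gspan"
    if "(i, j) \<in> {(2, 1), (3, 1), (1, 2), (3, 2), (1, 3), (2, 3), (1, 4), (2, 4)}" for i j
    using that by (intro gspan_gdig) (auto simp: gdig_def gdig1_def)
  have "rel_mono 1 (edge 4 1) \<in> gspan" "rel_mono 1 (edge 4 2) \<in> gspan" "rel_mono 1 (edge 4 3) \<in> gspan"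
    "rel_mono 1 (edge 3 4) \<in> gspan"
    using gspan_solve[OF rel[of 1 2 3 4]] gspan_solve[OF rel[of 2 1 3 4]] gspan_solve[OF rel[of 3 1 2 4]]
      gspan_solve[OF rel[of 4 1 2 3]] base by auto
  then show ?thesis
    using assms exhaust_4[of i] exhaust_4[of j] base by auto
qed

lemma gspan_zero: "rel_mono 1 0 \<in> gspan"
  by (rule gspan_gdig) (simp add: gdig_def)

lemma gspan_fork: "distinct [i, p, q] \<Longrightarrow> rel_mono 1 (edge i p + edge i q) \<in> gspan"
  by (rule gspan_gdig) (auto simp: gdig_def gdig2_G_def)

text \<open>The order on pairs selects one of the two matchings from {r, s} to {p, q}.\<close>

lemma matching_in_gdig:
  assumes "distinct [p, q, r, s]"
  shows "edge r p + edge s q \<in> gdig \<or> edge s p + edge r q \<in> gdig"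
proof -
  have "p \<noteq> q" "r \<noteq> s" using assms by auto
  then have pq: "(p, q) \<in> ordered_pairs \<or> (q, p) \<in> ordered_pairs" and rs: "(r, s) \<in> ordered_pairs \<or> (s, r) \<in> ordered_pairs"
    using exhaust_4[of p] exhaust_4[of q] exhaust_4[of r] exhaust_4[of s] by (auto simp: ordered_pairs_def)
  have c: "{p, q} = UNIV - {r, s}" using UNIV_labelling[OF assms] assms by auto
  have H: "edge a p' + edge b q' \<in> gdig" if "(a, b) \<in> ordered_pairs" "(p', q') \<in> ordered_pairs" "{p', q'} = UNIV - {a, b}" for a b p' q'
    using that by (auto simp: gdig_def gdig2_H_def)
  show ?thesis
    using pq rs
  proof (elim disjE)
    assume "(p, q) \<in> ordered_pairs" "(r, s) \<in> ordered_pairs"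
    then show ?thesis using H c by simp
  next
    assume "(p, q) \<in> ordered_pairs" "(s, r) \<in> ordered_pairs"
    then show ?thesis using H[of s r p q] c by (simp add: insert_commute)
  next
    assume "(q, p) \<in> ordered_pairs" "(r, s) \<in> ordered_pairs"
    then show ?thesis using H[of r s q p] c by (simp add: insert_commute add.commute)
  next
    assume "(q, p) \<in> ordered_pairs" "(s, r) \<in> ordered_pairs"
    then show ?thesis using H[of s r q p] c by (simp add: insert_commute add.commute)
  qed
qed

text \<open>The nine monomials form a 3 x 3 array with vanishing row and column sums. It contains
  one 2-cycle and two forks, and the sums place the sum of the two matchings in the span as well.
  One matching is a generator, so the other follows, and then the four remaining entries.\<close>

lemma gspan_two_heads:
  assumes d: "distinct [p, q, r, s]" and i: "i \<noteq> p" and j: "j \<noteq> q"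
  shows "rel_mono 1 (edge i p + edge j q) \<in> gspan"
proof -
  let ?a = "\<lambda>i j. rel_mono 1 (edge i p + edge j q)"
  have col1: "?a q j + ?a r j + ?a s j = 0" if "j \<noteq> q" for j
    using rel_mono_relation[of p q r s "edge j q"] d that
    by (auto simp: loopless_arc ind_add ind_arc add.commute)
  have col2: "?a i p + ?a i r + ?a i s = 0" if "i \<noteq> p" for i
    using rel_mono_relation[of q p r s "edge i p"] d that
    by (auto simp: loopless_arc ind_add ind_arc)
  have cyc: "?a q p \<in> gspan"
    using d by (intro gspan_decomposable cycle2[of _ q p])
      (auto simp: rel_adm_def loopless_add loopless_arc ind_add ind_arc, auto simp: edge_def)
  have fork: "?a r r \<in> gspan" "?a s s \<in> gspan" using d by (auto intro!: gspan_fork)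
  have sum: "?a r s + ?a s r + (?a r r + ?a s s - ?a q p) = 0"
  proof -
    have "?a r s + ?a s r + (?a r r + ?a s s - ?a q p)
      = (?a q r + ?a r r + ?a s r) + (?a q s + ?a r s + ?a s s) - (?a q p + ?a q r + ?a q s)"
      by (simp add: algebra_simps)
    also have "\<dots> = 0"
      by (subst col1[of r] col1[of s] col2[of q]; use d in auto)+
    finally show ?thesis .
  qed
  have rest: "?a r r + ?a s s - ?a q p \<in> gspan"
    using cyc fork unfolding gspan_def by (intro cfun.span_diff cfun.span_add)
  have "?a r s \<in> gspan \<or> ?a s r \<in> gspan"
    using matching_in_gdig[OF d] gspan_gdig by blast
  then have m: "?a r s \<in> gspan" "?a s r \<in> gspan"
    using gspan_solve[of "?a r s" "?a r r + ?a s s - ?a q p" "?a s r"]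
      gspan_solve[of "?a s r" "?a r r + ?a s s - ?a q p" "?a r s"] sum rest by (auto simp: algebra_simps)
  have "?a q r \<in> gspan" "?a q s \<in> gspan" "?a r p \<in> gspan" "?a s p \<in> gspan"
    using gspan_solve[of "?a r r" "?a s r" "?a q r"] gspan_solve[of "?a r s" "?a s s" "?a q s"]
      gspan_solve[of "?a r r" "?a r s" "?a r p"] gspan_solve[of "?a s r" "?a s s" "?a s p"]
      col1[of r] col1[of s] col2[of r] col2[of s] m fork d by (auto simp: add_ac)
  moreover have "i \<in> {q, r, s}" "j \<in> {p, r, s}" using UNIV_labelling[OF d] i j by auto
  ultimately show ?thesis using m fork cyc by auto
qed

text \<open>In the relation for the head \<open>p\<close> the edge from \<open>q\<close> closes a
  2-cycle with p -> q. So a double edge x -> p is, modulo cycles and up to sign, the same as one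
  edge from each of \<open>r\<close> and \<open>s\<close>, and that graph is a generator.\<close>

lemma gspan_hat_arc:
  assumes d: "distinct [p, q, r, s]" and x: "x \<in> {r, s}" and y: "y \<in> {r, s}"
  shows "rel_mono 1 (edge x p + edge y p + edge p q) \<in> gspan"
proof -
  let ?a = "\<lambda>x y. rel_mono 1 (edge x p + edge y p + edge p q)"
  have c: "{p, q} = UNIV - {r, s}" using UNIV_labelling[OF d] d by auto
  have "r \<noteq> s" using d by auto
  then have "(r, s) \<in> ordered_pairs \<or> (s, r) \<in> ordered_pairs"
    using exhaust_4[of r] exhaust_4[of s] by (auto simp: ordered_pairs_def)
  then have "edge r p + edge s p + edge p q \<in> gdig3 \<or> edge s p + edge r p + edge p q \<in> gdig3"
    using c unfolding gdig3_def by (smt (verit, best) insert_commute mem_Collect_eq)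
  then have rs: "?a r s \<in> gspan"
    using gspan_gdig[of "edge r p + edge s p + edge p q"] by (auto simp: gdig_def add.commute)
  have diag: "?a x x \<in> gspan" if xw: "(x, w) \<in> {(r, s), (s, r)}" for x w
  proof -
    have adm: "loopless (edge x p + edge p q)" "\<And>i. ind (edge x p + edge p q + edge q p) i \<le> outd (edge x p + edge p q) i + 1"
      "rel_adm 1 (edge q p + edge x p + edge p q)"
      using d xw by (auto simp: rel_adm_def loopless_add loopless_arc ind_add ind_arc outd_add outd_arc)
    have "rel_mono 1 (edge x p + edge p q + edge q p) + rel_mono 1 (edge x p + edge p q + edge w p)
       + rel_mono 1 (edge x p + edge p q + edge x p) = 0"
      using d xw by (intro rel_mono_relation adm) auto
    then have "?a q x + ?a r s + ?a x x = 0" using xw by (auto simp: add_ac)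
    moreover have "?a q x \<in> gspan"
      by (intro gspan_decomposable cycle2[OF adm(3), of p q]) (use d xw in \<open>auto simp: edge_def\<close>)
    ultimately show ?thesis using rs by (rule gspan_solve)
  qed
  show ?thesis
    using x y rs diag[of r s] diag[of s r] by (auto simp: add.commute[of "edge s p" "edge r p"])
qed

section \<open>Reduction of acyclic graphs according to their sources\<close>

definition times_arc :: "nat \<Rightarrow> digraph \<Rightarrow> digraph"
  where "times_arc n F = (\<lambda>i j. n * F i j)"

lemma times_arc_simps: "times_arc 0 F = 0" "times_arc 1 F = F" "times_arc 2 F = F + F"
  by (auto simp: times_arc_def fun_eq_iff)

text \<open>Only the edges s -> q, p -> q, s -> r, p -> r, q -> r can occur. As \<open>r\<close> has
  no outgoing edge, its in-degree is at most 1, and then that of \<open>q\<close> is at most 2. The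
  resulting finite list is covered by the preceding lemmas.\<close>

lemma gspan_two_sources:
  assumes d: "distinct [p, q, r, s]" and E: "rel_adm 1 E"
    and s: "ind E s = 0" and p: "ind E p = 0" and rq: "E r q = 0"
  shows "rel_mono 1 E \<in> gspan"
proof -
  have z: "E s s = 0" "E p s = 0" "E q s = 0" "E r s = 0" "E s p = 0" "E p p = 0" "E q p = 0" "E r p = 0"
    "E q q = 0" "E r r = 0"
    using s p E by (auto simp: ind_def rel_adm_def loopless_def)
  define u v w t a where "u = E s q" and "v = E p q" and "w = E s r" and "t = E p r" and "a = E q r"
  have ind: "ind E q = u + v" "ind E r = w + t + a"
    by (simp_all add: ind_def sum_labelling[OF d] z rq u_def v_def w_def t_def a_def)
  have out: "outd E q = a" "outd E r = 0"
    by (simp_all add: outd_def sum_labelling[OF d] z rq a_def)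
  have le: "u + v \<le> a + 1" "w + t + a \<le> 1"
    using E ind out by (metis add_0 rel_adm_def)+
  have eq: "E = times_arc u (edge s q) + times_arc v (edge p q) + times_arc w (edge s r) + times_arc t (edge p r) + times_arc a (edge q r)"
    by (rule digraph_eq_labelling[OF d])
      (use d in \<open>auto simp: times_arc_def edge_def z rq u_def v_def w_def t_def a_def\<close>)
  have A: "rel_mono 1 (edge i q) \<in> gspan" "rel_mono 1 (edge j r) \<in> gspan" "rel_mono 1 (edge i q + edge j r) \<in> gspan"
    if "i \<in> {s, p}" "j \<in> {s, p, q}" for i j
    using d that gspan_arc[of i q] gspan_arc[of j r] gspan_two_heads[of q r s p i j] by auto
  have B: "rel_mono 1 (edge i q + edge j q + edge q r) \<in> gspan" if "i \<in> {s, p}" "j \<in> {s, p}" for i j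
    using d that gspan_hat_arc[of q r s p i j] by auto
  have AB: "rel_mono 1 (edge s q) \<in> gspan" "rel_mono 1 (edge p q) \<in> gspan"
    "rel_mono 1 (edge s r) \<in> gspan" "rel_mono 1 (edge p r) \<in> gspan" "rel_mono 1 (edge q r) \<in> gspan"
    "rel_mono 1 (edge s q + edge s r) \<in> gspan" "rel_mono 1 (edge s q + edge p r) \<in> gspan" "rel_mono 1 (edge s q + edge q r) \<in> gspan"
    "rel_mono 1 (edge p q + edge s r) \<in> gspan" "rel_mono 1 (edge p q + edge p r) \<in> gspan" "rel_mono 1 (edge p q + edge q r) \<in> gspan"
    "rel_mono 1 (edge s q + edge s q + edge q r) \<in> gspan" "rel_mono 1 (edge s q + edge p q + edge q r) \<in> gspan"
    "rel_mono 1 (edge p q + edge p q + edge q r) \<in> gspan"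
    using A[of s s] A[of s p] A[of s q] A[of p s] A[of p p] A[of p q] B[of s s] B[of s p] B[of p p]
    by simp_all
  have "w = 0 \<and> t = 0 \<and> a = 0 \<or> w = 1 \<and> t = 0 \<and> a = 0 \<or> w = 0 \<and> t = 1 \<and> a = 0 \<or> w = 0 \<and> t = 0 \<and> a = 1"
    using le(2) by linarith
  moreover have "u = 0 \<and> v = 0 \<or> u = 1 \<and> v = 0 \<or> u = 0 \<and> v = 1 \<or>
     a = 1 \<and> (u = 2 \<and> v = 0 \<or> u = 1 \<and> v = 1 \<or> u = 0 \<and> v = 2)"
    using le by linarith
  ultimately show ?thesis
    unfolding eq by (elim disjE conjE; simp only: times_arc_simps add_0_left add_0_right AB gspan_zero zero_neq_one one_neq_zero)
qed

text \<open>If a vertex \<open>p\<close> reaches both other vertices \<open>q, r\<close> that are not the source \<open>s\<close>, then replacing an edge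
  \<open>s \<rightarrow> p\<close> by \<open>q \<rightarrow> p\<close> or \<open>r \<rightarrow> p\<close> closes a cycle.\<close>

lemma gspan_reach_both:
  assumes d: "distinct [p, q, r, s]" and E: "rel_adm 1 E" and s: "ind E s = 0" and p: "0 < ind E p"
    and reach: "0 < E p q \<and> 0 < E p r \<or> 0 < E p q \<and> 0 < E q r \<or> 0 < E p r \<and> 0 < E r q"
  shows "rel_mono 1 E \<in> gspan"
proof -
  have cyc: "decomposable F" if F: "rel_adm 1 F" "0 < F q p \<or> 0 < F r p"
    "0 < F p q \<and> 0 < F p r \<or> 0 < F p q \<and> 0 < F q r \<or> 0 < F p r \<and> 0 < F r q" for F
    using F cycle2[OF F(1), of p q] cycle2[OF F(1), of p r] cycle3[OF F(1), of p q r] cycle3[OF F(1), of p r q] d by auto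
  show ?thesis
  proof (cases "0 < E q p \<or> 0 < E r p")
    case True
    then show ?thesis by (intro gspan_decomposable cyc[OF E _ reach])
  next
    case False
    have "ind E p = E q p + E r p + E s p"
      using E by (simp add: ind_def sum_labelling[OF d] rel_adm_def loopless_def)
    then have sp: "0 < E s p" using False p by simp
    have si: "ind E s \<le> outd E s" using s by simp
    have "decomposable (move E s p x)" if x: "x \<in> {q, r}" for x
    proof (rule cyc)
      show "rel_adm 1 (move E s p x)" using d x by (intro rel_adm_move E sp si) auto
      show "0 < move E s p x q p \<or> 0 < move E s p x r p" using move_new[of x s E p] x d by auto
      have "E a b \<le> move E s p x a b" if "a \<noteq> s" for a b using move_ge[of a b s p E x] that by auto
      then show "0 < move E s p x p q \<and> 0 < move E s p x p r \<or> 0 < move E s p x p q \<and> 0 < move E s p x q r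
          \<or> 0 < move E s p x p r \<and> 0 < move E s p x r q"
        using reach d by (metis distinct_length_2_or_more order_less_le_trans)
    qed
    then show ?thesis
      using gspan_move[of s p q r E] d E sp si gspan_decomposable by auto
  qed
qed

text \<open>If there is a 2-cycle, or if some vertex reaches the other two among \<open>x\<close>,
  \<open>y\<close>, \<open>z\<close>, the claim is known. Otherwise only z -> y could accompany x ->
  y; but then \<open>y\<close> has out-degree 0, hence in-degree 1, so z -> y is absent and
  \<open>z\<close> is fed by \<open>s\<close>. Exchanging an edge s -> z for x -> z or y -> z lets
  \<open>x\<close> reach both.\<close>

lemma gspan_inner_arc:
  assumes d: "distinct [x, y, z, s]" and E: "rel_adm 1 E" and s: "ind E s = 0"
    and pos: "0 < ind E x" "0 < ind E y" "0 < ind E z" and xy: "0 < E x y"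
  shows "rel_mono 1 E \<in> gspan"
proof -
  have l: "E i i = 0" for i using E by (simp add: rel_adm_def loopless_def)
  have s0: "E i s = 0" for i using s by (simp add: ind_def)
  consider "0 < E y x" | "0 < E y z" | "0 < E x z" | "0 < E z x"
    | "E y x = 0" "E y z = 0" "E x z = 0" "E z x = 0" by blast
  then show ?thesis
  proof cases
    case 1
    then show ?thesis using cycle2[OF E xy] by (intro gspan_decomposable)
  next
    case 2
    then show ?thesis using gspan_reach_both[OF d E s] pos xy by auto
  next
    case 3
    then show ?thesis using gspan_reach_both[OF d E s] pos xy by auto
  next
    case 4
    then show ?thesis using gspan_reach_both[of z x y s E] d E s pos xy by auto
  next
    case 5
    have "outd E y = 0" using 5 l s0 by (simp add: outd_def sum_labelling[OF d])
    then have "ind E y \<le> 1" using E by (metis add_0 rel_adm_def)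
    then have "E z y = 0" using xy by (simp add: ind_def sum_labelling[OF d])
    then have sz: "0 < E s z" using 5 pos(3) l by (simp add: ind_def sum_labelling[OF d])
    have si: "ind E s \<le> outd E s" using s by simp
    have ge: "E a b \<le> move E s z w a b" if "a \<noteq> s" for a b w using move_ge[of a b s z E w] that by auto
    have "0 < move E s z w x y" for w using ge[of x y w] d xy by auto
    moreover have "0 < move E s z w w z" if "w \<noteq> s" for w using move_new[of w s E z] that by auto
    moreover have "rel_adm 1 (move E s z w)" if "w \<noteq> z" for w using rel_adm_move[OF E sz si that] .
    moreover have "ind (move E s z w) = ind E" for w using ind_move[of E s z w] sz .
    ultimately have "rel_mono 1 (move E s z w) \<in> gspan" if "w \<in> {x, y}" for w
      using gspan_reach_both[OF d, of "move E s z w"] that d s pos by auto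
    then show ?thesis
      using gspan_move[of s z x y E] d E sz si by auto
  qed
qed

text \<open>An exchange preserves in-degrees and thereby the set of sources. With a second source
  \<open>gspan_two_sources\<close> applies. If \<open>s\<close> is the only one, an edge between the
  other vertices is present or arises by exchanging an edge s -> p, and
  \<open>gspan_inner_arc\<close> applies.\<close>

theorem rel_mono_in_gspan:
  assumes E: "rel_adm 1 E"
  shows "rel_mono 1 E \<in> gspan"
proof (cases "decomposable E")
  case True
  then show ?thesis by (rule gspan_decomposable)
next
  case False
  obtain s where s: "ind E s = 0" using acyclic_source[OF E False] by blast
  have l: "E i i = 0" for i using E by (simp add: rel_adm_def loopless_def)
  have s0: "E i s = 0" for i using s by (simp add: ind_def)
  have ex: "\<exists>q r. distinct [p, q, r, s]" if "p \<noteq> s" for p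
  proof -
    have "card (UNIV - {p, s}) = 2" using that by (subst card_Diff_subset) auto
    then obtain q r where qr: "UNIV - {p, s} = {q, r}" "q \<noteq> r" by (auto simp: card_2_iff)
    then have "p \<notin> {q, r}" "s \<notin> {q, r}" by blast+
    then show ?thesis using qr(2) that by (intro exI[of _ q] exI[of _ r]) auto
  qed
  show ?thesis
  proof (cases "\<exists>p. p \<noteq> s \<and> ind E p = 0")
    case True
    then obtain p where p: "p \<noteq> s" "ind E p = 0" by blast
    then obtain q r where d: "distinct [p, q, r, s]" using ex by blast
    show ?thesis
    proof (cases "E r q = 0")
      case True
      then show ?thesis using gspan_two_sources[OF d E s p(2)] by simp
    next
      case F: False
      then have "E q r = 0" using cycle2[OF E, of q r] False by auto
      then show ?thesis using gspan_two_sources[of p r q s E] d E s p(2) by auto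
    qed
  next
    case pos: False
    have "1 \<noteq> s \<or> 2 \<noteq> s" by auto
    then obtain p where "p \<noteq> s" by blast
    then obtain q r where d: "distinct [p, q, r, s]" using ex by blast
    have ps: "0 < ind E p" "0 < ind E q" "0 < ind E r" using pos d by auto
    have inner: "rel_mono 1 F \<in> gspan"
      if F: "rel_adm 1 F" "ind F = ind E" "0 < F p q \<or> 0 < F q p \<or> 0 < F p r \<or> 0 < F r p \<or> 0 < F q r \<or> 0 < F r q" for F
    proof -
      have "ind F s = 0" using s F by simp
      note g = gspan_inner_arc[of _ _ _ s F, OF _ F(1) this]
      show ?thesis
        using F(3) g[of p q r] g[of q p r] g[of p r q] g[of r p q] g[of q r p] g[of r q p] d ps
        unfolding F(2) by auto
    qed
    show ?thesis
    proof (cases "0 < E p q \<or> 0 < E q p \<or> 0 < E p r \<or> 0 < E r p \<or> 0 < E q r \<or> 0 < E r q")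
      case True
      then show ?thesis using inner[OF E refl] by simp
    next
      case no: False
      then have sp: "0 < E s p" using ps(1) l by (simp add: ind_def sum_labelling[OF d])
      have si: "ind E s \<le> outd E s" using s by simp
      have "rel_mono 1 (move E s p w) \<in> gspan" if "w \<in> {q, r}" for w
        using inner[OF rel_adm_move[OF E sp si] ind_move[of E s p w, OF sp]] move_new[of w s E p] that d by auto
      then show ?thesis using gspan_move[of s p q r E] d E sp si by auto
    qed
  qed
qed

section \<open>Lower bound\<close>

text \<open>The four rows add up to zero, so all \<open>d i\<close> are equal and the basic
  relations say just that the columns of the matrix of the \<open>C i j\<close> have sum zero. Every
  such matrix with zero diagonal is attained.\<close>

definition sum_zero_point :: "(4 \<Rightarrow> 4 \<Rightarrow> complex) \<Rightarrow> config"
  where "sum_zero_point X = ((\<chi> j. vector [X 1 j, X 2 j, X 3 j]),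
     (\<chi> i. if i = 1 then vector [1, 0, 0] else if i = 2 then vector [0, 1, 0]
           else if i = 3 then vector [0, 0, 1] else vector [-1, -1, -1]))"

lemma sum_zero_point:
  assumes X: "\<And>j. X j j = 0" "\<And>j. (\<Sum>i\<in>UNIV. X i j) = 0"
  shows "sum_zero_point X \<in> M4" "d i (sum_zero_point X) = -1" "C i j (sum_zero_point X) = X i j"
proof -
  have X4: "X 4 j = - X 1 j - X 2 j - X 3 j" for j
    using X(2)[of j] by (simp add: sum_4 algebra_simps add_eq_0_iff)
  have sp: "scalar_product (rowL (sum_zero_point X) i) (colA (sum_zero_point X) j) = X i j" for i j
    using exhaust_4[of i] by (auto simp: sum_zero_point_def scalar_product_3 X4)
  then show M: "sum_zero_point X \<in> M4" by (simp add: M4_def X)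
  show "C i j (sum_zero_point X) = X i j" by (simp add: C_on_M4[OF M] sp)
  have "d 1 (sum_zero_point X) = -1" "d 2 (sum_zero_point X) = -1" "d 3 (sum_zero_point X) = -1"
    "d 4 (sum_zero_point X) = -1"
    unfolding d_simps D_on_M4[OF M] det_3 by (simp_all add: sum_zero_point_def)
  then show "d i (sum_zero_point X) = -1" using exhaust_4[of i] by auto
qed

lemma rel_mono_sum_zero_point:
  assumes X: "\<And>j. X j j = 0" "\<And>j. (\<Sum>i\<in>UNIV. X i j) = 0" and E: "rel_adm 1 E"
  shows "rel_mono 1 E (sum_zero_point X) = (\<Prod>i\<in>UNIV. \<Prod>j\<in>UNIV. X i j ^ E i j)"
proof -
  define m where "m i = nat (int (outd E i) - (int (ind E i) - int 1))" for i
  have m: "m i + ind E i = outd E i + 1" for i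
  proof -
    have "ind E i \<le> outd E i + 1" using E by (simp add: rel_adm_def)
    then have "int (m i) = int (outd E i) - (int (ind E i) - int 1)" unfolding m_def by simp
    then show ?thesis by linarith
  qed
  \<comment> \<open>The exponents of the \<open>d i\<close> add up to 4, so their values -1 multiply
    to 1.\<close>
  have "(\<Sum>i\<in>UNIV. m i + ind E i) = (\<Sum>i\<in>UNIV. outd E i + 1)" by (simp only: m)
  then have "(\<Sum>i\<in>UNIV. m i) = 4" by (simp add: sum.distrib sum_outd edges_def)
  then have "(\<Prod>i\<in>UNIV. (-1 :: complex) ^ m i) = 1" by (simp flip: power_sum)
  moreover have "rel_mono 1 E = dC_monom m E"
    by (simp add: rel_mono_def mono_at_def m_def[abs_def])
  ultimately show ?thesis
    by (simp add: dC_monom_def on_M4_def sum_zero_point[OF X])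
qed

text \<open>\<open>X\<close> is supported on the acyclic graph with the edges r, s -> p, q and p ->
  q, whereas a nonempty balanced graph contains a cycle and hence an edge at which \<open>X\<close>
  vanishes.\<close>

lemma balanced_product_zero:
  fixes X :: "4 \<Rightarrow> 4 \<Rightarrow> complex"
  assumes d: "distinct [p, q, r, s]" and X: "\<And>j. X j j = 0" "\<And>i j. j \<noteq> p \<Longrightarrow> j \<noteq> q \<Longrightarrow> X i j = 0" "X q p = 0"
    and F: "rel_adm 0 F" "0 < edges F"
  shows "(\<Prod>i\<in>UNIV. \<Prod>j\<in>UNIV. X i j ^ F i j) = 0"
proof (rule ccontr)
  assume "(\<Prod>i\<in>UNIV. \<Prod>j\<in>UNIV. X i j ^ F i j) \<noteq> 0"
  then have nz: "F i j = 0" if "X i j = 0" for i j using that by (auto simp: prod_zero_iff)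
  have bal: "ind F i = outd F i" for i using F by (simp add: rel_adm_0)
  have "outd F r = 0" "outd F s = 0"
    unfolding bal[symmetric] using d by (auto simp: ind_def intro!: nz X(2))
  then have rs: "F r j = 0" "F s j = 0" for j by (auto simp: outd_def)
  have "ind F p = 0" using rs nz[OF X(3)] nz[OF X(1)] by (simp add: ind_def sum_labelling[OF d])
  then have "outd F p = 0" by (simp add: bal)
  then have p: "F p j = 0" for j by (simp add: outd_def)
  have "ind F q = 0" using rs p nz[OF X(1)] by (simp add: ind_def sum_labelling[OF d])
  then have "outd F q = 0" by (simp add: bal)
  then have "edges F = 0" using p rs
    by (simp add: sum_outd[symmetric] sum_labelling[OF d]) (simp add: outd_def)
  then show False using F by simp
qed

text \<open>The general matrix with zero column sums supported on the edges r, s -> p, q and p ->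
  q.\<close>

definition pq_point :: "4 \<Rightarrow> 4 \<Rightarrow> 4 \<Rightarrow> 4 \<Rightarrow> complex \<Rightarrow> complex \<Rightarrow> complex \<Rightarrow> 4 \<Rightarrow> 4 \<Rightarrow> complex"
  where "pq_point p q r s t x y = (\<lambda>i j.
    if j = p then (if i = r then t else if i = s then - t else 0)
    else if j = q then (if i = r then x else if i = s then y else if i = p then - x - y else 0) else 0)"

lemma pq_point:
  fixes t x y :: complex
  assumes d: "distinct [p, q, r, s]"
  defines "X \<equiv> pq_point p q r s t x y"
  shows "X j j = 0" "(\<Sum>i\<in>UNIV. X i j) = 0" "j \<noteq> p \<Longrightarrow> j \<noteq> q \<Longrightarrow> X i j = 0" "X q p = 0"
  using d by (auto simp: X_def pq_point_def sum_labelling[OF d])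

text \<open>The graphs supported on the entries \<open>(r, p), (s, p), (r, q), (s, q), (p, q)\<close> at which the test point
  \<^const>\<open>pq_point\<close> does not vanish.\<close>

definition pq_digraph :: "4 \<Rightarrow> 4 \<Rightarrow> 4 \<Rightarrow> 4 \<Rightarrow> nat \<times> nat \<times> nat \<times> nat \<times> nat \<Rightarrow> digraph"
  where "pq_digraph p q r s = (\<lambda>(k1, k2, k3, k4, k5). times_arc k1 (edge r p) + times_arc k2 (edge s p)
    + times_arc k3 (edge r q) + times_arc k4 (edge s q) + times_arc k5 (edge p q))"

lemma pq_digraph_entries:
  assumes d: "distinct [p, q, r, s]"
  shows "pq_digraph p q r s (k1, k2, k3, k4, k5) r p = k1" "pq_digraph p q r s (k1, k2, k3, k4, k5) s p = k2"
    "pq_digraph p q r s (k1, k2, k3, k4, k5) r q = k3" "pq_digraph p q r s (k1, k2, k3, k4, k5) s q = k4"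
    "pq_digraph p q r s (k1, k2, k3, k4, k5) p q = k5"
    "(i, j) \<notin> {(r, p), (s, p), (r, q), (s, q), (p, q)} \<Longrightarrow> pq_digraph p q r s (k1, k2, k3, k4, k5) i j = 0"
  using d by (auto simp: pq_digraph_def times_arc_def edge_def)

lemma pq_product:
  assumes d: "distinct [p, q, r, s]"
  shows "(\<Prod>i\<in>UNIV. \<Prod>j\<in>UNIV. pq_point p q r s t x y i j ^ pq_digraph p q r s (k1, k2, k3, k4, k5) i j)
    = t ^ k1 * (- t) ^ k2 * x ^ k3 * y ^ k4 * (- x - y) ^ k5"
proof -
  have pl: "prod f UNIV = f p * f q * f r * f s" for f :: "4 \<Rightarrow> complex"
    using d unfolding UNIV_labelling[OF d] by (simp add: mult.assoc)
  have z: "pq_digraph p q r s (k1, k2, k3, k4, k5) i j = 0"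
    if "(i, j) \<in> {(p,p),(p,r),(p,s),(q,p),(q,q),(q,r),(q,s),(r,r),(r,s),(s,r),(s,s)}" for i j
    using d that by (intro pq_digraph_entries(6)) auto
  have v: "pq_point p q r s t x y r p = t" "pq_point p q r s t x y s p = - t" "pq_point p q r s t x y r q = x"
    "pq_point p q r s t x y s q = y" "pq_point p q r s t x y p q = - x - y"
    using d by (auto simp: pq_point_def)
  show ?thesis unfolding pl by (simp add: z v pq_digraph_entries(1-5)[OF d])
qed

text \<open>The generator shapes that fit this support: the empty graph, five single edges, two
  forks, two matchings and one graph with three edges. Which edges and matchings are generators
  depends on the labelling.\<close>

definition pq_keys :: "(nat \<times> nat \<times> nat \<times> nat \<times> nat) set"
  where "pq_keys = {(0,0,0,0,0), (1,0,0,0,0), (0,1,0,0,0), (0,0,1,0,0), (0,0,0,1,0), (0,0,0,0,1),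
     (1,0,1,0,0), (0,1,0,1,0), (1,0,0,1,0), (0,1,1,0,0), (1,1,0,0,1)}"

lemma gdig_cases:
  assumes E: "E \<in> gdig"
  obtains "E = 0" | i j where "E = edge i j" "i \<noteq> j" | i a b where "E = edge i a + edge i b" "distinct [i, a, b]"
    | i j a b where "E = edge i a + edge j b" "distinct [i, j, a, b]"
    | i j a b where "E = edge i a + edge j a + edge a b" "distinct [i, j, a, b]"
proof -
  have op: "distinct [i, j, a, b]" if "(i, j) \<in> ordered_pairs" "{a, b} = UNIV - {i, j}" for i j a b :: 4
  proof -
    have "i \<noteq> j" using that(1) by (auto simp: ordered_pairs_def)
    then have "card (UNIV - {i, j}) = 2" by (subst card_Diff_subset) auto
    then have "a \<noteq> b" using that(2) by (metis card_1_singleton_iff insert_absorb2 numeral_eq_one_iff semiring_norm(85) card.insert card.empty finite.emptyI empty_iff One_nat_def)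
    moreover have "a \<notin> {i, j}" "b \<notin> {i, j}" using that(2) by blast+
    ultimately show ?thesis using \<open>i \<noteq> j\<close> by auto
  qed
  consider "E = 0" | "E \<in> gdig1" | "E \<in> gdig2_G" | "E \<in> gdig2_H" | "E \<in> gdig3"
    using E unfolding gdig_def by blast
  then show ?thesis
  proof cases
    case 1
    then show ?thesis by (rule that(1))
  next
    case 2
    then show ?thesis using that(2) unfolding gdig1_def by auto
  next
    case 3
    then show ?thesis using that(3) unfolding gdig2_G_def by blast
  next
    case 4
    then obtain i j a b where h: "E = edge i a + edge j b" "(i, j) \<in> ordered_pairs" "{a, b} = UNIV - {i, j}"
      unfolding gdig2_H_def by blast
    show ?thesis by (rule that(4)[OF h(1) op[OF h(2,3)]])
  next
    case 5
    then obtain i j a b where h: "E = edge i a + edge j a + edge a b" "(i, j) \<in> ordered_pairs" "{a, b} = UNIV - {i, j}"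
      unfolding gdig3_def by blast
    show ?thesis by (rule that(5)[OF h(1) op[OF h(2,3)]])
  qed
qed

lemma gdig_pq_keys:
  assumes d: "distinct [p, q, r, s]" and E: "E \<in> gdig"
    and supp: "\<And>i j. (i, j) \<notin> {(r, p), (s, p), (r, q), (s, q), (p, q)} \<Longrightarrow> E i j = 0"
  shows "E \<in> pq_digraph p q r s ` pq_keys"
proof -
  let ?S = "{(r, p), (s, p), (r, q), (s, q), (p, q)}"
  have S: "(i, j) \<in> ?S" if "0 < E i j" for i j using supp[of i j] that by auto
  from E consider "E = 0" | i j where "E = edge i j" "i \<noteq> j" | i a b where "E = edge i a + edge i b" "distinct [i, a, b]"
    | i j a b where "E = edge i a + edge j b" "distinct [i, j, a, b]"
    | i j a b where "E = edge i a + edge j a + edge a b" "distinct [i, j, a, b]"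
    by (rule gdig_cases)
  then show ?thesis
  proof cases
    case 1
    then have "E = pq_digraph p q r s (0, 0, 0, 0, 0)" by (simp add: pq_digraph_def times_arc_simps)
    then show ?thesis by (auto simp: pq_keys_def)
  next
    case (2 i j)
    have "(i, j) \<in> ?S" by (rule S) (simp add: 2(1) edge_def)
    then have "E \<in> pq_digraph p q r s ` {(1,0,0,0,0), (0,1,0,0,0), (0,0,1,0,0), (0,0,0,1,0), (0,0,0,0,1)}"
      unfolding 2(1) by (auto simp: pq_digraph_def times_arc_simps)
    then show ?thesis by (auto simp: pq_keys_def)
  next
    case (3 i a b)
    have "(i, a) \<in> ?S" "(i, b) \<in> ?S" by (rule S, simp add: 3(1) edge_def)+
    with 3(2) d have "E \<in> pq_digraph p q r s ` {(1,0,1,0,0), (0,1,0,1,0)}"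
      unfolding 3(1) by (auto simp: pq_digraph_def times_arc_simps add.commute)
    then show ?thesis by (auto simp: pq_keys_def)
  next
    case (4 i j a b)
    have "(i, a) \<in> ?S" "(j, b) \<in> ?S" by (rule S, simp add: 4(1) edge_def)+
    with 4(2) d have "E \<in> pq_digraph p q r s ` {(1,0,0,1,0), (0,1,1,0,0)}"
      unfolding 4(1) by (auto simp: pq_digraph_def times_arc_simps add.commute)
    then show ?thesis by (auto simp: pq_keys_def)
  next
    case (5 i j a b)
    have "(i, a) \<in> ?S" "(j, a) \<in> ?S" "(a, b) \<in> ?S" by (rule S, simp add: 5(1) edge_def)+
    with 5(2) d have "E \<in> pq_digraph p q r s ` {(1,1,0,0,1)}"
      unfolding 5(1) by (auto simp: pq_digraph_def times_arc_simps add.commute)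
    then show ?thesis by (auto simp: pq_keys_def)
  qed
qed


lemma gdig_adm: "E \<in> gdig \<Longrightarrow> rel_adm 1 E"
  by (erule gdig_cases)
    (auto simp: rel_adm_def loopless_arc loopless_add ind_add outd_add ind_arc outd_arc loopless_def[of 0] ind_def[of 0])

lemma finite_gdig: "finite gdig"
proof -
  have "gdig \<subseteq> {0} \<union> range (\<lambda>(i, j). edge i j) \<union> range (\<lambda>(i, a, j, b). edge i a + edge j b)
      \<union> range (\<lambda>(i, a, j, b). edge i a + edge j a + edge a b)"
  proof
    fix E assume "E \<in> gdig"
    then show "E \<in> {0} \<union> range (\<lambda>(i, j). edge i j) \<union> range (\<lambda>(i, a, j, b). edge i a + edge j b)
      \<union> range (\<lambda>(i, a, j, b). edge i a + edge j a + edge a b)"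
    proof (cases rule: gdig_cases)
      case (2 i j)
      then have "E \<in> range (\<lambda>(i, j). edge i j)" by (intro range_eqI[of _ _ "(i, j)"]) simp
      then show ?thesis by blast
    next
      case (3 i a b)
      then have "E \<in> range (\<lambda>(i, a, j, b). edge i a + edge j b)" by (intro range_eqI[of _ _ "(i, a, i, b)"]) simp
      then show ?thesis by blast
    next
      case (4 i j a b)
      then have "E \<in> range (\<lambda>(i, a, j, b). edge i a + edge j b)" by (intro range_eqI[of _ _ "(i, a, j, b)"]) simp
      then show ?thesis by blast
    next
      case (5 i j a b)
      then have "E \<in> range (\<lambda>(i, a, j, b). edge i a + edge j a + edge a b)" by (intro range_eqI[of _ _ "(i, a, j, b)"]) simp
      then show ?thesis by blast
    qed simp
  qed
  then show ?thesis by (rule finite_subset) simp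
qed

lemma arc_inject: "edge i j = edge a b \<longleftrightarrow> i = a \<and> j = b"
proof
  assume "edge i j = edge a b"
  then have "edge i j i j = edge a b i j" by simp
  then show "i = a \<and> j = b" by (auto simp: edge_def split: if_splits)
qed simp

text \<open>Evaluation at the test point kills \<open>A4_plus_W4\<close>, since the balanced part of
  a decomposable graph vanishes there. What is left is a polynomial identity in t, x, y with at most
  eleven coefficients.\<close>

lemma gdig_sum_vanishes:
  assumes sum: "(\<lambda>z. \<Sum>E\<in>gdig. a E * rel_mono 1 E z) \<in> A4_plus_W4" and d: "distinct [p, q, r, s]"
  shows "(\<Sum>\<kappa>\<in>pq_keys. (if pq_digraph p q r s \<kappa> \<in> gdig then a (pq_digraph p q r s \<kappa>) else 0) *
    (case \<kappa> of (k1, k2, k3, k4, k5) \<Rightarrow> t ^ k1 * (- t) ^ k2 * x ^ k3 * y ^ k4 * (- x - y) ^ k5)) = 0"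
proof -
  define X where "X = pq_point p q r s t x y"
  note X = pq_point[OF d, where t = t and x = x and y = y, folded X_def]
  define P where "P E = (\<Prod>i\<in>UNIV. \<Prod>j\<in>UNIV. X i j ^ E i j)" for E :: digraph
  let ?dg = "pq_digraph p q r s"
  have P: "rel_mono 1 E (sum_zero_point X) = P E" if "rel_adm 1 E" for E
    unfolding P_def by (rule rel_mono_sum_zero_point[OF X(1,2) that])
  have "P (F + G) = 0" if "rel_adm 0 F" "0 < edges F" for F G
    using balanced_product_zero[OF d X(1) X(3,4) that] unfolding P_def
    by (simp add: power_add prod.distrib)
  then have "rel_mono 1 E (sum_zero_point X) = 0" if "decomposable E" for E
    using that P decomposable_adm by (metis decomposable_def)
  then have "A4_plus_W4 \<subseteq> {f. f (sum_zero_point X) = 0}"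
    unfolding A4_plus_W4_eq by (intro cfun.span_minimal) (auto simp: cscale_def intro!: cfun.subspaceI)
  then have "(\<Sum>E\<in>gdig. a E * rel_mono 1 E (sum_zero_point X)) = 0" using sum by auto
  then have "0 = (\<Sum>E\<in>gdig. a E * P E)" by (simp add: P gdig_adm cong: sum.cong)
  also have "\<dots> = (\<Sum>E\<in>gdig \<inter> ?dg ` pq_keys. a E * P E)"
  proof (rule sum.mono_neutral_right[OF finite_gdig]; (intro ballI)?)
    fix E assume "E \<in> gdig - gdig \<inter> ?dg ` pq_keys"
    then have E: "E \<in> gdig" "E \<notin> ?dg ` pq_keys" by auto
    then obtain i j where ij: "(i, j) \<notin> {(r, p), (s, p), (r, q), (s, q), (p, q)}" "E i j \<noteq> 0"
      using gdig_pq_keys[OF d E(1)] E(2) by metis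
    then have "X i j = 0" by (auto simp: X_def pq_point_def)
    then have "P E = 0" unfolding P_def using ij(2) by (auto simp: prod_zero_iff)
    then show "a E * P E = 0" by simp
  qed simp
  also have "\<dots> = (\<Sum>E\<in>?dg ` pq_keys. (if E \<in> gdig then a E else 0) * P E)"
  proof -
    have "finite (?dg ` pq_keys)" by (simp add: pq_keys_def)
    then show ?thesis by (simp add: sum.inter_restrict Int_commute[of gdig] if_distrib[of "\<lambda>x. x * _"] cong: if_cong)
  qed
  also have "\<dots> = (\<Sum>\<kappa>\<in>pq_keys. (if ?dg \<kappa> \<in> gdig then a (?dg \<kappa>) else 0) * P (?dg \<kappa>))"
  proof -
    have "(?dg \<kappa> r p, ?dg \<kappa> s p, ?dg \<kappa> r q, ?dg \<kappa> s q, ?dg \<kappa> p q) = \<kappa>" for \<kappa>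
      by (cases \<kappa>) (simp add: pq_digraph_entries[OF d])
    then have "inj ?dg" by (metis injI)
    then show ?thesis by (simp add: sum.reindex inj_on_subset[OF _ subset_UNIV])
  qed
  also have "\<dots> = (\<Sum>\<kappa>\<in>pq_keys. (if ?dg \<kappa> \<in> gdig then a (?dg \<kappa>) else 0) *
    (case \<kappa> of (k1, k2, k3, k4, k5) \<Rightarrow> t ^ k1 * (- t) ^ k2 * x ^ k3 * y ^ k4 * (- x - y) ^ k5))"
    unfolding P_def X_def by (rule sum.cong[OF refl]) (auto simp only: pq_product[OF d] prod.case)
  finally show ?thesis by simp
qed

text \<open>Continuing the coefficients by zero outside \<open>gdig\<close> makes the comparison
  uniform in the labelling; an equality then forces zero as soon as one of its graphs is not a
  generator.\<close>

lemma gdig_coefficients: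
  assumes sum: "(\<lambda>z. \<Sum>E\<in>gdig. a E * rel_mono 1 E z) \<in> A4_plus_W4" and d: "distinct [p, q, r, s]"
  defines "b \<equiv> \<lambda>E. if E \<in> gdig then a E else 0"
  shows "b 0 = 0" "b (edge r q) = b (edge p q)" "b (edge s q) = b (edge p q)"
    "b (edge r p + edge r q) = b (edge s p + edge r q)" "b (edge s p + edge s q) = b (edge r p + edge s q)"
    "b (edge r p + edge s p + edge p q) = 0"
proof -
  define b1 b2 where "b1 = b (edge r p)" and "b2 = b (edge s p)"
  define b3 b4 b5 where "b3 = b (edge r q)" and "b4 = b (edge s q)" and "b5 = b (edge p q)"
  define b6 b7 b8 b9 b10 where "b6 = b (edge r p + edge r q)" and "b7 = b (edge s p + edge s q)"
    and "b8 = b (edge r p + edge s q)" and "b9 = b (edge s p + edge r q)" and "b10 = b (edge r p + edge s p + edge p q)"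
  have eq: "b 0 + t * b1 - t * b2 + x * b3 + y * b4 + (- x - y) * b5
     + t * x * b6 - t * y * b7 + t * y * b8 - t * x * b9 - t * t * (- x - y) * b10 = 0" for t x y
  proof -
    have "(\<Sum>\<kappa>\<in>pq_keys. b (pq_digraph p q r s \<kappa>) *
      (case \<kappa> of (k1, k2, k3, k4, k5) \<Rightarrow> t ^ k1 * (- t) ^ k2 * x ^ k3 * y ^ k4 * (- x - y) ^ k5)) = 0"
      unfolding b_def by (rule gdig_sum_vanishes[OF sum d])
    then show ?thesis
      unfolding pq_keys_def
      by (simp add: pq_digraph_def times_arc_simps flip: b1_def b2_def b3_def b4_def b5_def b6_def b7_def b8_def
          b9_def b10_def) (simp add: algebra_simps)
  qed
  show b0: "b 0 = 0" using eq[of 0 0 0] by simp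
  have b3: "b3 = b5" using eq[of 0 1 0] b0 by simp
  have b4: "b4 = b5" using eq[of 0 0 1] b0 by simp
  have b1: "b1 = b2" using eq[of 1 0 0] b0 by simp
  \<comment> \<open>The values 1 and -1 of t separate degree 1 in t, which compares forks with
    matchings, from degree 2, which isolates the graph with three edges.\<close>
  have e1: "b6 - b9 + b10 = 0" using eq[of 1 1 0] b0 b1 b3 by (simp add: algebra_simps)
  have e2: "b9 - b6 + b10 = 0" using eq[of "-1" 1 0] b0 b1 b3 by (simp add: algebra_simps)
  have e3: "b8 - b7 + b10 = 0" using eq[of 1 0 1] b0 b1 b4 by (simp add: algebra_simps)
  have "2 * b10 = 0" using e1 e2 by algebra
  then have b10: "b10 = 0" by simp
  show "b (edge r q) = b (edge p q)" "b (edge s q) = b (edge p q)"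
    using b3 b4 by (simp_all add: b3_def b4_def b5_def)
  show "b (edge r p + edge r q) = b (edge s p + edge r q)" using e1 b10 by (simp add: b6_def b9_def)
  show "b (edge s p + edge s q) = b (edge r p + edge s q)" using e3 b10 by (simp add: b7_def b8_def)
  show "b (edge r p + edge s p + edge p q) = 0" using b10 by (simp add: b10_def)
qed

lemma ex_labelling2:
  assumes "i \<noteq> (j :: 4)"
  obtains p q where "distinct [i, j, p, q]" "UNIV - {i, j} = {p, q}"
proof -
  have "card (UNIV - {i, j}) = 2" using assms by (subst card_Diff_subset) auto
  then obtain p q where pq: "UNIV - {i, j} = {p, q}" "p \<noteq> q" by (auto simp: card_2_iff)
  then have "i \<notin> {p, q}" "j \<notin> {p, q}" by blast+
  then show ?thesis using that[of p q] pq assms by auto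
qed

lemma ex_labelling3:
  assumes "distinct [i, j, k :: 4]"
  obtains l where "distinct [i, j, k, l]"
proof -
  have "i \<noteq> j" using assms by simp
  then obtain p q where "distinct [i, j, p, q]" "UNIV - {i, j} = {p, q}" by (rule ex_labelling2)
  moreover from this have "k = p \<or> k = q" using assms by auto
  ultimately show ?thesis using that[of p] that[of q] by auto
qed

lemma edges_gdig: "edges 0 = 0" "E \<in> gdig1 \<Longrightarrow> edges E = 1" "E \<in> gdig2_G \<union> gdig2_H \<Longrightarrow> edges E = 2"
  "E \<in> gdig3 \<Longrightarrow> edges E = 3"
proof -
  show "edges 0 = 0" by (simp add: edges_def ind_def)
  show "edges E = 1" if E: "E \<in> gdig1"
  proof -
    obtain i j where "E = edge i j" using E unfolding gdig1_def by auto
    then show ?thesis by (simp add: edges_arc)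
  qed
  show "edges E = 2" if E: "E \<in> gdig2_G \<union> gdig2_H"
  proof -
    obtain i a j b where "E = edge i a + edge j b" using E unfolding gdig2_G_def gdig2_H_def by blast
    then show ?thesis by (simp add: edges_add edges_arc)
  qed
  show "edges E = 3" if E: "E \<in> gdig3"
  proof -
    obtain i a j b where "E = edge i a + edge j a + edge a b" using E unfolding gdig3_def by blast
    then show ?thesis by (simp add: edges_add edges_arc)
  qed
qed

lemma ordered_pairs_antisym: "(a, b) \<in> ordered_pairs \<Longrightarrow> (b, a) \<notin> ordered_pairs"
proof -
  have "(x, y) \<in> ordered_pairs \<longrightarrow> (y, x) \<notin> ordered_pairs" if "x \<in> {1, 2, 3, 4}" "y \<in> {1, 2, 3, 4}" for x y
    using that unfolding ordered_pairs_def by (elim insertE emptyE; hypsubst; simp)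
  then show "(a, b) \<in> ordered_pairs \<Longrightarrow> (b, a) \<notin> ordered_pairs" using UNIV_4 by blast
qed

lemma ordered_pairs_total: "a \<noteq> b \<Longrightarrow> (a, b) \<in> ordered_pairs \<or> (b, a) \<in> ordered_pairs"
  using exhaust_4[of a] exhaust_4[of b] by (auto simp: ordered_pairs_def)

lemma arc_in_gdig:
  assumes "edge i j \<in> gdig"
  shows "(i, j) \<in> {(2, 1), (3, 1), (1, 2), (3, 2), (1, 3), (2, 3), (1, 4), (2, 4)}"
proof -
  have "edge i j \<noteq> 0" using edges_gdig(1) edges_arc[of i j] by auto
  moreover have "edge i j \<notin> gdig2_G \<union> gdig2_H" "edge i j \<notin> gdig3"
    using edges_gdig(3,4)[of "edge i j"] by (auto simp: edges_arc)
  ultimately have "edge i j \<in> gdig1" using assms unfolding gdig_def by blast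
  then obtain x where x: "x \<in> {(2, 1), (3, 1), (1, 2), (3, 2), (1, 3), (2, 3), (1, 4), (2, 4)}" "edge i j = (\<lambda>(i, j). edge i j) x"
    unfolding gdig1_def by (rule imageE)
  from x(2) have "x = (i, j)" by (simp add: case_prod_beta arc_inject prod_eq_iff)
  with x(1) show ?thesis by simp
qed

lemma matching_in_gdigD:
  assumes m: "edge r p + edge s q \<in> gdig" and d: "distinct [p, q, r, s]"
  shows "(r, s) \<in> ordered_pairs \<and> (p, q) \<in> ordered_pairs \<or> (s, r) \<in> ordered_pairs \<and> (q, p) \<in> ordered_pairs"
proof -
  have "edges (edge r p + edge s q) = 2" by (simp add: edges_add edges_arc)
  then have "edge r p + edge s q \<in> gdig2_G \<union> gdig2_H"
    using m edges_gdig(1) edges_gdig(2-4)[of "edge r p + edge s q"] unfolding gdig_def by auto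
  moreover have "edge r p + edge s q \<notin> gdig2_G"
  proof
    assume "edge r p + edge s q \<in> gdig2_G"
    then obtain i a b where eq: "edge r p + edge s q = edge i a + edge i b" by (auto simp: gdig2_G_def)
    then have "outd (edge r p + edge s q) i = outd (edge i a + edge i b) i" by simp
    then show False using d by (auto simp: outd_add outd_arc split: if_splits)
  qed
  ultimately obtain a b a' b' where h: "edge r p + edge s q = edge a a' + edge b b'"
      "(a, b) \<in> ordered_pairs" "(a', b') \<in> ordered_pairs"
    by (auto simp: gdig2_H_def)
  have "(edge a a' + edge b b') r p = (edge r p + edge s q) r p" using h by simp
  then have "r = a \<and> p = a' \<or> r = b \<and> p = b'" by (auto simp: edge_def split: if_splits)
  then show ?thesis
  proof
    assume "r = a \<and> p = a'"
    then have "edge s q = edge b b'" using h(1) by simp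
    then show ?thesis using h \<open>r = a \<and> p = a'\<close> by (simp add: arc_inject)
  next
    assume "r = b \<and> p = b'"
    then have "edge s q + edge r p = edge a a' + edge r p" using h(1) by (simp add: add.commute)
    then have "edge s q = edge a a'" by simp
    then show ?thesis using h \<open>r = b \<and> p = b'\<close> by (simp add: arc_inject)
  qed
qed

text \<open>All edges with the same head have equal coefficients, and one of them is not a
  generator. Likewise a fork shares its coefficient with both matchings of the same two heads from
  its tail and the fourth vertex, and one of these matchings is not a generator.\<close>

theorem gdig_independent:
  assumes sum: "(\<lambda>z. \<Sum>E\<in>gdig. a E * rel_mono 1 E z) \<in> A4_plus_W4"
  shows "\<forall>E\<in>gdig. a E = 0"
proof
  fix E assume E: "E \<in> gdig"
  define b where "b E = (if E \<in> gdig then a E else 0)" for E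
  note co = gdig_coefficients[OF sum, folded b_def]
  have arcs: "b (edge i j) = b (edge k j)" if ijk: "distinct [i, j, k]" for i j k
  proof -
    obtain l where "distinct [i, j, k, l]" using ex_labelling3[OF ijk] by blast
    then show ?thesis using co(2)[of k j i l] by auto
  qed
  have non: "b (edge 4 1) = 0" "b (edge 4 2) = 0" "b (edge 4 3) = 0" "b (edge 3 4) = 0"
    using arc_in_gdig[of 4 1] arc_in_gdig[of 4 2] arc_in_gdig[of 4 3] arc_in_gdig[of 3 4] by (auto simp: b_def)
  have two: "b (edge r p + edge r q) = 0" "b (edge r p + edge s q) = 0" if d: "distinct [p, q, r, s]" for p q r s
  proof -
    have d': "distinct [q, p, r, s]" using d by auto
    have eqs: "b (edge r p + edge r q) = b (edge s p + edge r q)" "b (edge r p + edge r q) = b (edge r p + edge s q)"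
      using co(4)[OF d] co(4)[OF d'] by (simp_all add: add.commute)
    have "edge r p + edge s q \<notin> gdig \<or> edge s p + edge r q \<notin> gdig"
      using matching_in_gdigD[of r p s q] matching_in_gdigD[of s p r q] ordered_pairs_antisym d by auto
    then show "b (edge r p + edge r q) = 0" "b (edge r p + edge s q) = 0" using eqs by (auto simp: b_def)
  qed
  have "b E = 0"
    using E
  proof (cases rule: gdig_cases)
    case 1
    then show ?thesis using co(1)[of 1 2 3 4] by simp
  next
    case (2 i j)
    have "b (edge i j) = 0"
    proof -
      obtain i0 where i0: "b (edge i0 j) = 0" "i0 \<noteq> j" using exhaust_4[of j] non by auto
      then show ?thesis using arcs[of i j i0] 2 by (cases "i = i0") auto
    qed
    then show ?thesis using 2 by simp
  next
    case (3 i x y)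
    then obtain l where "distinct [i, x, y, l]" using ex_labelling3 by blast
    then show ?thesis using two(1)[of x y i l] 3 by auto
  next
    case (4 i j x y)
    then show ?thesis using two(2)[of x y i j] by auto
  next
    case (5 i j x y)
    then show ?thesis using co(6)[of x y i j] by auto
  qed
  then show "a E = 0" using E by (simp add: b_def)
qed

section \<open>The explicit invariants as monomials of graphs\<close>

lemma d_off_M4: "z \<notin> M4 \<Longrightarrow> d i z = 0"
  by (simp add: d_def D_off_M4)

lemma rel_mono_eval:
  assumes z: "z \<in> M4" and d: "distinct [p, q, r, s]"
  shows "rel_mono 1 E z = d p z ^ nat (1 + int (outd E p) - int (ind E p)) * d q z ^ nat (1 + int (outd E q) - int (ind E q))
    * d r z ^ nat (1 + int (outd E r) - int (ind E r)) * d s z ^ nat (1 + int (outd E s) - int (ind E s)) * dC_monom 0 E z"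
proof -
  have pl: "prod f UNIV = f p * f q * f r * f s" for f :: "4 \<Rightarrow> complex"
    using d unfolding UNIV_labelling[OF d] by (simp add: mult.assoc)
  have e: "nat (int (outd E i) - (int (ind E i) - int 1)) = nat (1 + int (outd E i) - int (ind E i))" for i
    by (simp add: algebra_simps)
  show ?thesis
    using z unfolding rel_mono_def mono_at_def dC_monom_def on_M4_def e pl[of "\<lambda>i. d i z ^ _ i"] by simp
qed

lemma fun_power_apply: "(f ^ n) z = f z ^ n" for f :: "'a \<Rightarrow> complex"
  by (induction n) simp_all

lemma dC_monom_arcs: "dC_monom 0 (E + F) = dC_monom 0 E * dC_monom 0 F"
  by (simp add: dC_monom_mult)

lemma F_inv_eq:
  assumes "i \<noteq> j"
  shows "F_inv i j = rel_mono 1 (edge i j)"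
proof
  fix z
  obtain p q where pq: "distinct [i, j, p, q]" "UNIV - {i, j} = {p, q}" using ex_labelling2[OF assms] by blast
  show "F_inv i j z = rel_mono 1 (edge i j) z"
  proof (cases "z \<in> M4")
    case True
    show ?thesis unfolding rel_mono_eval[OF True pq(1)] F_inv_def pq(2)
      using pq(1) by (auto simp: outd_arc ind_arc dC_monom_C fun_power_apply)
  qed (simp add: F_inv_def fun_power_apply d_off_M4 rel_mono_def mono_at_def dC_monom_off_M4)
qed

lemma G_inv_eq:
  assumes d: "distinct [i, r, p, q]"
  shows "G_inv i r = rel_mono 1 (edge i p + edge i q)"
proof
  fix z
  have pq: "UNIV - {i, r} = {p, q}" using UNIV_labelling[OF d] d by auto
  show "G_inv i r z = rel_mono 1 (edge i p + edge i q) z"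
  proof (cases "z \<in> M4")
    case True
    show ?thesis unfolding rel_mono_eval[OF True d] G_inv_def pq
      using d by (auto simp: outd_arc ind_arc outd_add ind_add dC_monom_C dC_monom_arcs fun_power_apply)
  qed (simp add: G_inv_def fun_power_apply d_off_M4 rel_mono_def mono_at_def dC_monom_off_M4)
qed

lemma H_inv_eq:
  assumes d: "distinct [a, b, p, q]"
  shows "H_inv a b p q = rel_mono 1 (edge a p + edge b q)"
proof
  fix z
  show "H_inv a b p q z = rel_mono 1 (edge a p + edge b q) z"
  proof (cases "z \<in> M4")
    case True
    show ?thesis unfolding rel_mono_eval[OF True d] H_inv_def
      using d by (auto simp: outd_arc ind_arc outd_add ind_add dC_monom_C dC_monom_arcs fun_power_apply)
  qed (simp add: H_inv_def fun_power_apply d_off_M4 rel_mono_def mono_at_def dC_monom_off_M4)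
qed

lemma K_inv_eq:
  assumes d: "distinct [a, b, p, q]"
  shows "K_inv a b p q = rel_mono 1 (edge a p + edge b p + edge p q)"
proof
  fix z
  show "K_inv a b p q z = rel_mono 1 (edge a p + edge b p + edge p q) z"
  proof (cases "z \<in> M4")
    case True
    show ?thesis unfolding rel_mono_eval[OF True d] K_inv_def
      using d by (auto simp: outd_arc ind_arc outd_add ind_add dC_monom_C dC_monom_arcs fun_power_apply)
  qed (simp add: K_inv_def fun_power_apply d_off_M4 rel_mono_def mono_at_def dC_monom_off_M4)
qed

lemma ordered_pair_labelling:
  assumes "(a, b) \<in> ordered_pairs" "{p, q} = UNIV - {a, b}"
  shows "distinct [a, b, p, q]"
proof -
  have "a \<noteq> b" using assms(1) by (auto simp: ordered_pairs_def)
  then obtain p' q' where pq: "distinct [a, b, p', q']" "UNIV - {a, b} = {p', q'}" by (rule ex_labelling2)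
  then have "{p, q} = {p', q'}" using assms(2) by simp
  then show ?thesis using pq(1) by (auto simp: doubleton_eq_iff)
qed

text \<open>The minus signs in \<open>d 2\<close> and \<open>d 4\<close> cancel in the
  product.\<close>

lemma gens0_eq: "gens0 = rel_mono 1 ` {0}"
proof -
  have "(D 1 2 3 * D 1 2 4 * D 1 3 4 * D 2 3 4) z = rel_mono 1 0 z" for z
  proof (cases "z \<in> M4")
    case True
    have d: "distinct [1, 2, 3, 4 :: 4]" by simp
    have "dC_monom 0 0 z = 1" using True by (simp add: dC_monom_def on_M4_def)
    then show ?thesis unfolding rel_mono_eval[OF True d] by (simp add: outd_def ind_def d_simps)
  qed (simp add: D_off_M4 rel_mono_def mono_at_def dC_monom_off_M4)
  then show ?thesis by (simp add: gens0_def fun_eq_iff del: times_fun_apply)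
qed

lemma gens1_eq: "gens1 = rel_mono 1 ` gdig1"
  unfolding gens1_def gdig1_def by (simp add: F_inv_eq)

lemma gens2_G_eq: "gens2_G = rel_mono 1 ` gdig2_G"
proof
  show "gens2_G \<subseteq> rel_mono 1 ` gdig2_G"
  proof
    fix f assume "f \<in> gens2_G"
    then obtain i r where f: "f = G_inv i r" "i \<noteq> r" by (auto simp: gens2_G_def)
    obtain p q where pq: "distinct [i, r, p, q]" using ex_labelling2[OF f(2)] by blast
    then have "edge i p + edge i q \<in> gdig2_G" by (auto simp: gdig2_G_def)
    then show "f \<in> rel_mono 1 ` gdig2_G" unfolding f(1) G_inv_eq[OF pq] by blast
  qed
  show "rel_mono 1 ` gdig2_G \<subseteq> gens2_G"
  proof safe
    fix E assume "E \<in> gdig2_G"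
    then obtain i p q where E: "E = edge i p + edge i q" "distinct [i, p, q]" by (auto simp: gdig2_G_def)
    obtain r where "distinct [i, p, q, r]" using ex_labelling3[OF E(2)] by blast
    then have "distinct [i, r, p, q]" by auto
    then have "rel_mono 1 E = G_inv i r" "i \<noteq> r" unfolding E(1) by (auto simp: G_inv_eq)
    then show "rel_mono 1 E \<in> gens2_G" by (auto simp: gens2_G_def)
  qed
qed

lemma gens2_H_eq: "gens2_H = rel_mono 1 ` gdig2_H"
proof -
  have eq: "H_inv a b p q = rel_mono 1 (edge a p + edge b q)"
    if "(a, b) \<in> ordered_pairs" "{p, q} = UNIV - {a, b}" for a b p q
    by (rule H_inv_eq[OF ordered_pair_labelling[OF that]])
  show ?thesis
  proof
    show "gens2_H \<subseteq> rel_mono 1 ` gdig2_H"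
    proof
      fix f assume "f \<in> gens2_H"
      then obtain a b p q where "f = H_inv a b p q" "(a, b) \<in> ordered_pairs" "(p, q) \<in> ordered_pairs" "{p, q} = UNIV - {a, b}"
        by (auto simp: gens2_H_def)
      then show "f \<in> rel_mono 1 ` gdig2_H" using eq unfolding gdig2_H_def by blast
    qed
    show "rel_mono 1 ` gdig2_H \<subseteq> gens2_H"
    proof safe
      fix E assume "E \<in> gdig2_H"
      then obtain a b p q where "E = edge a p + edge b q" "(a, b) \<in> ordered_pairs" "(p, q) \<in> ordered_pairs" "{p, q} = UNIV - {a, b}"
        by (auto simp: gdig2_H_def)
      then show "rel_mono 1 E \<in> gens2_H" using eq[symmetric] unfolding gens2_H_def by blast
    qed
  qed
qed

lemma gens3_eq: "gens3 = rel_mono 1 ` gdig3"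
proof -
  have eq: "K_inv a b p q = rel_mono 1 (edge a p + edge b p + edge p q)"
    if "(a, b) \<in> ordered_pairs" "{p, q} = UNIV - {a, b}" for a b p q
    by (rule K_inv_eq[OF ordered_pair_labelling[OF that]])
  show ?thesis
  proof
    show "gens3 \<subseteq> rel_mono 1 ` gdig3"
    proof
      fix f assume "f \<in> gens3"
      then obtain a b p q where "f = K_inv a b p q" "(a, b) \<in> ordered_pairs" "{p, q} = UNIV - {a, b}"
        by (auto simp: gens3_def)
      then show "f \<in> rel_mono 1 ` gdig3" using eq unfolding gdig3_def by blast
    qed
    show "rel_mono 1 ` gdig3 \<subseteq> gens3"
    proof safe
      fix E assume "E \<in> gdig3"
      then obtain a b p q where "E = edge a p + edge b p + edge p q" "(a, b) \<in> ordered_pairs" "{p, q} = UNIV - {a, b}"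
        by (auto simp: gdig3_def)
      then show "rel_mono 1 E \<in> gens3" using eq[symmetric] unfolding gens3_def by blast
    qed
  qed
qed

section \<open>Numbers of generators in each degree\<close>

lemma card_distinct_pairs: "card {(i, j :: 4). i \<noteq> j} = 12"
proof -
  have "{(i, j :: 4). i \<noteq> j} = (SIGMA i:UNIV. UNIV - {i})" by auto
  then show ?thesis by (simp add: card_SigmaI)
qed

lemma card_gdig1: "card gdig1 = 8"
  unfolding gdig1_def by (subst card_image) (auto simp: inj_on_def arc_inject)

text \<open>As in \<open>G_inv\<close>, a fork is indexed by its tail and the vertex that it misses;
  both can be recovered from the degrees.\<close>

lemma card_gdig2_G: "card gdig2_G = 12"
proof -
  define h where "h E = (THE (i, r). outd E i = 2 \<and> i \<noteq> r \<and> ind E r = 0)" for E :: digraph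
  define g where "g = (\<lambda>(i, r). \<Sum>p\<in>UNIV - {i, r}. edge i p)"
  have g: "g (i, r) = edge i p + edge i q" if "distinct [i, r, p, q]" for i r p q
  proof -
    have "UNIV - {i, r} = {p, q}" using UNIV_labelling[OF that] that by auto
    then show ?thesis using that by (simp add: g_def)
  qed
  have "gdig2_G = g ` {(i, j). i \<noteq> j}"
  proof
    show "gdig2_G \<subseteq> g ` {(i, j). i \<noteq> j}"
    proof
      fix E assume "E \<in> gdig2_G"
      then obtain i p q where E: "E = edge i p + edge i q" "distinct [i, p, q]" by (auto simp: gdig2_G_def)
      obtain r where "distinct [i, p, q, r]" using ex_labelling3[OF E(2)] by blast
      then have "E = g (i, r)" "i \<noteq> r" using g[of i r p q] E by auto
      then show "E \<in> g ` {(i, j). i \<noteq> j}" by blast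
    qed
    show "g ` {(i, j). i \<noteq> j} \<subseteq> gdig2_G"
    proof safe
      fix i r :: 4 assume "i \<noteq> r"
      then obtain p q where pq: "distinct [i, r, p, q]" by (rule ex_labelling2)
      then show "g (i, r) \<in> gdig2_G" unfolding g[OF pq] by (auto simp: gdig2_G_def)
    qed
  qed
  moreover have "inj_on g {(i, j). i \<noteq> j}"
  proof (rule inj_onI, clarify)
    fix i r i' r' :: 4 assume ne: "i \<noteq> r" "i' \<noteq> r'" and eq: "g (i, r) = g (i', r')"
    obtain p q where pq: "distinct [i, r, p, q]" using ne(1) by (rule ex_labelling2)
    obtain p' q' where pq': "distinct [i', r', p', q']" using ne(2) by (rule ex_labelling2)
    have e: "edge i p + edge i q = edge i' p' + edge i' q'" using eq g[OF pq] g[OF pq'] by simp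
    have "outd (edge i p + edge i q) i = outd (edge i' p' + edge i' q') i" by (simp only: e)
    then have i: "i = i'" by (simp add: outd_add outd_arc split: if_splits)
    have "ind (edge i p + edge i q) r = ind (edge i' p' + edge i' q') r" by (simp only: e)
    then have "r \<noteq> p'" "r \<noteq> q'" using pq by (auto simp: ind_add ind_arc split: if_splits)
    then show "i = i' \<and> r = r'" using i ne UNIV_labelling[OF pq'] by auto
  qed
  ultimately show ?thesis using card_image card_distinct_pairs by metis
qed

text \<open>The ordered pair of tails determines the ordered pair of heads, so the graphs are
  indexed by \<open>ordered_pairs\<close>; the order rules out a coincidence with the tails
  interchanged.\<close>

lemma card_gdig2_H: "card gdig2_H = 6"
proof -
  let ?R = "\<lambda>a b p q. (p, q) \<in> ordered_pairs \<and> {p, q} = UNIV - {a, b}"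
  have "\<exists>p q. ?R a b p q" if "(a, b) \<in> ordered_pairs" for a b
  proof -
    have "a \<noteq> b" using that ordered_pairs_antisym by blast
    then obtain p q where pq: "distinct [a, b, p, q]" "UNIV - {a, b} = {p, q}" by (rule ex_labelling2)
    then have "p \<noteq> q" by simp
    then show ?thesis using ordered_pairs_total[of p q] pq(2) by (metis insert_commute)
  qed
  then have "\<forall>x\<in>ordered_pairs. \<exists>y. ?R (fst x) (snd x) (fst y) (snd y)" by auto
  then obtain Y where Y: "\<forall>x\<in>ordered_pairs. ?R (fst x) (snd x) (fst (Y x)) (snd (Y x))" by (rule bchoice[THEN exE])
  define P Q where "P a b = fst (Y (a, b))" and "Q a b = snd (Y (a, b))" for a b
  have PQ: "?R a b (P a b) (Q a b)" if "(a, b) \<in> ordered_pairs" for a b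
    using bspec[OF Y that] by (simp add: P_def Q_def)
  have uniq: "p = P a b \<and> q = Q a b" if "(a, b) \<in> ordered_pairs" "?R a b p q" for a b p q
  proof -
    have "{p, q} = {P a b, Q a b}" using that PQ[OF that(1)] by simp
    then have "p = P a b \<and> q = Q a b \<or> p = Q a b \<and> q = P a b" unfolding doubleton_eq_iff .
    then show ?thesis using that(2) PQ[OF that(1)] ordered_pairs_antisym by blast
  qed
  define g where "g = (\<lambda>(a, b). edge a (P a b) + edge b (Q a b))"
  have "gdig2_H = g ` ordered_pairs"
  proof
    show "gdig2_H \<subseteq> g ` ordered_pairs"
    proof
      fix E assume "E \<in> gdig2_H"
      then obtain a b p q where E: "E = edge a p + edge b q" "(a, b) \<in> ordered_pairs" "?R a b p q"
        unfolding gdig2_H_def by blast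
      then have "E = g (a, b)" using uniq[OF E(2,3)] by (simp add: g_def)
      then show "E \<in> g ` ordered_pairs" using E(2) by blast
    qed
    show "g ` ordered_pairs \<subseteq> gdig2_H"
    proof (rule image_subsetI)
      fix x assume x: "x \<in> ordered_pairs"
      obtain a b where ab: "x = (a, b)" by (cases x)
      then have "?R a b (P a b) (Q a b)" using PQ x by blast
      then show "g x \<in> gdig2_H" using x unfolding ab g_def gdig2_H_def case_prod_conv by blast
    qed
  qed
  moreover have "inj_on g ordered_pairs"
  proof (rule inj_onI)
    fix x x' assume x: "x \<in> ordered_pairs" "x' \<in> ordered_pairs" and eq: "g x = g x'"
    obtain a b a' b' where ab: "x = (a, b)" "x' = (a', b')" by (cases x, cases x')
    note o = x[unfolded ab]
    have e: "edge a (P a b) + edge b (Q a b) = edge a' (P a' b') + edge b' (Q a' b')" using eq by (simp add: g_def ab)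
    have "(edge a' (P a' b') + edge b' (Q a' b')) a (P a b) = (edge a (P a b) + edge b (Q a b)) a (P a b)" using e by simp
    then have "a = a' \<and> P a b = P a' b' \<or> a = b' \<and> P a b = Q a' b'" by (auto simp: edge_def split: if_splits)
    then show "x = x'"
    proof
      assume a: "a = a' \<and> P a b = P a' b'"
      have a1: "a = a'" and a2: "P a b = P a' b'" using a by blast+
      have "edge a' (P a' b') = edge a (P a b)" by (subst a2) (simp add: a1)
      with e have "edge a (P a b) + edge b (Q a b) = edge a (P a b) + edge b' (Q a' b')" by (simp only:)
      then have "edge b (Q a b) = edge b' (Q a' b')" by (rule add_left_imp_eq)
      then show ?thesis using a by (simp add: ab arc_inject)
    next
      assume a: "a = b' \<and> P a b = Q a' b'"
      then have a1: "a = b'" and a2: "P a b = Q a' b'" by blast+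
      have "edge b' (Q a' b') = edge a (P a b)" by (subst a2) (simp add: a1)
      with e have "edge a (P a b) + edge b (Q a b) = edge a (P a b) + edge a' (P a' b')" by (simp only: add.commute)
      then have "edge b (Q a b) = edge a' (P a' b')" by (rule add_left_imp_eq)
      then have "b = a'" by (simp add: arc_inject)
      then show ?thesis using a o ordered_pairs_antisym by blast
    qed
  qed
  moreover have "card ordered_pairs = 6" by (simp add: ordered_pairs_def)
  ultimately show ?thesis using card_image by metis
qed

text \<open>The pair (p, q) is recovered from the in-degrees: 2 at \<open>p\<close> and 1 at
  \<open>q\<close>.\<close>

lemma card_gdig3: "card gdig3 = 12"
proof -
  define g where "g = (\<lambda>(p, q). (\<Sum>a\<in>UNIV - {p, q}. edge a p) + edge p q)"
  have g: "g (p, q) = edge a p + edge b p + edge p q" if "distinct [a, b, p, q]" for a b p q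
  proof -
    have "UNIV - {p, q} = {a, b}" using UNIV_labelling[OF that] that by auto
    then show ?thesis using that by (simp add: g_def)
  qed
  have "gdig3 = g ` {(i, j). i \<noteq> j}"
  proof
    show "gdig3 \<subseteq> g ` {(i, j). i \<noteq> j}"
    proof
      fix E assume "E \<in> gdig3"
      then obtain a b p q where E: "E = edge a p + edge b p + edge p q" "(a, b) \<in> ordered_pairs" "{p, q} = UNIV - {a, b}"
        by (auto simp: gdig3_def)
      have d: "distinct [a, b, p, q]" by (rule ordered_pair_labelling[OF E(2,3)])
      then have "E = g (p, q)" "p \<noteq> q" using g[OF d] E by auto
      then show "E \<in> g ` {(i, j). i \<noteq> j}" by blast
    qed
    show "g ` {(i, j). i \<noteq> j} \<subseteq> gdig3"
    proof safe
      fix p q :: 4 assume "p \<noteq> q"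
      then obtain a b where ab: "distinct [p, q, a, b]" "UNIV - {p, q} = {a, b}" by (rule ex_labelling2)
      then have d: "distinct [a, b, p, q]" "distinct [b, a, p, q]" and c: "{p, q} = UNIV - {a, b}" "{p, q} = UNIV - {b, a}"
        using UNIV_labelling[OF ab(1)] by auto
      have "(a, b) \<in> ordered_pairs \<or> (b, a) \<in> ordered_pairs" using ordered_pairs_total d(1) by auto
      then show "g (p, q) \<in> gdig3"
      proof
        assume "(a, b) \<in> ordered_pairs"
        then show ?thesis unfolding g[OF d(1)] gdig3_def using c by blast
      next
        assume "(b, a) \<in> ordered_pairs"
        then show ?thesis unfolding g[OF d(2)] gdig3_def using c by blast
      qed
    qed
  qed
  moreover have "inj_on g {(i, j). i \<noteq> j}"
  proof (rule inj_onI, clarify)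
    fix p q p' q' :: 4 assume ne: "p \<noteq> q" "p' \<noteq> q'" and eq: "g (p, q) = g (p', q')"
    obtain a b where ab: "distinct [p, q, a, b]" using ne(1) by (rule ex_labelling2)
    obtain a' b' where ab': "distinct [p', q', a', b']" using ne(2) by (rule ex_labelling2)
    have e: "edge a p + edge b p + edge p q = edge a' p' + edge b' p' + edge p' q'"
      using eq g[of a b p q] g[of a' b' p' q'] ab ab' by auto
    have "ind (edge a p + edge b p + edge p q) p = ind (edge a' p' + edge b' p' + edge p' q') p"
      "ind (edge a p + edge b p + edge p q) q = ind (edge a' p' + edge b' p' + edge p' q') q" by (simp_all only: e)
    then show "p = p' \<and> q = q'" using ne by (auto simp: ind_add ind_arc split: if_splits)
  qed
  ultimately show ?thesis using card_image card_distinct_pairs by metis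
qed

section \<open>The quotient and the generating systems\<close>

lemma coset_of_eq_iff: "coset_of f = coset_of g \<longleftrightarrow> f - g \<in> A4_plus_W4"
  by (simp add: cosets.abs_eq_iff coset_rel_def)

lemma coset_of_zero: "coset_of 0 = 0"
  by (simp add: zero_cosets.abs_eq)

lemma coset_of_eq_0_iff: "coset_of f = 0 \<longleftrightarrow> f \<in> A4_plus_W4"
  using coset_of_eq_iff[of f 0] by (simp add: coset_of_zero)

lemma coset_of_add: "coset_of (f + g) = coset_of f + coset_of g"
  by (simp add: plus_cosets.abs_eq)

lemma coset_of_scale: "coset_of (cscale a f) = qscale a (coset_of f)"
  by (simp add: qscale.abs_eq)

lemma coset_of_sum: "coset_of (\<Sum>i\<in>I. f i) = (\<Sum>i\<in>I. coset_of (f i))"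
  by (induction I rule: infinite_finite_induct)
    (simp_all only: sum.infinite sum.empty sum.insert coset_of_zero coset_of_add simp_thms)

lemma coset_of_span: "f \<in> cfun.span S \<Longrightarrow> coset_of f \<in> quot.span (coset_of ` S)"
proof -
  have "cfun.span S \<subseteq> {f. coset_of f \<in> quot.span (coset_of ` S)}"
    by (rule cfun.span_minimal)
      (auto intro!: cfun.subspaceI intro: quot.span_base quot.span_zero quot.span_add quot.span_scale
        simp: coset_of_zero coset_of_add coset_of_scale)
  then show "f \<in> cfun.span S \<Longrightarrow> coset_of f \<in> quot.span (coset_of ` S)" by blast
qed

definition gcoset :: "digraph \<Rightarrow> cosets"
  where "gcoset E = coset_of (rel_mono 1 E)"

lemma gcoset_relation:
  assumes S: "S \<subseteq> gdig" and sum: "(\<Sum>E\<in>S. qscale (a E) (gcoset E)) = 0" and E: "E \<in> S"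
  shows "a E = 0"
proof -
  define b where "b E = (if E \<in> S then a E else 0)" for E
  have "coset_of (\<Sum>E\<in>S. cscale (a E) (rel_mono 1 E)) = 0"
    using sum by (simp add: coset_of_sum coset_of_scale gcoset_def)
  moreover have "(\<Sum>E\<in>S. cscale (a E) (rel_mono 1 E)) = (\<lambda>z. \<Sum>E\<in>gdig. b E * rel_mono 1 E z)"
  proof
    fix z
    have "(\<Sum>E\<in>gdig. b E * rel_mono 1 E z) = (\<Sum>E\<in>S. b E * rel_mono 1 E z)"
      using S by (intro sum.mono_neutral_right finite_gdig) (auto simp: b_def)
    also have "\<dots> = (\<Sum>E\<in>S. a E * rel_mono 1 E z)" by (rule sum.cong) (auto simp: b_def)
    finally show "(\<Sum>E\<in>S. cscale (a E) (rel_mono 1 E)) z = (\<Sum>E\<in>gdig. b E * rel_mono 1 E z)"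
      by (simp add: sum_fun_apply cscale_def)
  qed
  ultimately have "(\<lambda>z. \<Sum>E\<in>gdig. b E * rel_mono 1 E z) \<in> A4_plus_W4" by (simp add: coset_of_eq_0_iff)
  then have "b E = 0" using gdig_independent[of b] E S by blast
  then show ?thesis using E by (simp add: b_def)
qed

lemma inj_on_gcoset: "inj_on gcoset gdig"
proof (rule inj_onI, rule ccontr)
  fix E F assume EF: "E \<in> gdig" "F \<in> gdig" "gcoset E = gcoset F" "E \<noteq> F"
  define a where "a G = (if G = E then 1 else -1 :: complex)" for G
  have "(\<Sum>G\<in>{E, F}. qscale (a G) (gcoset G)) = 0"
    using EF by (simp add: a_def quot.scale_minus_left)
  then have "a E = 0" using gcoset_relation[of "{E, F}" a E] EF by simp
  then show False by (simp add: a_def)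
qed

lemma inj_on_rel_mono: "inj_on (rel_mono 1) gdig"
  using inj_on_gcoset by (auto simp: inj_on_def gcoset_def)

lemma independent_gcoset:
  assumes "S \<subseteq> gdig"
  shows "quot.independent (gcoset ` S)"
proof (rule quot.independent_if_scalars_zero)
  have fin: "finite S" using assms finite_gdig by (rule finite_subset)
  then show "finite (gcoset ` S)" by simp
  have inj: "inj_on gcoset S" using inj_on_gcoset assms by (rule inj_on_subset)
  fix f x assume sum: "(\<Sum>x\<in>gcoset ` S. qscale (f x) x) = 0" and x: "x \<in> gcoset ` S"
  have "(\<Sum>E\<in>S. qscale (f (gcoset E)) (gcoset E)) = 0" using sum by (simp add: sum.reindex[OF inj])
  then show "f x = 0" using gcoset_relation[OF assms, of "\<lambda>E. f (gcoset E)"] x by auto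
qed

lemma W4_deg_reduce: "W4_deg k \<subseteq> cfun.span (rel_mono 1 ` ({E \<in> gdig. edges E = k} \<union> {E. decomposable E \<and> edges E = k}))"
proof -
  have "{E \<in> gdig \<union> {E. decomposable E}. edges E = k} = {E \<in> gdig. edges E = k} \<union> {E. decomposable E \<and> edges E = k}"
    by blast
  then have "rel_mono 1 E \<in> cfun.span (rel_mono 1 ` ({E \<in> gdig. edges E = k} \<union> {E. decomposable E \<and> edges E = k}))"
    if "rel_adm 1 E" "edges E = k" for E
    using span_homogeneous[OF rel_mono_in_gspan[OF that(1), unfolded gspan_def], of k] rel_mono_deg[of 1 E] that(2) by simp
  then show ?thesis
    unfolding W4_deg_eq by (intro cfun.span_minimal cfun.subspace_span) auto
qed

lemma coset_of_mod_decomposable: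
  assumes f: "f \<in> cfun.span (rel_mono 1 ` (S \<union> T))" and T: "\<And>E. E \<in> T \<Longrightarrow> decomposable E"
  shows "coset_of f \<in> quot.span (gcoset ` S)"
proof -
  have "coset_of (rel_mono 1 E) = 0" if "E \<in> T" for E
    using T[OF that] by (auto simp: coset_of_eq_0_iff A4_plus_W4_eq intro: cfun.span_base)
  then have "coset_of ` rel_mono 1 ` (S \<union> T) \<subseteq> quot.span (gcoset ` S)"
    by (auto simp: quot.span_zero quot.span_base simp flip: gcoset_def)
  then show ?thesis
    using coset_of_span[OF f] quot.span_minimal[OF _ quot.subspace_span] by blast
qed

lemma Q4_deg_span: "quot.span (gcoset ` {E \<in> gdig. edges E = k}) = quot.span (Q4_deg k)"
proof
  show "quot.span (gcoset ` {E \<in> gdig. edges E = k}) \<subseteq> quot.span (Q4_deg k)"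
    unfolding Q4_deg_def gcoset_def using rel_mono_W4 gdig_adm by (intro quot.span_mono) auto
  have "coset_of f \<in> quot.span (gcoset ` {E \<in> gdig. edges E = k})" if "f \<in> W4_deg k" for f
    using that W4_deg_reduce by (intro coset_of_mod_decomposable) auto
  then show "quot.span (Q4_deg k) \<subseteq> quot.span (gcoset ` {E \<in> gdig. edges E = k})"
    unfolding Q4_deg_def by (intro quot.span_minimal quot.subspace_span) auto
qed

lemma Q4_span: "quot.span (gcoset ` gdig) = quot.span Q4"
proof
  show "quot.span (gcoset ` gdig) \<subseteq> quot.span Q4"
    unfolding Q4_def gcoset_def using rel_mono_W4 gdig_adm
    by (intro quot.span_mono) (auto simp: W4_deg_def)
  have "W4 \<subseteq> cfun.span (rel_mono 1 ` (gdig \<union> {E. decomposable E}))"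
    using rel_mono_in_gspan unfolding W4_rel_inv rel_inv_eq gspan_def
    by (intro cfun.span_minimal cfun.subspace_span) auto
  then have "coset_of f \<in> quot.span (gcoset ` gdig)" if "f \<in> W4" for f
    using that by (intro coset_of_mod_decomposable) auto
  then show "quot.span Q4 \<subseteq> quot.span (gcoset ` gdig)"
    unfolding Q4_def by (intro quot.span_minimal quot.subspace_span) auto
qed

lemma gdig_homogeneous: "{E \<in> gdig. edges E = 0} = {0}" "{E \<in> gdig. edges E = 1} = gdig1"
  "{E \<in> gdig. edges E = 2} = gdig2_G \<union> gdig2_H" "{E \<in> gdig. edges E = 3} = gdig3"
  "4 \<le> k \<Longrightarrow> {E \<in> gdig. edges E = k} = {}"
  using edges_gdig by (auto simp: gdig_def)

lemma card_gcoset: "S \<subseteq> gdig \<Longrightarrow> card (gcoset ` S) = card S"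
  using inj_on_gcoset by (intro card_image) (rule inj_on_subset)

lemma dim_Q4_deg: "quot.dim (Q4_deg k) = card {E \<in> gdig. edges E = k}"
proof -
  have sub: "{E \<in> gdig. edges E = k} \<subseteq> gdig" by auto
  show ?thesis
    using quot.dim_eq_card[OF Q4_deg_span independent_gcoset[OF sub]] card_gcoset[OF sub] by simp
qed

lemma dim_Q4: "quot.dim Q4 = card gdig"
  using quot.dim_eq_card[OF Q4_span independent_gcoset[OF subset_refl]] card_gcoset[OF subset_refl] by simp

lemma gdig2_disjoint: "gdig2_G \<inter> gdig2_H = {}"
proof -
  have False if E: "E \<in> gdig2_G" "E \<in> gdig2_H" for E
  proof -
    obtain i p q where G: "E = edge i p + edge i q" using E(1) by (auto simp: gdig2_G_def)
    obtain a b p' q' where H: "E = edge a p' + edge b q'" "(a, b) \<in> ordered_pairs"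
      using E(2) unfolding gdig2_H_def by blast
    have "outd E i = 2" unfolding G by (simp add: outd_add outd_arc)
    then have "a = b" unfolding H(1) by (simp add: outd_add outd_arc split: if_splits)
    then show False using H(2) ordered_pairs_antisym by blast
  qed
  then show ?thesis by blast
qed

lemma finite_gdig_parts: "finite gdig1" "finite gdig2_G" "finite gdig2_H" "finite gdig3"
  using finite_gdig by (simp_all add: gdig_def)

lemma card_gdig2: "card (gdig2_G \<union> gdig2_H) = 18"
  using card_Un_disjoint[OF finite_gdig_parts(2,3) gdig2_disjoint] by (simp add: card_gdig2_G card_gdig2_H)

lemma card_gdig: "card gdig = 39"
proof -
  have disj: "({0} \<union> gdig1) \<inter> (gdig2_G \<union> gdig2_H) = {}" "{0} \<inter> gdig1 = {}"
    "({0} \<union> gdig1 \<union> (gdig2_G \<union> gdig2_H)) \<inter> gdig3 = {}"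
    using edges_gdig by fastforce+
  show ?thesis
    unfolding gdig_def using finite_gdig_parts disj
    by (simp add: card_Un_disjoint card_gdig1 card_gdig2 card_gdig3 del: Un_insert_left Un_insert_right insert_disjoint)
qed

section \<open>Generation and minimality over the absolute invariants\<close>

lemma A4_generated_finite:
  assumes "finite S"
  shows "A4_generated S = {\<Sum>g\<in>S. a g * g | a. \<forall>g\<in>S. a g \<in> A4}"
proof
  show "A4_generated S \<subseteq> {\<Sum>g\<in>S. a g * g | a. \<forall>g\<in>S. a g \<in> A4}"
  proof
    fix f assume "f \<in> A4_generated S"
    then obtain F a where F: "F \<subseteq> S" "\<forall>g\<in>F. a g \<in> A4" "f = (\<Sum>g\<in>F. a g * g)" by (auto simp: A4_generated_def)
    define b where "b g = (if g \<in> F then a g else 0)" for g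
    have "(\<Sum>g\<in>S. b g * g) = (\<Sum>g\<in>F. b g * g)"
      using F by (intro sum.mono_neutral_right assms) (auto simp: b_def)
    also have "\<dots> = f" unfolding F(3) by (rule sum.cong) (auto simp: b_def)
    finally have "f = (\<Sum>g\<in>S. b g * g)" by simp
    moreover have "\<forall>g\<in>S. b g \<in> A4" using F cfun.subspace_0[OF subspace_rel_inv[of 0, folded A4_rel_inv]] by (auto simp: b_def)
    ultimately show "f \<in> {\<Sum>g\<in>S. a g * g | a. \<forall>g\<in>S. a g \<in> A4}" by blast
  qed
qed (use assms in \<open>auto simp: A4_generated_def\<close>)

lemma A4_generatedI:
  assumes "finite S" "\<And>g. g \<in> S \<Longrightarrow> a g \<in> A4"
  shows "(\<Sum>g\<in>S. a g * g) \<in> A4_generated S"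
  unfolding A4_generated_def using assms by (intro CollectI exI[of _ S] exI[of _ a]) auto

lemma A4_generatedE:
  assumes "finite S" "f \<in> A4_generated S"
  obtains a where "f = (\<Sum>g\<in>S. a g * g)" "\<And>g. g \<in> S \<Longrightarrow> a g \<in> A4"
  using assms(2) unfolding A4_generated_finite[OF assms(1)] by auto

lemma subspace_A4_generated:
  assumes fin: "finite S"
  shows "cfun.subspace (A4_generated S)"
proof (rule cfun.subspaceI)
  show "0 \<in> A4_generated S"
    using A4_generatedI[OF fin, of "\<lambda>_. 0"] cfun.subspace_0[OF subspace_rel_inv[of 0, folded A4_rel_inv]] by simp
  fix x y and c :: complex
  assume x: "x \<in> A4_generated S"
  obtain a where a: "x = (\<Sum>g\<in>S. a g * g)" "\<And>g. g \<in> S \<Longrightarrow> a g \<in> A4" by (rule A4_generatedE[OF fin x]) blast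
  have "cscale c x = (\<Sum>g\<in>S. cscale c (a g) * g)"
    unfolding a by (auto simp: fun_eq_iff sum_fun_apply cscale_def sum_distrib_left mult.assoc)
  also have "\<dots> \<in> A4_generated S"
    using a(2) cfun.subspace_scale[OF subspace_rel_inv[of 0, folded A4_rel_inv]] by (intro A4_generatedI fin) blast
  finally show "cscale c x \<in> A4_generated S" .
  assume y: "y \<in> A4_generated S"
  obtain b where b: "y = (\<Sum>g\<in>S. b g * g)" "\<And>g. g \<in> S \<Longrightarrow> b g \<in> A4" by (rule A4_generatedE[OF fin y]) blast
  have "x + y = (\<Sum>g\<in>S. (a g + b g) * g)"
    unfolding a b by (simp add: distrib_right sum.distrib)
  also have "\<dots> \<in> A4_generated S"
    using a(2) b(2) cfun.subspace_add[OF subspace_rel_inv[of 0, folded A4_rel_inv]] by (intro A4_generatedI fin) blast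
  finally show "x + y \<in> A4_generated S" .
qed

lemma A4_generated_mult:
  assumes fin: "finite S" and a: "a \<in> A4" and f: "f \<in> A4_generated S"
  shows "a * f \<in> A4_generated S"
proof -
  obtain b where b: "f = (\<Sum>g\<in>S. b g * g)" "\<And>g. g \<in> S \<Longrightarrow> b g \<in> A4" by (rule A4_generatedE[OF fin f]) blast
  have "a * f = (\<Sum>g\<in>S. (a * b g) * g)" unfolding b by (simp add: sum_distrib_left mult.assoc)
  also have "\<dots> \<in> A4_generated S"
    using b(2) rel_inv_mult[of a _ 0] a unfolding A4_rel_inv by (intro A4_generatedI[unfolded A4_rel_inv] fin) blast
  finally show ?thesis .
qed

text \<open>\<open>rel_mono 0 0\<close> is the unit of the coordinate ring: it is 1 on
  \<open>M4\<close> and 0 outside, unlike the constant function 1.\<close>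

lemma rel_mono_zero_mult: "rel_mono 1 E = rel_mono 0 0 * rel_mono 1 E"
proof -
  have "rel_mono 0 0 * rel_mono 1 E = dC_monom 0 0 * rel_mono 1 E"
    by (simp add: rel_mono_def mono_at_def outd_def ind_def zero_fun_def)
  also have "\<dots> = rel_mono 1 E"
    unfolding rel_mono_def mono_at_def dC_monom_mult by simp
  finally show ?thesis by simp
qed

lemma rel_adm_zero: "rel_adm 0 0"
  by (simp add: rel_adm_def loopless_def ind_def)

text \<open>The graded Nakayama argument as an induction on the number of edges: a decomposable
  graph is an absolute invariant times a graph with fewer edges.\<close>

lemma A4_generated_gdig: "A4_generated (rel_mono 1 ` gdig) = W4"
proof
  let ?S = "rel_mono 1 ` gdig"
  have fin: "finite ?S" using finite_gdig by simp
  show "A4_generated ?S \<subseteq> W4"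
  proof
    fix f assume "f \<in> A4_generated ?S"
    then obtain a where a: "f = (\<Sum>g\<in>?S. a g * g)" "\<forall>g\<in>?S. a g \<in> A4" unfolding A4_generated_finite[OF fin] by blast
    have "?S \<subseteq> W4" using rel_mono_W4 gdig_adm by (auto simp: W4_deg_def)
    then show "f \<in> W4" unfolding a(1) using a(2) rel_inv_mult[of _ _ 1]
      unfolding A4_rel_inv W4_rel_inv by (intro cfun.subspace_sum[OF subspace_rel_inv]) auto
  qed
  have one: "rel_mono 0 0 \<in> A4" using rel_mono_A4[OF rel_adm_zero] by (simp add: A4_deg_def)
  have gen: "rel_mono 1 E \<in> A4_generated ?S" if "E \<in> gdig" for E
  proof -
    have "rel_mono 1 E = (\<Sum>g\<in>{rel_mono 1 E}. rel_mono 0 0 * g)" using rel_mono_zero_mult[of E] by simp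
    then show ?thesis
      unfolding A4_generated_def using that one
      by (intro CollectI exI[of _ "{rel_mono 1 E}"] exI[of _ "\<lambda>_. rel_mono 0 0"]) auto
  qed
  have "rel_mono 1 E \<in> A4_generated ?S" if "rel_adm 1 E" for E
    using that
  proof (induction "edges E" arbitrary: E rule: less_induct)
    case less
    have "rel_mono 1 F \<in> A4_generated ?S" if F: "decomposable F" "edges F = edges E" for F
    proof -
      obtain B G where BG: "F = B + G" "rel_adm 0 B" "0 < edges B" "rel_adm 1 G"
        using F(1) by (auto simp: decomposable_def)
      then have "edges G < edges E" using F(2) by (simp add: edges_add flip: F(2))
      then have "rel_mono 1 G \<in> A4_generated ?S" using less.hyps BG(4) by blast
      moreover have "rel_mono 0 B \<in> A4" using rel_mono_A4[OF BG(2)] by (simp add: A4_deg_def)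
      moreover have "rel_mono 1 F = rel_mono 0 B * rel_mono 1 G" using BG by (simp add: rel_mono_mult)
      ultimately show ?thesis using A4_generated_mult[OF fin] by simp
    qed
    then have "cfun.span (rel_mono 1 ` ({F \<in> gdig. edges F = edges E} \<union> {F. decomposable F \<and> edges F = edges E})) \<subseteq> A4_generated ?S"
      using gen by (intro cfun.span_minimal subspace_A4_generated fin) auto
    then show ?case using W4_deg_reduce[of "edges E"] rel_mono_W4[OF less.prems] by blast
  qed
  then show "W4 \<subseteq> A4_generated ?S"
    unfolding W4_rel_inv rel_inv_eq by (intro cfun.span_minimal subspace_A4_generated fin) auto
qed

text \<open>The only graph without edges is the empty one, so the absolute invariants of degree 0
  are the constants on \<open>M4\<close>.\<close>

lemma A4_constant_part:
  assumes "a \<in> A4"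
  obtains c a' where "a' \<in> A4_plus" "a = cscale c (rel_mono 0 0) + a'"
proof -
  have "E = 0" if "edges E = 0" for E
    using that by (auto simp: edges_def ind_def fun_eq_iff)
  then have "{E. rel_adm 0 E} \<subseteq> {0} \<union> {E. rel_adm 0 E \<and> edges E > 0}" by blast
  then have "A4 \<subseteq> cfun.span (rel_mono 0 ` ({0} \<union> {E. rel_adm 0 E \<and> edges E > 0}))"
    unfolding A4_rel_inv rel_inv_eq by (intro cfun.span_mono image_mono)
  then have "a \<in> cfun.span ({rel_mono 0 0} \<union> rel_mono 0 ` {E. rel_adm 0 E \<and> edges E > 0})"
    using assms by auto
  then obtain x y where "x \<in> cfun.span {rel_mono 0 0}" "y \<in> A4_plus" "a = x + y"
    unfolding cfun.span_Un A4_plus_eq by blast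
  then show ?thesis using that by (auto simp: cfun.span_singleton)
qed

text \<open>If a missing generator were an \<open>A4\<close>-combination of the others, reducing the
  coefficients modulo \<open>A4_plus\<close> to constants would give a linear relation modulo
  \<open>A4_plus_W4\<close> with coefficient 1 at \<open>E0\<close>, against
  \<open>gdig_independent\<close>.\<close>

lemma gdig_minimal:
  assumes S': "S' \<subset> rel_mono 1 ` gdig"
  shows "A4_generated S' \<noteq> W4"
proof
  assume gen: "A4_generated S' = W4"
  have fin: "finite S'" using finite_gdig S' by (meson finite_imageI finite_subset psubset_imp_subset)
  obtain E0 where E0: "E0 \<in> gdig" "rel_mono 1 E0 \<notin> S'" using S' by blast
  define T where "T = {E \<in> gdig. rel_mono 1 E \<in> S'}"
  have T: "S' = rel_mono 1 ` T" "inj_on (rel_mono 1) T"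
    using S' inj_on_rel_mono by (auto simp: T_def intro: inj_on_subset)
  have "rel_mono 1 E0 \<in> W4" using rel_mono_W4[OF gdig_adm[OF E0(1)]] by (simp add: W4_deg_def)
  then obtain a where a: "rel_mono 1 E0 = (\<Sum>g\<in>S'. a g * g)" "\<forall>g\<in>S'. a g \<in> A4"
    unfolding gen[symmetric] A4_generated_finite[OF fin] by blast
  have "\<forall>g\<in>S'. \<exists>c a'. a' \<in> A4_plus \<and> a g = cscale c (rel_mono 0 0) + a'"
    using a(2) by (metis A4_constant_part)
  then obtain c a' where ca: "\<And>g. g \<in> S' \<Longrightarrow> a' g \<in> A4_plus" "\<And>g. g \<in> S' \<Longrightarrow> a g = cscale (c g) (rel_mono 0 0) + a' g"
    by metis
  define b where "b E = (if E = E0 then 1 else if E \<in> T then - c (rel_mono 1 E) else 0)" for E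
  have E0T: "E0 \<notin> T" using E0 by (simp add: T_def)
  have sc: "cscale x (rel_mono 0 0) * rel_mono 1 E = cscale x (rel_mono 1 E)" for x E
    using rel_mono_zero_mult[of E] by (auto simp: cscale_def fun_eq_iff)
  have "rel_mono 1 E0 = (\<Sum>E\<in>T. a (rel_mono 1 E) * rel_mono 1 E)"
    unfolding a(1) T(1) sum.reindex[OF T(2)] by simp
  also have "\<dots> = (\<Sum>E\<in>T. cscale (c (rel_mono 1 E)) (rel_mono 1 E)) + (\<Sum>E\<in>T. a' (rel_mono 1 E) * rel_mono 1 E)"
    unfolding sum.distrib[symmetric]
  proof (rule sum.cong[OF refl])
    fix E assume "E \<in> T"
    then have "rel_mono 1 E \<in> S'" by (simp add: T_def)
    then show "a (rel_mono 1 E) * rel_mono 1 E = cscale (c (rel_mono 1 E)) (rel_mono 1 E) + a' (rel_mono 1 E) * rel_mono 1 E"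
      using ca(2) by (simp only: distrib_right sc)
  qed
  finally have eq: "(\<Sum>E\<in>T. a' (rel_mono 1 E) * rel_mono 1 E) = rel_mono 1 E0 - (\<Sum>E\<in>T. cscale (c (rel_mono 1 E)) (rel_mono 1 E))"
    by simp
  have "(\<Sum>E\<in>T. a' (rel_mono 1 E) * rel_mono 1 E) \<in> A4_plus_W4"
  proof -
    have "a' (rel_mono 1 E) * rel_mono 1 E \<in> A4_plus_W4" if "E \<in> T" for E
    proof -
      have "rel_mono 1 E \<in> S'" "E \<in> gdig" using that by (auto simp: T_def)
      then have "a' (rel_mono 1 E) \<in> A4_plus" "rel_mono 1 E \<in> W4"
        using ca(1) rel_mono_W4[OF gdig_adm] by (auto simp: W4_deg_def)
      then show ?thesis unfolding A4_plus_W4_def by (intro cfun.span_base) blast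
    qed
    then show ?thesis unfolding A4_plus_W4_def by (intro cfun.span_sum)
  qed
  moreover have "rel_mono 1 E0 - (\<Sum>E\<in>T. cscale (c (rel_mono 1 E)) (rel_mono 1 E)) = (\<lambda>z. \<Sum>E\<in>gdig. b E * rel_mono 1 E z)"
  proof
    fix z
    have "(\<Sum>E\<in>gdig. b E * rel_mono 1 E z) = (\<Sum>E\<in>insert E0 T. b E * rel_mono 1 E z)"
      using E0 by (intro sum.mono_neutral_right finite_gdig) (auto simp: b_def T_def)
    also have "\<dots> = rel_mono 1 E0 z + (\<Sum>E\<in>T. b E * rel_mono 1 E z)"
      using E0T finite_gdig by (subst sum.insert) (auto simp: b_def T_def)
    also have "(\<Sum>E\<in>T. b E * rel_mono 1 E z) = (\<Sum>E\<in>T. - (c (rel_mono 1 E) * rel_mono 1 E z))"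
      using E0T by (intro sum.cong) (auto simp: b_def)
    finally show "(rel_mono 1 E0 - (\<Sum>E\<in>T. cscale (c (rel_mono 1 E)) (rel_mono 1 E))) z = (\<Sum>E\<in>gdig. b E * rel_mono 1 E z)"
      by (simp add: sum_fun_apply cscale_def sum_negf)
  qed
  ultimately have "(\<lambda>z. \<Sum>E\<in>gdig. b E * rel_mono 1 E z) \<in> A4_plus_W4" using eq by simp
  then have "b E0 = 0" using gdig_independent[of b] E0(1) by blast
  then show False by (simp add: b_def)
qed

lemma card_rel_mono_image: "T \<subseteq> gdig \<Longrightarrow> card (rel_mono 1 ` T) = card T"
  using inj_on_rel_mono by (intro card_image) (rule inj_on_subset)

lemma rel_mono_image_W4_deg:
  assumes "T \<subseteq> gdig" "\<And>E. E \<in> T \<Longrightarrow> edges E = k"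
  shows "rel_mono 1 ` T \<subseteq> W4_deg k"
  using assms rel_mono_W4 gdig_adm by blast

theorem theorem4p4:
  shows "quot.dim (Q4_deg 0) = 1 \<and> quot.dim (Q4_deg 1) = 8 \<and>
         quot.dim (Q4_deg 2) = 18 \<and> quot.dim (Q4_deg 3) = 12 \<and>
         (\<forall>k\<ge>4. Q4_deg k = {0}) \<and>
         quot.dim Q4 = 39 \<and>
         minimal_homogeneous_generating_system (gens0 \<union> gens1 \<union> (gens2_G \<union> gens2_H) \<union> gens3) \<and>
         gens0 \<subseteq> W4_deg 0 \<and> card gens0 = 1 \<and>
         gens1 \<subseteq> W4_deg 1 \<and> card gens1 = 8 \<and>
         gens2_G \<union> gens2_H \<subseteq> W4_deg 2 \<and> card gens2_G = 12 \<and> card gens2_H = 6 \<and>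
         card (gens2_G \<union> gens2_H) = 18 \<and>
         gens3 \<subseteq> W4_deg 3 \<and> card gens3 = 12"
proof (intro conjI)
  show "quot.dim (Q4_deg 0) = 1" "quot.dim (Q4_deg 1) = 8" "quot.dim (Q4_deg 2) = 18" "quot.dim (Q4_deg 3) = 12"
    unfolding dim_Q4_deg gdig_homogeneous by (simp_all add: card_gdig1 card_gdig2 card_gdig3)
  show "\<forall>k\<ge>4. Q4_deg k = {0}"
  proof (intro allI impI)
    fix k :: nat assume k: "4 \<le> k"
    have "Q4_deg k \<subseteq> {0}"
      using quot.span_superset[of "Q4_deg k"] unfolding Q4_deg_span[symmetric] gdig_homogeneous(5)[OF k] by simp
    moreover have "0 \<in> W4_deg k" unfolding W4_deg_eq by (rule cfun.span_zero)
    then have "0 \<in> Q4_deg k" unfolding Q4_deg_def using coset_of_zero by (metis image_eqI)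
    ultimately show "Q4_deg k = {0}" by blast
  qed
  show "quot.dim Q4 = 39" by (simp add: dim_Q4 card_gdig)
  have sub: "{0} \<subseteq> gdig" "gdig1 \<subseteq> gdig" "gdig2_G \<subseteq> gdig" "gdig2_H \<subseteq> gdig" "gdig2_G \<union> gdig2_H \<subseteq> gdig" "gdig3 \<subseteq> gdig"
    by (auto simp: gdig_def)
  note gens = gens0_eq gens1_eq gens2_G_eq gens2_H_eq gens3_eq
  have all: "gens0 \<union> gens1 \<union> (gens2_G \<union> gens2_H) \<union> gens3 = rel_mono 1 ` gdig"
    unfolding gens gdig_def by (simp only: image_Un)
  show "minimal_homogeneous_generating_system (gens0 \<union> gens1 \<union> (gens2_G \<union> gens2_H) \<union> gens3)"
    unfolding minimal_homogeneous_generating_system_def all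
    using A4_generated_gdig gdig_minimal rel_mono_W4 gdig_adm by blast
  show "gens0 \<subseteq> W4_deg 0" "gens1 \<subseteq> W4_deg 1" "gens3 \<subseteq> W4_deg 3"
    unfolding gens using edges_gdig by (intro rel_mono_image_W4_deg sub; blast)+
  show "gens2_G \<union> gens2_H \<subseteq> W4_deg 2"
    unfolding gens image_Un[symmetric] using edges_gdig by (intro rel_mono_image_W4_deg sub) auto
  show "card (gens2_G \<union> gens2_H) = 18"
    unfolding gens image_Un[symmetric] card_rel_mono_image[OF sub(5)] by (rule card_gdig2)
  show "card gens0 = 1" "card gens1 = 8" "card gens2_G = 12" "card gens2_H = 6" "card gens3 = 12"
    unfolding gens by (simp_all add: card_rel_mono_image sub card_gdig1 card_gdig2_G card_gdig2_H card_gdig3)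
qed

end
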